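(* Let $N$ be a free $\mathbf Z$-module of finite rank with basis $(\lambda_i)_{i\in I}$, $\Lambda\subset N_{\mathbf R}$ the cone generated by this basis, $M\subset N$ a subgroup such that $\Gamma=N/M$ is torsion-free, $j:N\to\Gamma$ the quotient map, and $N'\subset N$ a subgroup of finite index. Let $a:\Lambda\cap N\to\mathbf C$ and $\varepsilon>0$ be such that the series defining $\mathcal L_{N,\Lambda,a}(q^{-s})$ converges absolutely for all $s\in\mathcal T(\Lambda^\vee_{>-\varepsilon})$. For $s\in\mathcal T(\Lambda^\vee_{>0})$ put $$f_2(s)=\int_{\Gamma^\vee_{\mathbf U}}\mathcal L_{N,\Lambda,a}\bigl(j^\vee_{\mathbf U}(z)\,q^{-s}\bigr)\,\mathcal L_{N',\Lambda}\bigl(j^\vee_{\mathbf U}(z)\,q^{-s}\bigr)\,dz .$$ Assume $\Gamma^\vee\cap\Lambda^\vee=\{0\}$. 1. There exists a function $g$, admissible of multiplicity at least $0$, such that the function $s\mapsto f_2(s)-g(s)\,\mathcal L_{N',\Lambda\cap M_{\mathbf R}}(q^{-s})$ is admissible of multiplicity at least $1-\mathrm{rk}(M)$. 2. Assume moreover that for every $y\in\Lambda\cap N$, if $a_y\neq0$ then $j(y)\in j(N')$. Then $g$ can be chosen so that $g(0)=\mathcal L_{N,\Lambda,a}(1)$.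
   Context: $q$ is the cardinality of a fixed finite field. For a $\mathbf Z$-module $N$ write $N^\vee=\mathrm{Hom}(N,\mathbf Z)$, $N_A=N\otimes A$. $(\lambda_i^\vee)$ is the basis dual to $(\lambda_i)$; $\Lambda^\vee\subset N^\vee_{\mathbf R}$ is the dual cone of $\Lambda$; for real $\eta$, $\Lambda^\vee_{>\eta}=\sum_{i\in I}\mathbf R_{>\eta}\lambda_i^\vee$; for $U\subset N^\vee_{\mathbf R}$, $\mathcal T(U)=\{s\in N^\vee_{\mathbf C}:\Re(s)\in U\}$. $\mathbf U$ is the group of complex numbers of modulus $1$; $N^\vee_{\mathbf U}=\mathrm{Hom}(N,\mathbf U)$, $N^\vee_{\mathbf C^\times}=\mathrm{Hom}(N,\mathbf C^\times)$, with pairing $\langle z,y\rangle=z(y)$. For $s\in N^\vee_{\mathbf C}$, $q^{-s}\in N^\vee_{\mathbf C^\times}$ is $y\mapsto q^{-\langle y,s\rangle}$. For $A\subset N_{\mathbf R}$ and $a:A\cap N\to\mathbf C$, $\mathcal L_{N,A,a}(z)=\sum_{y\in A\cap N}a_y\langle z,y\rangle$ for those $z\in N^\vee_{\mathbf C^\times}$ for which this converges absolutely; $\mathcal L_{N,A}$ is the case $a\equiv1$. For a subgroup $N'\subset N$, $\mathcal L_{N',A}(z)=\sum_{y\in A\cap N'}\langle z,y\rangle$. Thus $\mathcal L_{N,\Lambda,a}(1)=\sum_{y\in\Lambda\cap N}a_y$. $j^\vee:\Gamma^\vee\hookrightarrow N^\vee$ is dual to $j$ (through it $\Gamma^\vee$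 is viewed inside $N^\vee$); $j^\vee_{\mathbf U}:\Gamma^\vee_{\mathbf U}\to N^\vee_{\mathbf U}$ is the induced map; $dz$ is the Haar measure of total mass $1$ on $\Gamma^\vee_{\mathbf U}$. Admissible functions. An elementary admissible function of multiplicity at least $0$ is a function $s\mapsto\mathcal L_{N,\Lambda,b}(q^{-s})$ where $b:\Lambda\cap N\to\mathbf C$ is such that for some $\eta>0$ the series converges absolutely for all $s\in\mathcal T(\Lambda^\vee_{>-\eta})$ (it is then holomorphic on that domain). For an integer $r\ge1$, an elementary admissible function of multiplicity at least $-r$ is a holomorphic function $f$ on $\mathcal T(\Lambda^\vee_{>0})$ that can be written $f(s)=g(s)\,\mathcal L_{N'',\mathrm{relint}(\Upsilon)}(q^{-s})$ with $\Upsilon\subset\Lambda$ a (rational polyhedral) cone of dimension at most $r$, $\mathrm{relint}(\Upsilon)$ its relative interior, $N''$ a subgroup of $N$, and $g$ elementary admissible of multiplicity at least $0$. For $r\ge0$, a function admissible of multiplicity at least $-r$ is a finite sum of elementary admissible functions of multiplicity at least $-r$. *)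

theory Defs
  imports "HOL-Analysis.Analysis" "HOL-Library.Set_Algebras"
begin

text \<open>
  The real vector space \<open>N\<^sub>R\<close> is a normed type \<open>'v\<close> (possibly of dimension \<open>0\<close>) with basis
  \<open>(lam i)\<close>, \<open>i \<in> I\<close>, \<open>I\<close> finite; the norm only serves to provide the canonical topology. \<open>N\<close> is the
  subgroup generated by the basis. The duals \<open>N\<^sup>\<or>\<^sub>R\<close> and \<open>N\<^sup>\<or>\<^sub>C\<close> are the spaces of real-linear
  maps from \<open>'v\<close> to the reals, resp. to the complex numbers.
\<close>

definition real_basis :: "'i set \<Rightarrow> ('i \<Rightarrow> 'v::real_vector) \<Rightarrow> bool" where
  "real_basis I lam \<longleftrightarrow>
     finite I \<and> inj_on lam I \<and> independent (lam ` I) \<and> span (lam ` I) = UNIV"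

definition lattice_of :: "'i set \<Rightarrow> ('i \<Rightarrow> 'v::real_vector) \<Rightarrow> 'v set" where
  "lattice_of I lam = {y. \<exists>m :: 'i \<Rightarrow> int. y = (\<Sum>i\<in>I. of_int (m i) *\<^sub>R lam i)}"

definition basis_cone :: "'i set \<Rightarrow> ('i \<Rightarrow> 'v::real_vector) \<Rightarrow> 'v set" where
  "basis_cone I lam = convex_cone hull (lam ` I)"

definition subgroup_of :: "'v::ab_group_add set \<Rightarrow> 'v set \<Rightarrow> bool" where
  "subgroup_of H N \<longleftrightarrow> H \<subseteq> N \<and> 0 \<in> H \<and> (\<forall>x\<in>H. \<forall>y\<in>H. x - y \<in> H)"

text \<open>The group structure of the quotient is the elementwise sum of cosets, with zero \<open>M\<close>.\<close>

definition quot_group :: "'v::ab_group_add set \<Rightarrow> 'v set \<Rightarrow> 'v set set" where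
  "quot_group N M = (\<lambda>x. x +o M) ` N"

definition finite_index :: "'v::ab_group_add set \<Rightarrow> 'v set \<Rightarrow> bool" where
  "finite_index H N \<longleftrightarrow> finite (quot_group N H)"

definition torsion_free_quot :: "'v::real_vector set \<Rightarrow> 'v set \<Rightarrow> bool" where
  "torsion_free_quot N M \<longleftrightarrow>
     (\<forall>x\<in>N. \<forall>k::nat. k > 0 \<and> (of_nat k *\<^sub>R x) +o M = M \<longrightarrow> x +o M = M)"

definition quot_dual_int :: "'v::ab_group_add set \<Rightarrow> 'v set \<Rightarrow> ('v set \<Rightarrow> int) set" where
  "quot_dual_int N M = {\<phi> \<in> extensional (quot_group N M).
     \<forall>A\<in>quot_group N M. \<forall>B\<in>quot_group N M. \<phi> (A + B) = \<phi> A + \<phi> B}"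

definition quot_dual_in_real_dual ::
    "'v::real_normed_vector set \<Rightarrow> 'v set \<Rightarrow> ('v \<Rightarrow>\<^sub>L real) set" where
  "quot_dual_in_real_dual N M =
     {u. \<exists>\<phi>\<in>quot_dual_int N M. \<forall>y\<in>N. blinfun_apply u y = of_int (\<phi> (y +o M))}"

definition dual_cone :: "'v::real_normed_vector set \<Rightarrow> ('v \<Rightarrow>\<^sub>L real) set" where
  "dual_cone C = {u. \<forall>x\<in>C. blinfun_apply u x \<ge> 0}"

definition dual_vec ::
    "'i set \<Rightarrow> ('i \<Rightarrow> 'v::real_normed_vector) \<Rightarrow> 'i \<Rightarrow> ('v \<Rightarrow>\<^sub>L real)" where
  "dual_vec I lam i = Blinfun (\<lambda>x. representation (lam ` I) x (lam i))"

lemma coefficients_bounded: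
  fixes B :: "'v::real_normed_vector set"
  assumes "finite B" "independent B"
  shows "\<exists>C\<ge>0. \<forall>c. \<forall>b\<in>B. \<bar>c b\<bar> \<le> C * norm (\<Sum>b\<in>B. c b *\<^sub>R b)"
  using assms
proof (induction B rule: finite_induct)
  case empty
  then show ?case by (auto intro: exI[of _ 0])
next
  case (insert b0 B)
  have indB: "independent B" using insert.prems independent_mono by blast
  have b0: "b0 \<notin> span B" using insert by (simp add: independent_insert)
  obtain C where C: "C \<ge> 0" "\<And>c b. b \<in> B \<Longrightarrow> \<bar>c b\<bar> \<le> C * norm (\<Sum>b\<in>B. c b *\<^sub>R b)"
    using insert.IH indB by blast
  have "\<exists>d>0. \<forall>c. d \<le> norm (b0 - (\<Sum>b\<in>B. c b *\<^sub>R b))"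
  proof (rule ccontr)
    assume "\<not> ?thesis"
    then have "\<forall>n::nat. \<exists>c. norm (b0 - (\<Sum>b\<in>B. c b *\<^sub>R b)) < inverse (real (Suc n))"
      by (metis inverse_positive_iff_positive linorder_not_less of_nat_0_less_iff zero_less_Suc)
    then obtain c where c: "\<And>n. norm (b0 - (\<Sum>b\<in>B. c n b *\<^sub>R b)) < inverse (real (Suc n))"
      by metis
    define v where "v n = (\<Sum>b\<in>B. c n b *\<^sub>R b)" for n
    have "(\<lambda>n. b0 - v n) \<longlonglongrightarrow> 0"
      by (rule Lim_null_comparison[OF _ LIMSEQ_inverse_real_of_nat])
         (use c in \<open>auto simp: v_def intro!: always_eventually less_imp_le\<close>)
    then have "(\<lambda>n. b0 - (b0 - v n)) \<longlonglongrightarrow> b0 - 0" by (intro tendsto_intros)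
    then have v: "v \<longlonglongrightarrow> b0" by simp
    have diff: "\<bar>c m b - c n b\<bar> \<le> C * norm (v m - v n)" if "b \<in> B" for b m n
      using C(2)[OF that, of "\<lambda>b. c m b - c n b"]
      by (simp add: v_def scaleR_left_diff_distrib sum_subtractf)
    have "convergent (\<lambda>n. c n b)" if b: "b \<in> B" for b
    proof -
      have "Cauchy (\<lambda>n. c n b)"
      proof (rule metric_CauchyI)
        fix e :: real assume e: "e > 0"
        have "Cauchy v" using v LIMSEQ_imp_Cauchy by blast
        moreover have "e / (C + 1) > 0" using e C(1) by simp
        ultimately obtain K where K: "\<forall>m\<ge>K. \<forall>n\<ge>K. dist (v m) (v n) < e / (C + 1)"
          using metric_CauchyD by blast
        show "\<exists>K. \<forall>m\<ge>K. \<forall>n\<ge>K. dist (c m b) (c n b) < e"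
        proof (intro exI allI impI)
          fix m n assume "K \<le> m" "K \<le> n"
          then have "norm (v m - v n) < e / (C + 1)" using K by (simp add: dist_norm)
          then have "C * norm (v m - v n) \<le> C * (e / (C + 1))"
            using C(1) by (intro mult_left_mono) auto
          also have "\<dots> < e" using e C(1) by (simp add: field_simps)
          finally show "dist (c m b) (c n b) < e" using diff[OF b, of m n] by (simp add: dist_real_def)
        qed
      qed
      then show ?thesis by (simp add: Cauchy_convergent_iff)
    qed
    then have "\<forall>b\<in>B. \<exists>l. (\<lambda>n. c n b) \<longlonglongrightarrow> l" by (auto simp: convergent_def)
    then obtain l where l: "\<And>b. b \<in> B \<Longrightarrow> (\<lambda>n. c n b) \<longlonglongrightarrow> l b" by metis
    have "v \<longlonglongrightarrow> (\<Sum>b\<in>B. l b *\<^sub>R b)"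
      unfolding v_def by (intro tendsto_intros l)
    then have "b0 = (\<Sum>b\<in>B. l b *\<^sub>R b)" using v LIMSEQ_unique by blast
    moreover have "(\<Sum>b\<in>B. l b *\<^sub>R b) \<in> span B"
      by (intro span_sum span_scale span_base)
    ultimately show False using b0 by simp
  qed
  then obtain d where d: "d > 0" "\<And>c. d \<le> norm (b0 - (\<Sum>b\<in>B. c b *\<^sub>R b))" by blast
  define C' where "C' = max (1 / d) (C * (1 + norm b0 / d))"
  show ?case
  proof (intro exI conjI allI ballI)
    show "0 \<le> C'" using d by (simp add: C'_def le_max_iff_disj)
    fix c b assume b: "b \<in> insert b0 B"
    let ?v = "\<Sum>b\<in>B. c b *\<^sub>R b"
    let ?t = "c b0 *\<^sub>R b0 + ?v"
    have t: "(\<Sum>b\<in>insert b0 B. c b *\<^sub>R b) = ?t" using insert.hyps by simp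
    have c0: "\<bar>c b0\<bar> \<le> 1 / d * norm ?t"
    proof (cases "c b0 = 0")
      case True
      then show ?thesis using d by simp
    next
      case False
      have "?t = c b0 *\<^sub>R (b0 - (\<Sum>b\<in>B. (- c b / c b0) *\<^sub>R b))"
        using False by (simp add: scaleR_right_diff_distrib scaleR_add_right scaleR_sum_right sum_negf)
      then have "norm ?t \<ge> \<bar>c b0\<bar> * d" by (simp only: norm_scaleR mult_left_mono[OF d(2) abs_ge_zero])
      then show ?thesis using d(1) by (simp add: field_simps)
    qed
    have "norm ?v \<le> norm ?t + \<bar>c b0\<bar> * norm b0"
      using norm_triangle_ineq4[of ?t "c b0 *\<^sub>R b0"] by simp
    also have "\<dots> \<le> norm ?t + 1 / d * norm ?t * norm b0"
      using c0 by (intro add_left_mono mult_right_mono) auto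
    finally have v: "norm ?v \<le> (1 + norm b0 / d) * norm ?t" by (simp add: field_simps)
    have *: "1 / d * norm ?t \<le> C' * norm ?t" "C * (1 + norm b0 / d) * norm ?t \<le> C' * norm ?t"
      by (intro mult_right_mono; simp add: C'_def)+
    have "\<bar>c b\<bar> \<le> C' * norm ?t"
    proof (cases "b = b0")
      case True
      show ?thesis unfolding True by (rule order_trans[OF c0 *(1)])
    next
      case False
      then have "\<bar>c b\<bar> \<le> C * norm ?v" using C(2) b by blast
      also have "\<dots> \<le> C * ((1 + norm b0 / d) * norm ?t)" using v C(1) by (intro mult_left_mono)
      finally show ?thesis using *(2) by (simp add: mult.assoc)
    qed
    then show "\<bar>c b\<bar> \<le> C' * norm (\<Sum>b\<in>insert b0 B. c b *\<^sub>R b)" by (simp only: t)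
  qed
qed

lemma dual_vec_basis:
  fixes lam :: "'i \<Rightarrow> 'v::real_normed_vector"
  assumes "real_basis I lam" "i \<in> I" "k \<in> I"
  shows "blinfun_apply (dual_vec I lam i) (lam k) = (if k = i then 1 else 0)"
proof -
  let ?B = "lam ` I"
  have B: "finite ?B" "independent ?B" "span ?B = UNIV" "inj_on lam I"
    using assms by (auto simp: real_basis_def)
  obtain C where C: "C \<ge> 0" "\<And>c b. b \<in> ?B \<Longrightarrow> \<bar>c b\<bar> \<le> C * norm (\<Sum>b\<in>?B. c b *\<^sub>R b)"
    using coefficients_bounded[OF B(1,2)] by blast
  have "bounded_linear (\<lambda>x. representation ?B x (lam i))"
  proof (rule bounded_linear_intro[where K = C])
    fix x
    have "(\<Sum>b\<in>?B. representation ?B x b *\<^sub>R b) = x"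
      using B by (intro real_vector.sum_representation_eq) auto
    then show "norm (representation ?B x (lam i)) \<le> norm x * C"
      using C(2)[of "lam i" "representation ?B x"] assms by (simp add: mult.commute)
  qed (use B in \<open>simp_all add: real_vector.representation_add real_vector.representation_scale\<close>)
  then have "blinfun_apply (dual_vec I lam i) (lam k) = representation ?B (lam k) (lam i)"
    by (simp add: dual_vec_def bounded_linear_Blinfun_apply)
  also have "\<dots> = (if k = i then 1 else 0)"
    using B assms by (auto simp: real_vector.representation_basis inj_on_eq_iff)
  finally show ?thesis .
qed

definition dual_cone_gt ::
    "'i set \<Rightarrow> ('i \<Rightarrow> 'v::real_normed_vector) \<Rightarrow> real \<Rightarrow> ('v \<Rightarrow>\<^sub>L real) set" where
  "dual_cone_gt I lam \<eta> =
     {u. \<exists>c. (\<forall>i\<in>I. c i > \<eta>) \<and> u = (\<Sum>i\<in>I. c i *\<^sub>R dual_vec I lam i)}"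

definition tube :: "('v::real_normed_vector \<Rightarrow>\<^sub>L real) set \<Rightarrow> ('v \<Rightarrow>\<^sub>L complex) set" where
  "tube U = {s. Blinfun (\<lambda>x. Re (blinfun_apply s x)) \<in> U}"

definition q_neg :: "nat \<Rightarrow> ('v::real_normed_vector \<Rightarrow>\<^sub>L complex) \<Rightarrow> 'v \<Rightarrow> complex" where
  "q_neg q s = (\<lambda>y. of_nat q powr (- blinfun_apply s y))"

text \<open>
  Elements of \<open>Hom(N, C\<^sup>\<times>)\<close> are given as functions on \<open>'v\<close>, of which only the values on \<open>N\<close> matter.
  For complex-valued families \<open>summable_on\<close> is absolute convergence; without it \<open>infsum\<close> is \<open>0\<close>.
\<close>

definition Lser :: "'v set \<Rightarrow> 'v set \<Rightarrow> ('v \<Rightarrow> complex) \<Rightarrow> ('v \<Rightarrow> complex) \<Rightarrow> complex" where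
  "Lser N A a z = (\<Sum>\<^sub>\<infinity>y\<in>A \<inter> N. a y * z y)"

definition Lconv :: "'v set \<Rightarrow> 'v set \<Rightarrow> ('v \<Rightarrow> complex) \<Rightarrow> ('v \<Rightarrow> complex) \<Rightarrow> bool" where
  "Lconv N A a z \<longleftrightarrow> (\<lambda>y. norm (a y * z y)) summable_on (A \<inter> N)"

text \<open>Complex Frechet differentiability; the complex structure of \<open>N\<^sup>\<or>\<^sub>C\<close> is that of the values.\<close>

definition dual_holomorphic_on ::
    "(('v::real_normed_vector \<Rightarrow>\<^sub>L complex) \<Rightarrow> complex) \<Rightarrow> ('v \<Rightarrow>\<^sub>L complex) set \<Rightarrow> bool" where
  "dual_holomorphic_on f D \<longleftrightarrow>
     (\<forall>s\<in>D. \<exists>f'. (f has_derivative f') (at s within D) \<and>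
        (\<forall>c h. f' (blinfun_mult_right c o\<^sub>L h) = c * f' h))"

definition rational_polyhedral_cone :: "'v::real_vector set \<Rightarrow> 'v set \<Rightarrow> bool" where
  "rational_polyhedral_cone N C \<longleftrightarrow> (\<exists>S. finite S \<and> S \<subseteq> N \<and> C = convex_cone hull S)"

definition elementary_admissible0 ::
    "'i set \<Rightarrow> ('i \<Rightarrow> 'v::real_normed_vector) \<Rightarrow> nat \<Rightarrow> (('v \<Rightarrow>\<^sub>L complex) \<Rightarrow> complex) \<Rightarrow> bool" where
  "elementary_admissible0 I lam q f \<longleftrightarrow>
     (\<exists>b. (\<exists>\<eta>>0. \<forall>s\<in>tube (dual_cone_gt I lam (-\<eta>)).
              Lconv (lattice_of I lam) (basis_cone I lam) b (q_neg q s)) \<and>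
          f = (\<lambda>s. Lser (lattice_of I lam) (basis_cone I lam) b (q_neg q s)))"

text \<open>
  Multiplicity at least \<open>m\<close>, for an integer \<open>m \<le> 0\<close>. For \<open>m < 0\<close> only the values on the open tube
  over the interior of the dual cone are constrained, as this is the domain of the function. For
  \<open>m > 0\<close> there are no elementary admissible functions, and only \<open>0\<close> is admissible; in the theorem
  this happens only when \<open>N = 0\<close>.
\<close>

definition elementary_admissible ::
    "'i set \<Rightarrow> ('i \<Rightarrow> 'v::real_normed_vector) \<Rightarrow> nat \<Rightarrow> int \<Rightarrow>
     (('v \<Rightarrow>\<^sub>L complex) \<Rightarrow> complex) \<Rightarrow> bool" where
  "elementary_admissible I lam q m f \<longleftrightarrow>
     m = 0 \<and> elementary_admissible0 I lam q f \<or>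
     m < 0 \<and> dual_holomorphic_on f (tube (dual_cone_gt I lam 0)) \<and>
       (\<exists>g \<Upsilon> N''. elementary_admissible0 I lam q g \<and>
          rational_polyhedral_cone (lattice_of I lam) \<Upsilon> \<and> \<Upsilon> \<subseteq> basis_cone I lam \<and>
          int (dim \<Upsilon>) \<le> - m \<and> subgroup_of N'' (lattice_of I lam) \<and>
          (\<forall>s\<in>tube (dual_cone_gt I lam 0).
             f s = g s * Lser N'' (rel_interior \<Upsilon>) (\<lambda>_. 1) (q_neg q s)))"

definition admissible ::
    "'i set \<Rightarrow> ('i \<Rightarrow> 'v::real_normed_vector) \<Rightarrow> nat \<Rightarrow> int \<Rightarrow>
     (('v \<Rightarrow>\<^sub>L complex) \<Rightarrow> complex) \<Rightarrow> bool" where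
  "admissible I lam q m f \<longleftrightarrow>
     (\<exists>(n::nat) F. (\<forall>k<n. elementary_admissible I lam q m (F k)) \<and> f = (\<lambda>s. \<Sum>k<n. F k s))"

definition quot_dual_U :: "'v::ab_group_add set \<Rightarrow> 'v set \<Rightarrow> ('v set \<Rightarrow> complex) set" where
  "quot_dual_U N M = {z \<in> extensional (quot_group N M).
     (\<forall>A\<in>quot_group N M. norm (z A) = 1) \<and>
     (\<forall>A\<in>quot_group N M. \<forall>B\<in>quot_group N M. z (A + B) = z A * z B)}"

text \<open>
  The Haar probability measure on the Borel sets of the compact group \<open>Hom(N/M, U)\<close>, which carries
  the topology of pointwise convergence.
\<close>

definition haar_prob ::
    "'v::ab_group_add set \<Rightarrow> 'v set \<Rightarrow> ('v set \<Rightarrow> complex) measure \<Rightarrow> bool" where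
  "haar_prob N M \<mu> \<longleftrightarrow>
     emeasure \<mu> (space \<mu>) = 1 \<and> space \<mu> = quot_dual_U N M \<and>
     sets \<mu> = sigma_sets (quot_dual_U N M)
       {V. openin (subtopology (product_topology (\<lambda>_. euclidean) (quot_group N M))
                    (quot_dual_U N M)) V} \<and>
     (\<forall>w\<in>quot_dual_U N M. \<forall>E\<in>sets \<mu>.
        emeasure \<mu> ((\<lambda>z. restrict (\<lambda>\<gamma>. w \<gamma> * z \<gamma>) (quot_group N M)) ` E) = emeasure \<mu> E)"

end

theory Submission
  imports Defs
begin

text \<open>
  Write \<open>E(m)\<close> for \<open>q\<close> to the power \<open>-\<langle>m, s\<rangle>\<close>, and compare lattice points coordinate by coordinate.
  Integrating over the dual torus keeps exactly the pairs with \<open>x + y \<in> M\<close>; with \<open>m = x + y\<close> this says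
  that \<open>f\<^sub>2(s)\<close> is the sum of \<open>E(m)\<close> over the \<open>m\<close> in \<open>\<Lambda> \<inter> M\<close>, weighted by the finite sum of \<open>a x\<close> over
  the \<open>x \<le> m\<close> with \<open>m - x \<in> N'\<close> (\<open>torus_integral\<close>). One can treat the finitely many cosets \<open>\<kappa>\<close> of \<open>N'\<close>
  separately. For \<open>x \<in> \<kappa>\<close> the points \<open>m\<close> run over the elements \<open>\<ge> x\<close> of \<open>M \<inter> \<kappa>\<close>, which is empty or a
  coset of \<open>M' = M \<inter> N'\<close>.

  The hypothesis on the dual cones means, by an integral form of Gordan's alternative, that \<open>M\<close> has
  an element with all coordinates positive (\<open>gordan\<close>, \<open>interior_point\<close>). Adding a multiple of it
  produces, if there is a coset, a point \<open>p x \<ge> x\<close> in it, of size linear in that of \<open>x\<close>, with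
  \<open>p x + (M' \<inter> \<Lambda>) \<subseteq> {m. m \<ge> x}\<close>. These translates contribute the product of \<open>\<Sum> a x E(p x)\<close> with
  the generating function of \<open>M' \<inter> \<Lambda>\<close>. As \<open>N/M\<close> is torsion free, this is the generating function of
  \<open>N' \<inter> \<Lambda> \<inter> span M\<close> (\<open>saturated\<close>), and \<open>g\<close> is the sum of the first factors over all \<open>\<kappa>\<close>. Each first factor
  at \<open>s = 0\<close> is the sum of \<open>a x\<close> over the \<open>x \<in> \<kappa>\<close> that lie below some point of the coset;
  under the second hypothesis this is every \<open>x \<in> \<kappa>\<close> with \<open>a x \<noteq> 0\<close>.

  A point \<open>m \<ge> x\<close> outside the translate has some coordinate with \<open>x\<^sub>i \<le> m\<^sub>i < (p x)\<^sub>i\<close>. Fixing it leaves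
  the same problem with one more prescribed coordinate, and the bound on \<open>p x\<close> keeps the new coefficients
  exponentially summable (\<open>exp_summable_push\<close>). By induction on the number of free coordinates
  everything becomes a finite sum of summable coefficients convolved with the monoids \<open>face_monoid F\<close>
  of the elements of \<open>M' \<inter> \<Lambda>\<close> that vanish on \<open>F\<close> (\<open>slice_coeff_decomposition\<close>). The remainder
  consists of the terms with \<open>F \<noteq> {}\<close>; such a monoid omits the positive element of \<open>M\<close>, so it spans a
  space of smaller dimension, and cutting it into relative interiors of faces shows admissibility
  (\<open>rel_interior_face\<close>, \<open>face_monoid_admissible\<close>).

  Finiteness enters through Dickson's lemma, which bounds how far one must go to find a point with
  prescribed coordinates (\<open>linear_lower_point\<close>).
\<close>

section \<open>Coordinates on the lattice\<close>

lemma sum_Nats: "(\<And>i. i \<in> A \<Longrightarrow> f i \<in> \<nat>) \<Longrightarrow> (\<Sum>i\<in>A. f i) \<in> (\<nat> :: real set)"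
  by (induction A rule: infinite_finite_induct) auto

lemma nat_pos_ge_1: "x \<in> \<nat> \<Longrightarrow> x \<noteq> 0 \<Longrightarrow> (1::real) \<le> x"
  by (auto elim!: Nats_cases)

locale cone_lattice =
  fixes I :: "'i set" and lam :: "'i \<Rightarrow> 'v::real_normed_vector" and q :: nat
  assumes basis: "real_basis I lam" and q_ge_2: "2 \<le> q"
begin

text \<open>
  The functionals of the dual basis, shortened because every size estimate is read off coordinates.
\<close>

definition co :: "'i \<Rightarrow> 'v \<Rightarrow> real" where
  "co i y = blinfun_apply (dual_vec I lam i) y"

abbreviation "N \<equiv> lattice_of I lam"
abbreviation "\<Lambda> \<equiv> basis_cone I lam"

text \<open>
  The monoid over which all series run; in coordinates it consists of the vectors of natural numbers.
\<close>

definition P :: "'v set" where "P = \<Lambda> \<inter> N"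

text \<open>
  The weight that measures decay: on \<open>P\<close> a point \<open>s\<close> of the tube satisfies
  \<open>Re (s y) \<ge> \<delta> * deg y\<close> as soon as \<open>\<delta>\<close> bounds the values \<open>Re (s (lam i))\<close> from below.
\<close>

definition deg :: "'v \<Rightarrow> real" where "deg y = (\<Sum>i\<in>I. co i y)"

lemma finI: "finite I" and span_lam: "span (lam ` I) = UNIV"
  using basis by (auto simp: real_basis_def)

lemma co_lam: "i \<in> I \<Longrightarrow> k \<in> I \<Longrightarrow> co i (lam k) = (if k = i then 1 else 0)"
  unfolding co_def by (rule dual_vec_basis[OF basis])

lemma co_add [simp]: "co i (x + y) = co i x + co i y"
  and co_diff [simp]: "co i (x - y) = co i x - co i y"
  and co_minus [simp]: "co i (- x) = - co i x"
  and co_zero [simp]: "co i 0 = 0"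
  and co_scale [simp]: "co i (c *\<^sub>R x) = c * co i x"
  by (simp_all add: co_def blinfun.add_right blinfun.diff_right blinfun.minus_right
      blinfun.scaleR_right blinfun.zero_right)

lemma co_sum: "co i (\<Sum>x\<in>A. f x) = (\<Sum>x\<in>A. co i (f x))"
  by (simp add: co_def blinfun.sum_right)

lemma coordinate_expansion: "(\<Sum>i\<in>I. co i y *\<^sub>R lam i) = y"
proof -
  have "y \<in> span (lam ` I)" using span_lam by simp
  then show ?thesis
  proof (induction rule: span_induct_alt)
    case base then show ?case by simp
  next
    case (step c x y)
    then obtain k where k: "k \<in> I" "x = lam k" by blast
    have "(\<Sum>i\<in>I. co i x *\<^sub>R lam i) = (\<Sum>i\<in>I. if i = k then lam i else 0)"
      using k by (intro sum.cong) (auto simp: co_lam)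
    also have "\<dots> = x" using k finI by simp
    finally have x: "(\<Sum>i\<in>I. co i x *\<^sub>R lam i) = x" .
    have "(\<Sum>i\<in>I. co i (c *\<^sub>R x + y) *\<^sub>R lam i)
        = c *\<^sub>R (\<Sum>i\<in>I. co i x *\<^sub>R lam i) + (\<Sum>i\<in>I. co i y *\<^sub>R lam i)"
      by (simp add: scaleR_add_left sum.distrib scaleR_sum_right)
    then show ?case using x step.IH by simp
  qed
qed

lemma co_eqI: "(\<And>i. i \<in> I \<Longrightarrow> co i x = co i y) \<Longrightarrow> x = y"
  by (metis (no_types, lifting) coordinate_expansion sum.cong)

lemma co_comb: "i \<in> I \<Longrightarrow> co i (\<Sum>k\<in>I. c k *\<^sub>R lam k) = c i"
proof -
  assume i: "i \<in> I"
  have "co i (\<Sum>k\<in>I. c k *\<^sub>R lam k) = (\<Sum>k\<in>I. if k = i then c k else 0)"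
    unfolding co_sum using i by (intro sum.cong) (auto simp: co_lam)
  then show ?thesis using i finI by simp
qed

lemma N_iff: "y \<in> N \<longleftrightarrow> (\<forall>i\<in>I. co i y \<in> \<int>)"
proof
  assume "y \<in> N" then show "\<forall>i\<in>I. co i y \<in> \<int>"
    by (auto simp: lattice_of_def co_comb)
next
  assume *: "\<forall>i\<in>I. co i y \<in> \<int>"
  have "y = (\<Sum>i\<in>I. of_int \<lfloor>co i y\<rfloor> *\<^sub>R lam i)"
    by (rule trans[OF coordinate_expansion[symmetric]], rule sum.cong) (use * in \<open>auto elim!: Ints_cases\<close>)
  then show "y \<in> N" unfolding lattice_of_def by (intro CollectI exI[of _ "\<lambda>i. \<lfloor>co i y\<rfloor>"])
qed

lemma cone_iff: "y \<in> \<Lambda> \<longleftrightarrow> (\<forall>i\<in>I. co i y \<ge> 0)"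
proof
  have "convex_cone {y. \<forall>i\<in>I. co i y \<ge> 0}"
    unfolding convex_cone_def convex_def conic_def by (auto intro!: exI[of _ 0])
  moreover have "lam ` I \<subseteq> {y. \<forall>i\<in>I. co i y \<ge> 0}" by (auto simp: co_lam)
  ultimately have "\<Lambda> \<subseteq> {y. \<forall>i\<in>I. co i y \<ge> 0}"
    unfolding basis_cone_def by (intro hull_minimal)
  then show "y \<in> \<Lambda> \<Longrightarrow> \<forall>i\<in>I. co i y \<ge> 0" by blast
next
  assume *: "\<forall>i\<in>I. co i y \<ge> 0"
  have "(\<Sum>i\<in>J. co i y *\<^sub>R lam i) \<in> \<Lambda>" if "J \<subseteq> I" for J
    using finite_subset[OF that finI] that
  proof (induction J rule: finite_induct)
    case empty show ?case by (simp add: basis_cone_def convex_cone_hull_contains_0)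
  next
    case (insert j J)
    have "lam j \<in> \<Lambda>" unfolding basis_cone_def using insert.prems by (intro hull_inc) auto
    then show ?case using insert * unfolding basis_cone_def
      by (auto intro!: convex_cone_hull_add convex_cone_hull_mul)
  qed
  from this[OF order_refl] show "y \<in> \<Lambda>" by (simp add: coordinate_expansion)
qed

lemma P_iff: "y \<in> P \<longleftrightarrow> (\<forall>i\<in>I. co i y \<in> \<nat>)"
  unfolding P_def by (auto simp: N_iff cone_iff Nats_altdef2)

lemma P_nonneg: "y \<in> P \<Longrightarrow> i \<in> I \<Longrightarrow> 0 \<le> co i y"
  by (auto simp: P_def cone_iff)

lemma P_subset_N: "P \<subseteq> N" by (auto simp: P_def)

lemma zero_P [simp]: "0 \<in> P" by (simp add: P_iff)

lemma add_P: "x \<in> P \<Longrightarrow> y \<in> P \<Longrightarrow> x + y \<in> P" by (simp add: P_iff)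

lemma mult_P: "x \<in> P \<Longrightarrow> real n *\<^sub>R x \<in> P" by (simp add: P_iff)

lemma diff_P: "x \<in> N \<Longrightarrow> y \<in> N \<Longrightarrow> (\<And>i. i \<in> I \<Longrightarrow> co i y \<le> co i x) \<Longrightarrow> x - y \<in> P"
  by (auto simp: P_def N_iff cone_iff)

lemma diff_N: "x \<in> N \<Longrightarrow> y \<in> N \<Longrightarrow> x - y \<in> N"
  and add_N: "x \<in> N \<Longrightarrow> y \<in> N \<Longrightarrow> x + y \<in> N"
  by (auto simp: N_iff)

lemma deg_add [simp]: "deg (x + y) = deg x + deg y"
  and deg_diff [simp]: "deg (x - y) = deg x - deg y"
  and deg_zero [simp]: "deg 0 = 0"
  and deg_scale [simp]: "deg (c *\<^sub>R x) = c * deg x"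
  by (simp_all add: deg_def sum.distrib sum_subtractf sum_distrib_left)

lemma deg_nonneg: "y \<in> P \<Longrightarrow> 0 \<le> deg y"
  unfolding deg_def by (intro sum_nonneg P_nonneg)

lemma deg_Nats: "y \<in> P \<Longrightarrow> deg y \<in> \<nat>"
  unfolding deg_def P_iff by (rule sum_Nats) auto

lemma co_le_deg: "y \<in> P \<Longrightarrow> i \<in> I \<Longrightarrow> co i y \<le> deg y"
  unfolding deg_def using finI P_nonneg by (intro member_le_sum) auto

lemma deg_eq_0: "y \<in> P \<Longrightarrow> deg y = 0 \<Longrightarrow> y = 0"
  using co_le_deg P_nonneg by (intro co_eqI) (metis co_zero order_antisym)

lemma comb_P: "(\<And>i. i \<in> I \<Longrightarrow> c i \<in> \<nat>) \<Longrightarrow> (\<Sum>i\<in>I. c i *\<^sub>R lam i) \<in> P"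
  by (simp add: P_iff co_comb)

text \<open>
  Finite for every \<open>m\<close>. All operations on coefficients below look only at \<open>below m\<close> to compute the value
  at \<open>m\<close>, so the combinatorics needs finite sums only.
\<close>

definition below :: "'v \<Rightarrow> 'v set" where
  "below m = {w\<in>P. \<forall>i\<in>I. co i w \<le> co i m}"

lemma finite_box: "finite {w\<in>P. \<forall>i\<in>I. co i w \<le> K}"
proof -
  let ?A = "{w\<in>P. \<forall>i\<in>I. co i w \<le> K}"
  let ?r = "\<lambda>w. restrict (\<lambda>i. co i w) I"
  have "?r ` ?A \<subseteq> (\<Pi>\<^sub>E i\<in>I. real ` {..nat \<lfloor>K\<rfloor>})"
    unfolding P_iff
    by (force simp: le_nat_floor Nats_def)
  moreover have "finite (\<Pi>\<^sub>E i\<in>I. real ` {..nat \<lfloor>K\<rfloor>})"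
    using finI by (intro finite_PiE) auto
  ultimately have "finite (?r ` ?A)" by (rule finite_subset)
  moreover have "inj_on ?r ?A"
    by (intro inj_onI co_eqI) (metis restrict_apply')
  ultimately show ?thesis by (rule finite_imageD)
qed

lemma finite_below: "finite (below m)"
proof (rule finite_subset)
  have "co i m \<le> (\<Sum>i\<in>I. \<bar>co i m\<bar>)" if "i \<in> I" for i
    using member_le_sum[of i I "\<lambda>i. \<bar>co i m\<bar>"] finI that by force
  then show "below m \<subseteq> {w\<in>P. \<forall>i\<in>I. co i w \<le> (\<Sum>i\<in>I. \<bar>co i m\<bar>)}"
    by (force simp: below_def)
qed (rule finite_box)

lemma deg_below: "w \<in> below m \<Longrightarrow> deg w \<le> deg m"
  unfolding deg_def below_def by (auto intro: sum_mono)

section \<open>Convergence on the tube\<close>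

text \<open>
  A finite set of lattice points lies in a box, over which the sum factors into geometric sums.
\<close>

lemma sum_box:
  fixes r :: real
  assumes r: "0 \<le> r" "r < 1" and A: "finite A" "A \<subseteq> P"
  shows "(\<Sum>m\<in>A. \<Prod>i\<in>I. r ^ nat \<lfloor>co i m\<rfloor>) \<le> (1 / (1 - r)) ^ card I"
proof -
  define K where "K = nat \<lfloor>\<Sum>m\<in>A. deg m\<rfloor>"
  let ?r = "\<lambda>w. restrict (\<lambda>i. nat \<lfloor>co i w\<rfloor>) I"
  let ?B = "\<Pi>\<^sub>E i\<in>I. {..K}"
  have inj: "inj_on ?r A"
  proof (intro inj_onI co_eqI)
    fix x y i assume xy: "x \<in> A" "y \<in> A" "?r x = ?r y" "i \<in> I"
    then have "nat \<lfloor>co i x\<rfloor> = nat \<lfloor>co i y\<rfloor>" by (metis restrict_apply')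
    moreover have "co i x \<in> \<nat>" "co i y \<in> \<nat>" using xy A by (auto simp: P_iff)
    ultimately show "co i x = co i y" by (auto elim!: Nats_cases)
  qed
  have sub: "?r ` A \<subseteq> ?B"
  proof -
    have "nat \<lfloor>co i m\<rfloor> \<le> K" if "m \<in> A" "i \<in> I" for m i
    proof -
      have "co i m \<le> deg m" using that A by (intro co_le_deg) auto
      also have "\<dots> \<le> (\<Sum>m\<in>A. deg m)"
        using that A deg_nonneg by (intro member_le_sum) auto
      finally show ?thesis unfolding K_def by (intro nat_mono floor_mono)
    qed
    then show ?thesis by auto
  qed
  have "(\<Sum>m\<in>A. \<Prod>i\<in>I. r ^ nat \<lfloor>co i m\<rfloor>) = (\<Sum>g\<in>?r ` A. \<Prod>i\<in>I. r ^ g i)"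
    by (subst sum.reindex[OF inj]) simp
  also have "\<dots> \<le> (\<Sum>g\<in>?B. \<Prod>i\<in>I. r ^ g i)"
    using sub finI r by (intro sum_mono2 finite_PiE) (auto intro: prod_nonneg)
  also have "\<dots> = (\<Prod>i\<in>I. \<Sum>k\<le>K. r ^ k)" by (rule prod_sum_PiE[symmetric]) (use finI in auto)
  also have "\<dots> \<le> (\<Prod>i\<in>I. 1 / (1 - r))"
  proof (intro prod_mono conjI)
    show "0 \<le> (\<Sum>k\<le>K. r ^ k)" using r by (intro sum_nonneg) auto
    have "(\<Sum>k\<le>K. r ^ k) \<le> (\<Sum>k. r ^ k)" using r by (intro sum_le_suminf summable_geometric) auto
    then show "(\<Sum>k\<le>K. r ^ k) \<le> 1 / (1 - r)" using r suminf_geometric[of r] by simp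
  qed
  finally show ?thesis by simp
qed

lemma summable_deg:
  assumes "\<theta> > 0"
  shows "(\<lambda>m. q powr (- \<theta> * deg m)) summable_on P"
proof (rule nonneg_bdd_above_summable_on)
  define r where "r = q powr (- \<theta>)"
  have q1: "1 < real q" using q_ge_2 by simp
  have r: "0 \<le> r" "r < 1" using assms q1 powr_less_one[of q "-\<theta>"] by (auto simp: r_def)
  have "q powr (- \<theta> * deg m) = (\<Prod>i\<in>I. r ^ nat \<lfloor>co i m\<rfloor>)" if "m \<in> P" for m
  proof -
    have "q powr (- \<theta> * deg m) = (\<Prod>i\<in>I. q powr (- \<theta> * co i m))"
      unfolding deg_def sum_distrib_left using q1 finI by (subst powr_sum) auto
    also have "\<dots> = (\<Prod>i\<in>I. r ^ nat \<lfloor>co i m\<rfloor>)"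
    proof (rule prod.cong[OF refl])
      fix i assume "i \<in> I"
      then have "co i m \<in> \<nat>" using that by (auto simp: P_iff)
      then obtain n where "co i m = real n" by (auto elim: Nats_cases)
      then show "q powr (- \<theta> * co i m) = r ^ nat \<lfloor>co i m\<rfloor>"
        using q1 by (simp add: r_def powr_powr flip: powr_realpow)
    qed
    finally show ?thesis .
  qed
  then have eq: "(\<Sum>m\<in>A. q powr (- \<theta> * deg m)) = (\<Sum>m\<in>A. \<Prod>i\<in>I. r ^ nat \<lfloor>co i m\<rfloor>)"
    if "A \<subseteq> P" for A using that by (intro sum.cong) auto
  show "bdd_above (sum (\<lambda>m. q powr (- \<theta> * deg m)) ` {F. F \<subseteq> P \<and> finite F})"
    by (rule bdd_aboveI[of _ "(1 / (1 - r)) ^ card I"]) (use sum_box[OF r] eq in auto)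
qed simp

text \<open>
  Equivalent to absolute convergence on some tube that contains the closed one, hence these are the coefficients
  of elementary admissible functions of multiplicity at least 0 (\<open>exp_summable_admissible\<close>,
  \<open>Lconv_imp_exp_summable\<close>). The exponent \<open>\<eta>\<close> may shrink from one function to the next.
\<close>

definition exp_summable :: "('v \<Rightarrow> complex) \<Rightarrow> bool" where
  "exp_summable b \<longleftrightarrow> (\<exists>\<eta>>0. (\<lambda>w. norm (b w) * q powr (\<eta> * deg w)) summable_on P)"

lemma tube_iff: "s \<in> tube (dual_cone_gt I lam \<eta>) \<longleftrightarrow> (\<forall>i\<in>I. Re (blinfun_apply s (lam i)) > \<eta>)"
proof -
  define u where "u = Blinfun (\<lambda>x. Re (blinfun_apply s x))"
  have bl: "bounded_linear (\<lambda>x. Re (blinfun_apply s x))"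
    by (intro bounded_linear_compose[OF bounded_linear_Re] blinfun.bounded_linear_right)
  have u: "blinfun_apply u x = Re (blinfun_apply s x)" for x
    unfolding u_def by (simp add: bounded_linear_Blinfun_apply[OF bl])
  have comb: "blinfun_apply (\<Sum>i\<in>I. c i *\<^sub>R dual_vec I lam i) (lam k) = c k" if "k \<in> I" for c k
  proof -
    have "blinfun_apply (\<Sum>i\<in>I. c i *\<^sub>R dual_vec I lam i) (lam k)
        = (\<Sum>i\<in>I. if i = k then c i else 0)"
      unfolding blinfun.sum_left using that
      by (intro sum.cong) (auto simp: blinfun.scaleR_left dual_vec_basis[OF basis])
    then show ?thesis using that finI by simp
  qed
  have "u = (\<Sum>i\<in>I. blinfun_apply u (lam i) *\<^sub>R dual_vec I lam i)"
  proof (rule blinfun_eqI)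
    fix y
    have "blinfun_apply u y = blinfun_apply u (\<Sum>i\<in>I. co i y *\<^sub>R lam i)" by (simp add: coordinate_expansion)
    also have "\<dots> = blinfun_apply (\<Sum>i\<in>I. blinfun_apply u (lam i) *\<^sub>R dual_vec I lam i) y"
      by (simp add: blinfun.sum_left blinfun.sum_right blinfun.scaleR_left blinfun.scaleR_right
          co_def mult.commute)
    finally show "blinfun_apply u y
      = blinfun_apply (\<Sum>i\<in>I. blinfun_apply u (lam i) *\<^sub>R dual_vec I lam i) y" .
  qed
  then have "u \<in> dual_cone_gt I lam \<eta> \<longleftrightarrow> (\<forall>i\<in>I. blinfun_apply u (lam i) > \<eta>)"
    unfolding dual_cone_gt_def using comb by auto
  then show ?thesis by (simp add: tube_def u_def[symmetric] u)
qed

abbreviation "tube0 \<equiv> tube (dual_cone_gt I lam 0)"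

lemma apply_expand: "blinfun_apply s y = (\<Sum>i\<in>I. co i y *\<^sub>R blinfun_apply s (lam i))"
  for s :: "'v \<Rightarrow>\<^sub>L complex"
proof -
  have "blinfun_apply s y = blinfun_apply s (\<Sum>i\<in>I. co i y *\<^sub>R lam i)" by (simp add: coordinate_expansion)
  then show ?thesis by (simp add: blinfun.sum_right blinfun.scaleR_right)
qed

lemma E_add: "q_neg q s (x + y) = q_neg q s x * q_neg q s y"
  by (simp add: q_neg_def blinfun.add_right powr_add[symmetric] algebra_simps)

lemma E_exp: "q_neg q s x = exp (- of_real (ln q) * blinfun_apply s x)"
  using q_ge_2 by (simp add: q_neg_def powr_def Ln_of_nat mult.commute)

lemma norm_E: "norm (q_neg q s x) = q powr (- Re (blinfun_apply s x))"
  using q_ge_2 by (simp add: E_exp powr_def)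

lemma Re_apply_ge:
  assumes "\<And>i. i \<in> I \<Longrightarrow> \<delta> \<le> Re (blinfun_apply s (lam i))" "y \<in> P"
  shows "\<delta> * deg y \<le> Re (blinfun_apply s y)"
  unfolding apply_expand[of s y] deg_def sum_distrib_left
  using assms(1) P_nonneg[OF assms(2)]
  by (auto simp: mult.commute[of \<delta>] Re_sum intro!: sum_mono mult_left_mono)

lemma norm_E_le:
  assumes "\<And>i. i \<in> I \<Longrightarrow> \<delta> \<le> Re (blinfun_apply s (lam i))" "y \<in> P"
  shows "norm (q_neg q s y) \<le> q powr (- \<delta> * deg y)"
  unfolding norm_E using Re_apply_ge[OF assms] q_ge_2 by (intro powr_mono) auto

lemma tube0_delta:
  assumes "s \<in> tube0"
  obtains \<delta> where "\<delta> > 0" "\<And>i. i \<in> I \<Longrightarrow> \<delta> \<le> Re (blinfun_apply s (lam i))"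
proof -
  let ?\<delta> = "Min (insert 1 ((\<lambda>i. Re (blinfun_apply s (lam i))) ` I))"
  have "?\<delta> > 0" using assms finI by (auto simp: tube_iff)
  moreover have "?\<delta> \<le> Re (blinfun_apply s (lam i))" if "i \<in> I" for i
    using that finI by (intro Min_le) auto
  ultimately show ?thesis using that by blast
qed

lemma Lser_points: "Lser N' \<Lambda> b z = (\<Sum>\<^sub>\<infinity>y\<in>P \<inter> N'. b y * z y)" if "N' \<subseteq> N" for N'
proof -
  have "\<Lambda> \<inter> N' = P \<inter> N'" using that by (auto simp: P_def)
  then show ?thesis by (simp add: Lser_def)
qed

lemma exp_summable_imp_Lconv:
  assumes "exp_summable b"
  obtains \<eta> where "\<eta> > 0" "\<And>s. s \<in> tube (dual_cone_gt I lam (-\<eta>)) \<Longrightarrow> Lconv N \<Lambda> b (q_neg q s)"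
proof -
  obtain \<eta> where \<eta>: "\<eta> > 0" "(\<lambda>w. norm (b w) * q powr (\<eta> * deg w)) summable_on P"
    using assms by (auto simp: exp_summable_def)
  show ?thesis
  proof (rule that[OF \<eta>(1)])
    fix s assume "s \<in> tube (dual_cone_gt I lam (-\<eta>))"
    then have s: "\<And>i. i \<in> I \<Longrightarrow> -\<eta> \<le> Re (blinfun_apply s (lam i))" by (auto simp: tube_iff less_imp_le)
    show "Lconv N \<Lambda> b (q_neg q s)" unfolding Lconv_def P_def[symmetric]
      by (rule summable_on_comparison_test[OF \<eta>(2)])
         (use norm_E_le[OF s] in \<open>auto simp: norm_mult intro!: mult_left_mono\<close>)
  qed
qed

lemma exp_summable_admissible:
  assumes "exp_summable b" shows "elementary_admissible0 I lam q (\<lambda>s. Lser N \<Lambda> b (q_neg q s))"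
  using exp_summable_imp_Lconv[OF assms] unfolding elementary_admissible0_def by metis

text \<open>
  One real point of the tube suffices: at the constant point \<open>-\<epsilon>/2\<close> the norm of the general term is
  \<open>norm (b w) * q powr (\<epsilon>/2 * deg w)\<close>.
\<close>

lemma Lconv_imp_exp_summable:
  assumes "\<epsilon> > 0" "\<forall>s\<in>tube (dual_cone_gt I lam (-\<epsilon>)). Lconv N \<Lambda> b (q_neg q s)"
  shows "exp_summable b"
proof -
  define s :: "'v \<Rightarrow>\<^sub>L complex" where "s = Blinfun (\<lambda>y. of_real (- (\<epsilon> / 2) * deg y))"
  have "bounded_linear (\<lambda>y. of_real (- (\<epsilon> / 2) * deg y) :: complex)"
    unfolding deg_def co_def
    by (intro bounded_linear_compose[OF bounded_linear_of_real] bounded_linear_const_mult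
        bounded_linear_sum blinfun.bounded_linear_right)
  then have s: "blinfun_apply s y = of_real (- (\<epsilon> / 2) * deg y)" for y
    unfolding s_def by (subst bounded_linear_Blinfun_apply) auto
  have deg1: "deg (lam i) = 1" if "i \<in> I" for i
    using that finI by (simp add: deg_def co_lam)
  have "s \<in> tube (dual_cone_gt I lam (-\<epsilon>))" using assms(1) by (simp add: tube_iff s deg1)
  then have "Lconv N \<Lambda> b (q_neg q s)" using assms by blast
  then have "(\<lambda>w. norm (b w) * q powr (\<epsilon> / 2 * deg w)) summable_on P"
    unfolding Lconv_def P_def[symmetric] norm_mult norm_E s by simp
  then show ?thesis unfolding exp_summable_def using assms(1) by (intro exI[of _ "\<epsilon>/2"]) auto
qed

end

section \<open>Dickson's lemma and operations on coefficients\<close>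

text \<open>
  Dickson's lemma, by induction on the set of coordinates. For a finite set \<open>B0\<close> that works without
  the coordinate \<open>i\<close>, an element whose \<open>i\<close>-th coordinate is large is already above a member of \<open>B0\<close>, and
  there are finitely many other values, each covered by the induction hypothesis.
\<close>

lemma dickson:
  fixes c :: "'i \<Rightarrow> 'a \<Rightarrow> nat"
  assumes "finite I"
  shows "\<exists>B\<subseteq>A. finite B \<and> (\<forall>a\<in>A. \<exists>b\<in>B. \<forall>i\<in>I. c i b \<le> c i a)"
  using assms
proof (induction I arbitrary: A rule: finite_induct)
  case empty
  show ?case
  proof (cases "A = {}")
    case False
    then obtain a where "a \<in> A" by blast
    then show ?thesis by (intro exI[of _ "{a}"]) auto
  qed auto
next
  case (insert i I)
  obtain B0 where B0: "B0 \<subseteq> A" "finite B0" "\<And>a. a \<in> A \<Longrightarrow> \<exists>b\<in>B0. \<forall>k\<in>I. c k b \<le> c k a"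
    using insert.IH[of A] by blast
  define K where "K = (\<Sum>b\<in>B0. c i b)"
  have K: "c i b \<le> K" if "b \<in> B0" for b
    unfolding K_def using that B0(2) by (intro member_le_sum) auto
  define S where "S v = {a\<in>A. c i a = v}" for v
  have "\<exists>B. B \<subseteq> S v \<and> finite B \<and> (\<forall>a\<in>S v. \<exists>b\<in>B. \<forall>k\<in>I. c k b \<le> c k a)" for v
    using insert.IH[of "S v"] by blast
  then obtain B where B: "\<And>v. B v \<subseteq> S v" "\<And>v. finite (B v)"
    "\<And>v a. a \<in> S v \<Longrightarrow> \<exists>b\<in>B v. \<forall>k\<in>I. c k b \<le> c k a"
    by metis
  let ?B = "B0 \<union> (\<Union>v\<in>{..<K}. B v)"
  have "\<exists>b\<in>?B. \<forall>k\<in>insert i I. c k b \<le> c k a" if a: "a \<in> A" for a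
  proof (cases "c i a < K")
    case True
    have "a \<in> S (c i a)" using a by (simp add: S_def)
    from B(3)[OF this] obtain b where b: "b \<in> B (c i a)" "\<forall>k\<in>I. c k b \<le> c k a" by blast
    have "b \<in> S (c i a)" using B(1) b(1) by blast
    then have "c i b = c i a" by (simp add: S_def)
    then have "\<forall>k\<in>insert i I. c k b \<le> c k a" using b(2) by simp
    moreover have "b \<in> ?B" using b(1) True by blast
    ultimately show ?thesis by blast
  next
    case False
    obtain b where b: "b \<in> B0" "\<forall>k\<in>I. c k b \<le> c k a" using B0(3)[OF a] by blast
    then have "\<forall>k\<in>insert i I. c k b \<le> c k a" using K[OF b(1)] False by auto
    then show ?thesis using b(1) by blast
  qed
  moreover have "?B \<subseteq> A" using B0(1) B(1) by (auto simp: S_def)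
  moreover have "finite ?B" using B0(2) B(2) by auto
  ultimately show ?case by blast
qed

context cone_lattice
begin

lemma dickson_P:
  assumes "A \<subseteq> P"
  obtains B where "B \<subseteq> A" "finite B" "\<And>a. a \<in> A \<Longrightarrow> \<exists>b\<in>B. b \<in> below a"
proof -
  obtain B where B: "B \<subseteq> A" "finite B"
    "\<And>a. a \<in> A \<Longrightarrow> \<exists>b\<in>B. \<forall>i\<in>I. nat \<lfloor>co i b\<rfloor> \<le> nat \<lfloor>co i a\<rfloor>"
    using dickson[OF finI, of A "\<lambda>i y. nat \<lfloor>co i y\<rfloor>"] by metis
  show ?thesis
  proof (rule that[OF B(1,2)])
    fix a assume a: "a \<in> A"
    obtain b where b: "b \<in> B" "\<forall>i\<in>I. nat \<lfloor>co i b\<rfloor> \<le> nat \<lfloor>co i a\<rfloor>" using B(3)[OF a] by blast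
    have "co i b \<le> co i a" if i: "i \<in> I" for i
    proof -
      have "co i a \<in> \<nat>" "co i b \<in> \<nat>" using assms a b B(1) i by (auto simp: P_iff subset_iff)
      then show ?thesis using b(2) i by (auto elim!: Nats_cases)
    qed
    moreover have "b \<in> P" using b(1) B(1) assms by blast
    ultimately show "\<exists>b\<in>B. b \<in> below a" using b(1) unfolding below_def by blast
  qed
qed

text \<open>
  Transport of coefficients along a relation. Only relations inside the coordinatewise order occur, and the restriction to \<open>below w'\<close> builds this in.
\<close>

definition push :: "('v \<Rightarrow> 'v \<Rightarrow> bool) \<Rightarrow> ('v \<Rightarrow> complex) \<Rightarrow> 'v \<Rightarrow> complex" where
  "push R b w' = (\<Sum>w\<in>{w\<in>below w'. R w w'}. b w)"

definition conv :: "('v \<Rightarrow> complex) \<Rightarrow> 'v set \<Rightarrow> 'v \<Rightarrow> complex" where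
  "conv g A m = (\<Sum>w\<in>{w\<in>below m. m - w \<in> A}. g w)"

lemma one_le_powr_deg: "0 \<le> x \<Longrightarrow> 1 \<le> q powr x"
  using q_ge_2 by (intro ge_one_powr_ge_zero) auto

lemma exp_summable_norm: "exp_summable b \<Longrightarrow> (\<lambda>w. norm (b w)) summable_on P"
proof -
  assume "exp_summable b"
  then obtain \<eta> where \<eta>: "\<eta> > 0" "(\<lambda>w. norm (b w) * q powr (\<eta> * deg w)) summable_on P"
    by (auto simp: exp_summable_def)
  show ?thesis
  proof (rule summable_on_comparison_test[OF \<eta>(2)])
    fix w assume "w \<in> P"
    then have "1 \<le> q powr (\<eta> * deg w)" using \<eta>(1) deg_nonneg by (intro one_le_powr_deg) simp
    then show "norm (b w) \<le> norm (b w) * q powr (\<eta> * deg w)"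
      using mult_left_mono[of 1 _ "norm (b w)"] by simp
  qed simp
qed

text \<open>
  With \<open>deg w' \<le> C (1 + deg w)\<close>, the weight of the image is paid for by the weight of the source once
  the exponent is divided by about \<open>C\<close>. The images of \<open>w\<close> are not counted: half of the gain is
  spent on the convergent series of \<open>q powr (- \<theta> * deg w')\<close>.
\<close>

lemma exp_summable_push:
  assumes b: "exp_summable b" and C: "0 \<le> C"
    and R: "\<And>w w'. w \<in> P \<Longrightarrow> w' \<in> P \<Longrightarrow> R w w' \<Longrightarrow> deg w' \<le> C * (1 + deg w)"
  shows "exp_summable (push R b)"
proof -
  obtain \<eta> where \<eta>: "\<eta> > 0" "(\<lambda>w. norm (b w) * q powr (\<eta> * deg w)) summable_on P"
    using b by (auto simp: exp_summable_def)
  \<comment> \<open>Chosen with \<open>2 * \<theta> * C \<le> \<eta>\<close>: one \<open>\<theta>\<close> for the weight of \<open>w'\<close>, one for summing over \<open>w'\<close>.\<close>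
  define \<theta> where "\<theta> = \<eta> / (2 * (C + 1))"
  have \<theta>: "\<theta> > 0" using \<eta>(1) C by (simp add: \<theta>_def)
  have \<theta>C: "2 * \<theta> * C \<le> \<eta>" using \<eta>(1) C by (simp add: \<theta>_def field_simps)
  define u where "u w = norm (b w) * q powr (\<eta> * (1 + deg w))" for w
  have "(\<lambda>w. norm (b w) * q powr (\<eta> * deg w) * q powr \<eta>) summable_on P"
    by (rule summable_on_cmult_left[OF \<eta>(2)])
  then have u: "u summable_on P"
    unfolding u_def by (simp add: distrib_left powr_add mult_ac)
  have key: "norm (push R b w') * q powr (\<theta> * deg w') \<le> infsum u P * q powr (- \<theta> * deg w')"
    if w': "w' \<in> P" for w'
  proof -
    let ?A = "{w\<in>below w'. R w w'}"
    have A: "finite ?A" "?A \<subseteq> P" using finite_below[of w'] by (simp, auto simp: below_def)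
    have "norm (push R b w') * q powr (2 * \<theta> * deg w')
        \<le> (\<Sum>w\<in>?A. norm (b w)) * q powr (2 * \<theta> * deg w')"
      unfolding push_def by (intro mult_right_mono norm_sum) auto
    also have "\<dots> \<le> (\<Sum>w\<in>?A. u w)" unfolding sum_distrib_right u_def
    proof (intro sum_mono mult_left_mono powr_mono)
      fix w assume w: "w \<in> ?A"
      have "2 * \<theta> * deg w' \<le> 2 * \<theta> * (C * (1 + deg w))"
        using R[of w w'] w w' A \<theta> by (intro mult_left_mono) auto
      also have "\<dots> = 2 * \<theta> * C * (1 + deg w)" by simp
      also have "\<dots> \<le> \<eta> * (1 + deg w)"
        using \<theta>C deg_nonneg[of w] w A by (intro mult_right_mono) auto
      finally show "2 * \<theta> * deg w' \<le> \<eta> * (1 + deg w)" .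
    qed (use q_ge_2 in auto)
    also have "\<dots> \<le> infsum u P"
      by (rule finite_sum_le_infsum[OF u A]) (simp add: u_def)
    finally have "norm (push R b w') * q powr (2 * \<theta> * deg w') * q powr (- \<theta> * deg w')
        \<le> infsum u P * q powr (- \<theta> * deg w')"
      by (intro mult_right_mono) auto
    then show ?thesis by (simp add: mult.assoc flip: powr_add)
  qed
  have "(\<lambda>w'. infsum u P * q powr (- \<theta> * deg w')) summable_on P"
    by (rule summable_on_cmult_right[OF summable_deg[OF \<theta>]])
  then have "(\<lambda>w'. norm (push R b w') * q powr (\<theta> * deg w')) summable_on P"
    by (rule summable_on_comparison_test) (use key in auto)
  then show ?thesis unfolding exp_summable_def using \<theta> by blast
qed

lemma exp_summable_zero: "exp_summable (\<lambda>_. 0)"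
  unfolding exp_summable_def by (intro exI[of _ 1]) auto

lemma exp_summable_add: assumes "exp_summable b" "exp_summable c" shows "exp_summable (\<lambda>w. b w + c w)"
proof -
  obtain \<eta> where \<eta>: "\<eta> > 0" "(\<lambda>w. norm (b w) * q powr (\<eta> * deg w)) summable_on P"
    using assms by (auto simp: exp_summable_def)
  obtain \<xi> where \<xi>: "\<xi> > 0" "(\<lambda>w. norm (c w) * q powr (\<xi> * deg w)) summable_on P"
    using assms by (auto simp: exp_summable_def)
  have "(\<lambda>w. norm (b w + c w) * q powr (min \<eta> \<xi> * deg w)) summable_on P"
  proof (rule summable_on_comparison_test[OF summable_on_add[OF \<eta>(2) \<xi>(2)]])
    fix w assume w: "w \<in> P"
    have 1: "q powr (min \<eta> \<xi> * deg w) \<le> q powr (\<eta> * deg w)"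
      "q powr (min \<eta> \<xi> * deg w) \<le> q powr (\<xi> * deg w)"
      using q_ge_2 deg_nonneg[OF w] by (intro powr_mono mult_right_mono; simp)+
    have "norm (b w + c w) * q powr (min \<eta> \<xi> * deg w)
        \<le> (norm (b w) + norm (c w)) * q powr (min \<eta> \<xi> * deg w)"
      by (intro mult_right_mono norm_triangle_ineq) auto
    also have "\<dots> \<le> norm (b w) * q powr (\<eta> * deg w) + norm (c w) * q powr (\<xi> * deg w)"
      unfolding distrib_right using 1 by (intro add_mono mult_left_mono) auto
    finally show "norm (b w + c w) * q powr (min \<eta> \<xi> * deg w)
        \<le> norm (b w) * q powr (\<eta> * deg w) + norm (c w) * q powr (\<xi> * deg w)" .
  qed auto
  then show ?thesis unfolding exp_summable_def using \<eta>(1) \<xi>(1) by (intro exI[of _ "min \<eta> \<xi>"]) auto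
qed

lemma exp_summable_sum: "finite A \<Longrightarrow> (\<And>k. k \<in> A \<Longrightarrow> exp_summable (b k)) \<Longrightarrow> exp_summable (\<lambda>w. \<Sum>k\<in>A. b k w)"
  by (induction A rule: finite_induct) (auto simp: exp_summable_zero intro!: exp_summable_add)

lemma exp_summable_restrict: "exp_summable b \<Longrightarrow> exp_summable (\<lambda>w. if w \<in> A then b w else 0)"
proof -
  assume "exp_summable b"
  then obtain \<eta> where \<eta>: "\<eta> > 0" "(\<lambda>w. norm (b w) * q powr (\<eta> * deg w)) summable_on P"
    by (auto simp: exp_summable_def)
  have "(\<lambda>w. norm (if w \<in> A then b w else 0) * q powr (\<eta> * deg w)) summable_on P"
    by (rule summable_on_comparison_test[OF \<eta>(2)]) auto
  then show ?thesis using \<eta>(1) unfolding exp_summable_def by blast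
qed

lemma conv_add: "conv (\<lambda>w. f w + g w) A m = conv f A m + conv g A m"
  by (simp add: conv_def sum.distrib)

lemma conv_sum: "conv (\<lambda>w. \<Sum>k\<in>K. f k w) A m = (\<Sum>k\<in>K. conv (f k) A m)"
  unfolding conv_def by (rule sum.swap)

lemma conv_zero: "conv (\<lambda>w. 0) A m = 0"
  by (simp add: conv_def)

text \<open>
  Exchange of two finite sums. The numbers on the right count the \<open>w'\<close> fed by \<open>w\<close> that contribute at \<open>m\<close>, so an
  identity between coefficients reduces to the claim that such numbers add up to 0 or 1.
\<close>

lemma sum_push:
  assumes Q: "\<And>w'. Q w' \<Longrightarrow> w' \<in> below m"
  shows "(\<Sum>w'\<in>{w'\<in>below m. Q w'}. push R b w')
    = (\<Sum>w\<in>below m. b w * of_nat (card {w'. w' \<in> below m \<and> w \<in> below w' \<and> R w w' \<and> Q w'}))"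
proof -
  have tr: "below w' \<subseteq> below m" if "w' \<in> below m" for w'
    using that by (force simp: below_def)
  have "(\<Sum>w'\<in>{w'\<in>below m. Q w'}. push R b w')
      = (\<Sum>w'\<in>{w'\<in>below m. Q w'}. \<Sum>w\<in>below m. if w \<in> below w' \<and> R w w' then b w else 0)"
  proof (rule sum.cong[OF refl])
    fix w' assume w': "w' \<in> {w'\<in>below m. Q w'}"
    have "{w\<in>below m. w \<in> below w' \<and> R w w'} = {w\<in>below w'. R w w'}" using tr w' by blast
    then show "push R b w' = (\<Sum>w\<in>below m. if w \<in> below w' \<and> R w w' then b w else 0)"
      unfolding push_def by (simp add: sum.inter_filter[OF finite_below, symmetric])
  qed
  also have "\<dots> = (\<Sum>w\<in>below m. \<Sum>w'\<in>{w'\<in>below m. Q w'}. if w \<in> below w' \<and> R w w' then b w else 0)"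
    by (rule sum.swap)
  also have "\<dots> = (\<Sum>w\<in>below m. b w * of_nat (card {w'. w' \<in> below m \<and> w \<in> below w' \<and> R w w' \<and> Q w'}))"
  proof (rule sum.cong[OF refl])
    fix w
    have eq: "{w'\<in>below m. Q w'} \<inter> {w'. w \<in> below w' \<and> R w w'}
      = {w'. w' \<in> below m \<and> w \<in> below w' \<and> R w w' \<and> Q w'}" by blast
    show "(\<Sum>w'\<in>{w'\<in>below m. Q w'}. if w \<in> below w' \<and> R w w' then b w else 0)
      = b w * of_nat (card {w'. w' \<in> below m \<and> w \<in> below w' \<and> R w w' \<and> Q w'})"
      using finite_below[of m] by (simp add: sum.If_cases eq mult.commute)
  qed
  finally show ?thesis .
qed

end

section \<open>Slices of a coset in the cone\<close>

text \<open>
  \<open>T\<close> is the part in the cone of one coset of \<open>M'\<close>, or empty. It is described by its closure properties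
  so that no representative of the coset has to be carried along.
\<close>

locale coset_points = cone_lattice I lam q
  for I :: "'i set" and lam :: "'i \<Rightarrow> 'v::real_normed_vector" and q :: nat +
  fixes M' T :: "'v set"
  assumes M': "subgroup_of M' N" and T_P: "T \<subseteq> P"
    and T_diff: "\<And>m m'. m \<in> T \<Longrightarrow> m' \<in> T \<Longrightarrow> m - m' \<in> M'"
    and T_add: "\<And>m l. m \<in> T \<Longrightarrow> l \<in> M' \<Longrightarrow> m + l \<in> P \<Longrightarrow> m + l \<in> T"
begin

lemma M'_0: "0 \<in> M'" and M'_diff: "x \<in> M' \<Longrightarrow> y \<in> M' \<Longrightarrow> x - y \<in> M'" and M'_N: "M' \<subseteq> N"
  using M' by (auto simp: subgroup_of_def)

lemma M'_uminus: "x \<in> M' \<Longrightarrow> - x \<in> M'"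
  using M'_diff[OF M'_0] by simp

lemma M'_add: "x \<in> M' \<Longrightarrow> y \<in> M' \<Longrightarrow> x + y \<in> M'"
  using M'_diff[of x "- y"] M'_uminus by simp

lemma M'_mult: "x \<in> M' \<Longrightarrow> real n *\<^sub>R x \<in> M'"
  by (induction n) (auto simp: M'_0 scaleR_add_left intro: M'_add)

definition face_monoid :: "'i set \<Rightarrow> 'v set" where
  "face_monoid F = {l\<in>M' \<inter> P. \<forall>k\<in>F. co k l = 0}"

lemma face_monoid_add: "x \<in> face_monoid F \<Longrightarrow> y \<in> face_monoid F \<Longrightarrow> x + y \<in> face_monoid F"
  by (auto simp: face_monoid_def M'_add add_P)

lemma face_monoid_mult: "x \<in> face_monoid F \<Longrightarrow> real n *\<^sub>R x \<in> face_monoid F"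
  by (auto simp: face_monoid_def M'_mult mult_P)

lemma face_monoid_0: "0 \<in> face_monoid F" by (auto simp: face_monoid_def M'_0)

definition partial_deg :: "'i set \<Rightarrow> 'v \<Rightarrow> real" where "partial_deg F y = (\<Sum>k\<in>F. co k y)"

lemma partial_deg_diff: "partial_deg F (x - y) = partial_deg F x - partial_deg F y"
  by (simp add: partial_deg_def sum_subtractf)

lemma partial_deg_nonneg: "F \<subseteq> I \<Longrightarrow> y \<in> P \<Longrightarrow> 0 \<le> partial_deg F y"
  unfolding partial_deg_def by (intro sum_nonneg P_nonneg) auto

lemma partial_deg_le: "F \<subseteq> I \<Longrightarrow> y \<in> P \<Longrightarrow> partial_deg F y \<le> deg y"
  unfolding partial_deg_def deg_def using finI P_nonneg by (intro sum_mono2) auto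

lemma belowD: "h \<in> below l \<Longrightarrow> l \<in> P \<Longrightarrow> l - h \<in> P"
  using P_subset_N by (intro diff_P) (auto simp: below_def)

text \<open>
  Subtract minimal nonzero elements of the monoid \<open>M' \<inter> P\<close> one at a time. Those vanishing on \<open>F\<close> are dropped
  from \<open>l'\<close>; each of the others has at least 1 among its coordinates in \<open>F\<close>, so \<open>partial_deg F l\<close> bounds
  how many of them are kept.
\<close>

lemma linear_lower_monoid:
  assumes F: "F \<subseteq> I"
  obtains C where "0 \<le> C"
    "\<And>l. l \<in> M' \<inter> P \<Longrightarrow> \<exists>l'\<in>M' \<inter> P. l - l' \<in> face_monoid F \<and> deg l' \<le> C * partial_deg F l"
proof -
  obtain H where H: "H \<subseteq> M' \<inter> P - {0}" "finite H"
    "\<And>a. a \<in> M' \<inter> P - {0} \<Longrightarrow> \<exists>b\<in>H. b \<in> below a"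
    using dickson_P[of "M' \<inter> P - {0}"] by blast
  define C where "C = (\<Sum>h\<in>H. deg h)"
  have C0: "0 \<le> C" unfolding C_def using H deg_nonneg by (intro sum_nonneg) auto
  have C: "deg h \<le> C" if "h \<in> H" for h
    unfolding C_def using that H deg_nonneg by (intro member_le_sum) auto
  have "\<exists>l'\<in>M' \<inter> P. l - l' \<in> face_monoid F \<and> deg l' \<le> C * partial_deg F l" if "l \<in> M' \<inter> P" for l
    using that
  proof (induction "nat \<lfloor>deg l\<rfloor>" arbitrary: l rule: less_induct)
    case less
    show ?case
    proof (cases "l = 0")
      case True
      then show ?thesis by (intro bexI[of _ 0]) (auto simp: face_monoid_0 partial_deg_def M'_0)
    next
      case False
      then obtain h where h: "h \<in> H" "h \<in> below l" using H(3) less.prems by blast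
      then have hM: "h \<in> M' \<inter> P" "h \<noteq> 0" using H(1) by auto
      have l1: "l - h \<in> M' \<inter> P" using less.prems hM belowD[OF h(2)] M'_diff by auto
      have "1 \<le> deg h" using hM deg_eq_0[of h] deg_Nats[of h] by (intro nat_pos_ge_1) auto
      moreover have "deg h \<le> deg l" using deg_below[OF h(2)] .
      ultimately have "nat \<lfloor>deg (l - h)\<rfloor> < nat \<lfloor>deg l\<rfloor>" by (simp; linarith)
      from less.hyps[OF this l1] obtain l'' where l'': "l'' \<in> M' \<inter> P" "l - h - l'' \<in> face_monoid F"
        "deg l'' \<le> C * partial_deg F (l - h)" by blast
      show ?thesis
      proof (cases "\<forall>k\<in>F. co k h = 0")
        case True
        have "h \<in> face_monoid F" using True hM by (auto simp: face_monoid_def)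
        then have "l - h - l'' + h \<in> face_monoid F" using l''(2) face_monoid_add by blast
        moreover have "partial_deg F h = 0" using True by (simp add: partial_deg_def)
        ultimately show ?thesis using l'' by (intro bexI[of _ l'']) (auto simp: partial_deg_diff)
      next
        case False
        then obtain k where k: "k \<in> F" "co k h \<noteq> 0" by blast
        have "1 \<le> co k h" using k F hM by (intro nat_pos_ge_1) (auto simp: P_iff)
        also have "\<dots> \<le> partial_deg F h"
          unfolding partial_deg_def using k F hM P_nonneg finite_subset[OF F finI]
          by (intro member_le_sum) auto
        finally have "C * 1 \<le> C * partial_deg F h" using C0 by (intro mult_left_mono)
        then have "deg (l'' + h) \<le> C * partial_deg F l"
          using l''(3) C[OF h(1)] by (simp add: partial_deg_diff right_diff_distrib)
        moreover have "l'' + h \<in> M' \<inter> P" using l''(1) hM M'_add add_P by auto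
        moreover have "l - (l'' + h) \<in> face_monoid F" using l''(2) by (simp add: algebra_simps)
        ultimately show ?thesis by blast
      qed
    qed
  qed
  then show ?thesis using that C0 by blast
qed

text \<open>
  The key finiteness statement. It yields points of \<open>T\<close> with prescribed coordinates on \<open>F\<close> whose size
  is linear in these coordinates, and it bounds every coordinate that vanishes on \<open>face_monoid F\<close>.
\<close>

lemma linear_lower_point:
  assumes F: "F \<subseteq> I"
  obtains C where "0 \<le> C"
    "\<And>m. m \<in> T \<Longrightarrow> \<exists>m'\<in>T. m - m' \<in> face_monoid F \<and> deg m' \<le> C * (1 + partial_deg F m)"
proof -
  obtain C where C: "0 \<le> C"
    "\<And>l. l \<in> M' \<inter> P \<Longrightarrow> \<exists>l'\<in>M' \<inter> P. l - l' \<in> face_monoid F \<and> deg l' \<le> C * partial_deg F l"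
    using linear_lower_monoid[OF F] by blast
  obtain B where B: "B \<subseteq> T" "finite B" "\<And>a. a \<in> T \<Longrightarrow> \<exists>b\<in>B. b \<in> below a"
    using dickson_P[OF T_P] by blast
  define D where "D = (\<Sum>h\<in>B. deg h)"
  have D0: "0 \<le> D" unfolding D_def using B T_P deg_nonneg by (intro sum_nonneg) auto
  have D: "deg h \<le> D" if "h \<in> B" for h
    unfolding D_def using that B T_P deg_nonneg by (intro member_le_sum) auto
  show ?thesis
  proof (rule that[of "C + D"])
    fix m assume m: "m \<in> T"
    obtain b where b: "b \<in> B" "b \<in> below m" using B(3)[OF m] by blast
    have bT: "b \<in> T" "b \<in> P" "m \<in> P" using b B T_P m by auto
    have "m - b \<in> M' \<inter> P" using T_diff[OF m bT(1)] belowD[OF b(2) bT(3)] by blast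
    then obtain l' where l': "l' \<in> M' \<inter> P" "m - b - l' \<in> face_monoid F" "deg l' \<le> C * partial_deg F (m - b)"
      using C(2) by blast
    have "b + l' \<in> T" using l' bT by (intro T_add add_P) auto
    moreover have "m - (b + l') \<in> face_monoid F" using l' by (simp add: algebra_simps)
    moreover have "deg (b + l') \<le> (C + D) * (1 + partial_deg F m)"
    proof -
      have "C * partial_deg F (m - b) \<le> C * partial_deg F m"
        using C(1) partial_deg_nonneg[OF F bT(2)] by (intro mult_left_mono) (auto simp: partial_deg_diff)
      moreover have "0 \<le> D * partial_deg F m" using D0 partial_deg_nonneg[OF F bT(3)] by simp
      ultimately show ?thesis using l'(3) D[OF b(1)] C(1) by (simp add: algebra_simps)
    qed
    ultimately show "\<exists>m'\<in>T. m - m' \<in> face_monoid F \<and> deg m' \<le> (C + D) * (1 + partial_deg F m)" by blast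
  qed (use C D0 in auto)
qed

text \<open>
  One vector \<open>w\<close> carries both the prescribed coordinates and the
  remaining bounds.
\<close>

definition slice :: "'i set \<Rightarrow> 'v \<Rightarrow> 'v set" where
  "slice F w = {m\<in>T. (\<forall>k\<in>F. co k m = co k w) \<and> (\<forall>k\<in>I - F. co k w \<le> co k m)}"

text \<open>
  Coefficient of \<open>E(m)\<close> in the sum of \<open>b w\<close> times the generating function of \<open>slice F w\<close>.
\<close>

definition slice_coeff :: "'i set \<Rightarrow> ('v \<Rightarrow> complex) \<Rightarrow> 'v \<Rightarrow> complex" where
  "slice_coeff F b m = (\<Sum>w\<in>{w\<in>below m. m \<in> slice F w}. b w)"

lemma slice_below: "w \<in> P \<Longrightarrow> m \<in> slice F w \<Longrightarrow> w \<in> below m"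
  by (auto simp: slice_def below_def)

lemma slice_coeff_alt: "slice_coeff F b m = (\<Sum>w\<in>below m. b w * (if m \<in> slice F w then 1 else 0))"
  unfolding slice_coeff_def sum.inter_filter[OF finite_below] by (intro sum.cong) auto

lemma slice_coeff_push:
  "slice_coeff F (push R b) m = (\<Sum>w\<in>below m. b w *
     of_nat (card {w'. w' \<in> below m \<and> w \<in> below w' \<and> R w w' \<and> m \<in> slice F w'}))"
  using sum_push[of "\<lambda>w'. w' \<in> below m \<and> m \<in> slice F w'" m R b]
  by (auto simp: slice_coeff_def cong: conj_cong)

lemma conv_push:
  "conv (push R b) A m = (\<Sum>w\<in>below m. b w *
     of_nat (card {w'. w' \<in> below m \<and> w \<in> below w' \<and> R w w' \<and> m - w' \<in> A}))"
  using sum_push[of "\<lambda>w'. w' \<in> below m \<and> m - w' \<in> A" m R b]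
  by (auto simp: conv_def cong: conj_cong)

end

context coset_points
begin

text \<open>
  If the coordinate \<open>i\<close> vanishes on \<open>face_monoid F\<close>, it takes on \<open>slice F w\<close> only values bounded linearly in
  \<open>deg w\<close>. Hence the slice is a disjoint union of slices in which \<open>i\<close> is prescribed too, and
  no convolution arises.
\<close>

lemma slice_flat_coordinate:
  assumes F: "F \<subseteq> I" and b: "exp_summable b" and i: "i \<in> I - F" and flat: "\<And>l. l \<in> face_monoid F \<Longrightarrow> co i l = 0"
  shows "\<exists>b'. exp_summable b' \<and> (\<forall>m. slice_coeff F b m = slice_coeff (insert i F) b' m)"
proof -
  obtain C where C: "0 \<le> C"
    "\<And>m. m \<in> T \<Longrightarrow> \<exists>m'\<in>T. m - m' \<in> face_monoid F \<and> deg m' \<le> C * (1 + partial_deg F m)"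
    using linear_lower_point[OF F] by blast
  define R where "R w w' \<longleftrightarrow> (\<forall>k\<in>I - {i}. co k w' = co k w) \<and> co i w' \<le> C * (1 + deg w)" for w w'
  have "exp_summable (push R b)"
  proof (rule exp_summable_push[OF b, of "C + 1"])
    fix w w' assume w: "w \<in> P" "w' \<in> P" "R w w'"
    have iI: "i \<in> I" using i by auto
    have "deg w' = co i w' + (\<Sum>k\<in>I - {i}. co k w')"
      unfolding deg_def using sum.remove[OF finI iI] by blast
    also have "(\<Sum>k\<in>I - {i}. co k w') = (\<Sum>k\<in>I - {i}. co k w)"
      using w(3) by (intro sum.cong) (auto simp: R_def)
    also have "\<dots> \<le> deg w"
      unfolding deg_def using finI P_nonneg[OF w(1)] by (intro sum_mono2) auto
    finally show "deg w' \<le> (C + 1) * (1 + deg w)"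
      using w(3) by (simp add: R_def algebra_simps)
  qed (use C in simp)
  moreover have "slice_coeff F b m = slice_coeff (insert i F) (push R b) m" for m
    unfolding slice_coeff_alt[of F] slice_coeff_push
  proof (intro sum.cong refl arg_cong2[where f = "(*)"])
    fix w assume w: "w \<in> below m"
    have wP: "w \<in> P" and wm: "\<And>k. k \<in> I \<Longrightarrow> co k w \<le> co k m" using w by (auto simp: below_def)
    \<comment> \<open>The only slice containing \<open>m\<close> prescribes the value \<open>co i m\<close>.\<close>
    define x where "x = (\<Sum>k\<in>I. (if k = i then co k m else co k w) *\<^sub>R lam k)"
    have x: "co k x = (if k = i then co k m else co k w)" if "k \<in> I" for k
      unfolding x_def using that by (simp add: co_comb)
    have "{w'. w' \<in> below m \<and> w \<in> below w' \<and> R w w' \<and> m \<in> slice (insert i F) w'}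
      = (if m \<in> slice F w then {x} else {})" (is "?S = _")
    proof (cases "m \<in> slice F w")
      case True
      then have mT: "m \<in> T" and mF: "\<And>k. k \<in> F \<Longrightarrow> co k m = co k w" by (auto simp: slice_def)
      have mP: "m \<in> P" using mT T_P by auto
      have xP: "x \<in> P" unfolding x_def using mP wP by (intro comb_P) (auto simp: P_iff)
      obtain m' where m': "m' \<in> T" "m - m' \<in> face_monoid F" "deg m' \<le> C * (1 + partial_deg F m)"
        using C(2)[OF mT] by blast
      have "co i m = co i m'" using flat[OF m'(2)] by simp
      also have "\<dots> \<le> deg m'" using m'(1) T_P i by (intro co_le_deg) auto
      also have "\<dots> \<le> C * (1 + partial_deg F m)" by (rule m'(3))
      also have "\<dots> \<le> C * (1 + deg w)"
      proof -
        have "partial_deg F m = partial_deg F w" unfolding partial_deg_def using mF by (intro sum.cong) auto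
        then show ?thesis using partial_deg_le[OF F wP] C(1) by (intro mult_left_mono) auto
      qed
      finally have bd: "co i m \<le> C * (1 + deg w)" .
      have "x \<in> ?S"
        using xP wP wm x bd mT mF i F
        by (auto simp: below_def R_def slice_def subset_iff)
      moreover have "y = x" if "y \<in> ?S" for y
      proof (rule co_eqI)
        fix k assume k: "k \<in> I"
        show "co k y = co k x" using that k x[OF k] by (auto simp: R_def slice_def)
      qed
      ultimately have "?S = {x}" by blast
      then show ?thesis using True by simp
    next
      case False
      have "m \<in> slice F w" if "w' \<in> ?S" for w'
        using that i F wm by (auto simp: R_def slice_def subset_iff)
      then show ?thesis using False by auto
    qed
    then show "(if m \<in> slice F w then 1 else 0) = (of_nat (card ?S) :: complex)" by simp
  qed
  ultimately show ?thesis by blast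
qed

text \<open>
  A multiple of \<open>l0\<close> with factor \<open>deg w\<close> lifts any point of the right coset and prescribed coordinates
  above \<open>w\<close>; starting from a point of linear size keeps the size linear.
\<close>

lemma base_point:
  assumes F: "F \<subseteq> I" and l0: "l0 \<in> face_monoid F" "\<And>k. k \<in> I - F \<Longrightarrow> 1 \<le> co k l0"
  obtains p C where "0 \<le> C"
    "\<And>w. w \<in> P \<Longrightarrow> slice F w \<noteq> {} \<Longrightarrow> p w \<in> slice F w \<and> deg (p w) \<le> C * (1 + deg w)"
proof -
  obtain C where C: "0 \<le> C"
    "\<And>m. m \<in> T \<Longrightarrow> \<exists>m'\<in>T. m - m' \<in> face_monoid F \<and> deg m' \<le> C * (1 + partial_deg F m)"
    using linear_lower_point[OF F] by blast
  have l0P: "l0 \<in> P" "l0 \<in> M'" "\<And>k. k \<in> F \<Longrightarrow> co k l0 = 0" using l0 by (auto simp: face_monoid_def)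
  have "\<exists>p. p \<in> slice F w \<and> deg p \<le> (C + deg l0) * (1 + deg w)" if w: "w \<in> P" "slice F w \<noteq> {}" for w
  proof -
    obtain m where m: "m \<in> slice F w" using w by blast
    then have mT: "m \<in> T" and mF: "\<And>k. k \<in> F \<Longrightarrow> co k m = co k w" by (auto simp: slice_def)
    obtain m' where m': "m' \<in> T" "m - m' \<in> face_monoid F" "deg m' \<le> C * (1 + partial_deg F m)"
      using C(2)[OF mT] by blast
    have m'P: "m' \<in> P" using m' T_P by auto
    obtain n where n: "deg w = real n" using deg_Nats[OF w(1)] by (auto elim: Nats_cases)
    let ?p = "m' + real n *\<^sub>R l0"
    have "co k m' = co k m" if "k \<in> F" for k using m'(2) that by (auto simp: face_monoid_def)
    then have pF: "co k ?p = co k w" if "k \<in> F" for k using that mF l0P by simp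
    have pnF: "co k w \<le> co k ?p" if "k \<in> I - F" for k
    proof -
      have "co k w \<le> real n" using co_le_deg[OF w(1)] that n by auto
      also have "\<dots> \<le> real n * co k l0" using l0(2)[OF that] by (simp add: mult_le_cancel_left1)
      also have "\<dots> \<le> co k ?p" using P_nonneg[OF m'P] that by simp
      finally show ?thesis .
    qed
    have "?p \<in> T" using m' m'P l0P by (intro T_add add_P mult_P M'_mult) auto
    then have "?p \<in> slice F w" using pF pnF by (auto simp: slice_def)
    moreover have "deg ?p \<le> (C + deg l0) * (1 + deg w)"
    proof -
      have "partial_deg F m = partial_deg F w" unfolding partial_deg_def using mF by (intro sum.cong) auto
      then have "C * (1 + partial_deg F m) \<le> C * (1 + deg w)"
        using partial_deg_le[OF F w(1)] C(1) by (intro mult_left_mono) auto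
      then show ?thesis using m'(3) deg_nonneg[OF l0P(1)] by (simp add: n algebra_simps)
    qed
    ultimately show ?thesis by blast
  qed
  then have "\<forall>w. \<exists>p. w \<in> P \<and> slice F w \<noteq> {} \<longrightarrow> p \<in> slice F w \<and> deg p \<le> (C + deg l0) * (1 + deg w)"
    by metis
  from choice[OF this] obtain p where
    "\<And>w. w \<in> P \<Longrightarrow> slice F w \<noteq> {} \<Longrightarrow> p w \<in> slice F w \<and> deg (p w) \<le> (C + deg l0) * (1 + deg w)"
    by blast
  then show ?thesis using that[of "C + deg l0" p] C(1) deg_nonneg[OF l0P(1)] by simp
qed

text \<open>
  If some \<open>l0\<close> is positive off \<open>F\<close>, the slice of \<open>w\<close> contains \<open>p w + face_monoid F\<close>. A point \<open>m\<close> of the slice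
  outside it has a coordinate below that of \<open>p w\<close>; to split the rest disjointly, take the first such
  coordinate \<open>i\<close> for an enumeration \<open>f\<close> of \<open>I\<close>. Then \<open>m\<close> lies in a slice with \<open>i\<close> prescribed and with the
  bounds of \<open>p w\<close> for the coordinates before \<open>i\<close>, those of \<open>w\<close> for the ones after.
\<close>

lemma slice_off_base_points:
  assumes F: "F \<subseteq> I" and b: "exp_summable b"
    and l0: "l0 \<in> face_monoid F" "\<And>k. k \<in> I - F \<Longrightarrow> 1 \<le> co k l0"
  obtains p B where "exp_summable (push (\<lambda>w w'. slice F w \<noteq> {} \<and> w' = p w) b)"
    "\<And>i. i \<in> I - F \<Longrightarrow> exp_summable (B i)"
    "\<And>w. w \<in> P \<Longrightarrow> slice F w \<noteq> {} \<Longrightarrow> p w \<in> P \<and> w \<in> below (p w)"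
    "\<And>m. slice_coeff F b m = conv (push (\<lambda>w w'. slice F w \<noteq> {} \<and> w' = p w) b) (face_monoid F) m
        + (\<Sum>i\<in>I - F. slice_coeff (insert i F) (B i) m)"
proof -
  obtain p C where p: "0 \<le> C"
    "\<And>w. w \<in> P \<Longrightarrow> slice F w \<noteq> {} \<Longrightarrow> p w \<in> slice F w \<and> deg (p w) \<le> C * (1 + deg w)"
    by (rule base_point[OF F l0], assumption) (rule that)
  obtain f :: "'i \<Rightarrow> nat" where f: "inj_on f I"
    using finite_imp_inj_to_nat_seg[OF finI] by blast
  define RA where "RA w w' \<longleftrightarrow> slice F w \<noteq> {} \<and> w' = p w" for w w'
  define R where "R i w w' \<longleftrightarrow> slice F w \<noteq> {} \<and> co i w' < co i (p w) \<and>
     (\<forall>k\<in>I - {i}. co k w' = (if k \<in> F then co k w else if f k < f i then co k (p w) else co k w))"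
    for i w w'
  have pP: "p w \<in> P \<and> w \<in> below (p w)" if "w \<in> P" "slice F w \<noteq> {}" for w
    using p(2)[OF that] T_P that slice_below[of w "p w" F] by (auto simp: slice_def)
  have eA: "exp_summable (push RA b)"
    by (rule exp_summable_push[OF b p(1)]) (use p(2) in \<open>auto simp: RA_def\<close>)
  have eI: "exp_summable (push (R i) b)" if i: "i \<in> I - F" for i
  proof (rule exp_summable_push[OF b p(1)])
    fix w w' assume w: "w \<in> P" "w' \<in> P" "R i w w'"
    have wp: "p w \<in> slice F w" "deg (p w) \<le> C * (1 + deg w)" using p(2)[OF w(1)] w(3) by (auto simp: R_def)
    have "co k w' \<le> co k (p w)" if "k \<in> I" for k
      using wp(1) w(3) that by (cases "k = i") (auto simp: R_def slice_def)
    then have "deg w' \<le> deg (p w)" unfolding deg_def by (intro sum_mono)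
    then show "deg w' \<le> C * (1 + deg w)" using wp by simp
  qed
  have count: "(if m \<in> slice F w then 1 else 0)
      = (of_nat (card {w'. w' \<in> below m \<and> w \<in> below w' \<and> RA w w' \<and> m - w' \<in> face_monoid F})
        + (\<Sum>i\<in>I - F. of_nat (card {w'. w' \<in> below m \<and> w \<in> below w' \<and> R i w w'
            \<and> m \<in> slice (insert i F) w'})) :: complex)"
    if w: "w \<in> below m" for w m
  proof -
    have wP: "w \<in> P" and wm: "\<And>k. k \<in> I \<Longrightarrow> co k w \<le> co k m" using w by (auto simp: below_def)
    let ?SA = "{w'. w' \<in> below m \<and> w \<in> below w' \<and> RA w w' \<and> m - w' \<in> face_monoid F}"
    let ?S = "\<lambda>i. {w'. w' \<in> below m \<and> w \<in> below w' \<and> R i w w' \<and> m \<in> slice (insert i F) w'}"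
    show "(if m \<in> slice F w then 1 else 0) = (of_nat (card ?SA) + (\<Sum>i\<in>I - F. of_nat (card (?S i))) :: complex)"
    proof (cases "m \<in> slice F w")
      case False
      have SA0: "?SA = {}"
      proof (rule ccontr)
        assume "?SA \<noteq> {}"
        then have *: "slice F w \<noteq> {}" "m - p w \<in> face_monoid F" "p w \<in> below m" by (auto simp: RA_def)
        have pw: "p w \<in> slice F w" using p(2)[OF wP *(1)] by blast
        have "p w + (m - p w) \<in> P"
          using *(2) pP[OF wP *(1)] by (intro add_P) (auto simp: face_monoid_def)
        then have "p w + (m - p w) \<in> T"
          using *(2) pw by (intro T_add) (auto simp: slice_def face_monoid_def)
        then have "m \<in> T" by simp
        moreover have "co k m = co k w" if "k \<in> F" for k
          using *(2) pw that by (auto simp: slice_def face_monoid_def)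
        ultimately have "m \<in> slice F w" using wm by (auto simp: slice_def)
        then show False using False by simp
      qed
      have S0: "?S i = {}" if i: "i \<in> I - F" for i
      proof (rule ccontr)
        assume "?S i \<noteq> {}"
        then obtain w' where w': "R i w w'" "m \<in> slice (insert i F) w'" by blast
        then have "m \<in> T" by (simp add: slice_def)
        moreover have "co k m = co k w" if k: "k \<in> F" for k
        proof -
          have "co k m = co k w'" using w'(2) k by (simp add: slice_def)
          moreover have "k \<in> I - {i}" using k F i by blast
          ultimately show ?thesis using w'(1) k by (simp add: R_def)
        qed
        ultimately show False using False wm by (auto simp: slice_def)
      qed
      have "(\<Sum>i\<in>I - F. of_nat (card (?S i)) :: complex) = 0"
        by (intro sum.neutral ballI) (simp only: S0 card.empty of_nat_0)
      then show ?thesis using False by (simp only: SA0 card.empty if_False of_nat_0 add_0)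
    next
      case True
      then have mT: "m \<in> T" and mF: "\<And>k. k \<in> F \<Longrightarrow> co k m = co k w" by (auto simp: slice_def)
      have mP: "m \<in> P" using mT T_P by auto
      have ne: "slice F w \<noteq> {}" using True by blast
      have pw: "p w \<in> P" "w \<in> below (p w)" "p w \<in> T" "\<And>k. k \<in> F \<Longrightarrow> co k (p w) = co k w"
        "\<And>k. k \<in> I - F \<Longrightarrow> co k w \<le> co k (p w)"
        using pP[OF wP ne] p(2)[OF wP ne] by (auto simp: slice_def)
      define ge where "ge \<longleftrightarrow> (\<forall>k\<in>I - F. co k (p w) \<le> co k m)"
      define sel where "sel i \<longleftrightarrow> co i m < co i (p w) \<and> (\<forall>k\<in>I - F. f k < f i \<longrightarrow> co k (p w) \<le> co k m)" for i
      have "?SA = (if ge then {p w} else {})"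
      proof (cases ge)
        case True
        then have "p w \<in> below m" unfolding below_def using pw(1,4) mF
          by (auto simp: ge_def)
        moreover from this have "m - p w \<in> face_monoid F"
          using belowD mP T_diff[OF mT pw(3)] mF pw(4) by (auto simp: face_monoid_def)
        ultimately show ?thesis using True ne pw(2) by (auto simp: RA_def)
      next
        case False
        then show ?thesis using F by (auto simp: RA_def ge_def below_def)
      qed
      then have SA: "of_nat (card ?SA) = (if ge then 1 else 0 :: complex)" by simp
      have S: "of_nat (card (?S i)) = (if sel i then 1 else 0 :: complex)" if i: "i \<in> I - F" for i
      proof -
        define x where "x = (\<Sum>k\<in>I. (if k = i then co k m else if k \<in> F then co k w
          else if f k < f i then co k (p w) else co k w) *\<^sub>R lam k)"
        have x: "co k x = (if k = i then co k m else if k \<in> F then co k w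
          else if f k < f i then co k (p w) else co k w)" if "k \<in> I" for k
          unfolding x_def using that by (simp add: co_comb)
        have xP: "x \<in> P" unfolding x_def using mP wP pw(1) by (intro comb_P) (auto simp: P_iff)
        have "?S i = (if sel i then {x} else {})"
        proof (cases "sel i")
          case True
          have "x \<in> ?S i"
          proof (intro CollectI conjI)
            show "x \<in> below m" using xP x wm True by (auto simp: below_def sel_def)
            show "w \<in> below x" using wP x wm pw(5) by (auto simp: below_def)
            show "R i w x" using ne x True i by (auto simp: R_def sel_def)
            show "m \<in> slice (insert i F) x"
              using mT mF x i F wm True by (auto simp: slice_def sel_def subset_iff)
          qed
          moreover have "y = x" if "y \<in> ?S i" for y
          proof (rule co_eqI)
            fix k assume k: "k \<in> I"
            show "co k y = co k x" using that k x[OF k] by (auto simp: R_def slice_def)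
          qed
          ultimately have "?S i = {x}" by blast
          then show ?thesis using True by simp
        next
          case False
          have "sel i" if "w' \<in> ?S i" for w'
            unfolding sel_def
          proof (intro conjI ballI impI)
            show "co i m < co i (p w)" using that by (auto simp: R_def slice_def)
            fix k assume k: "k \<in> I - F" "f k < f i"
            then have "k \<in> I - {i}" by auto
            then have "co k w' = co k (p w)" using that k by (auto simp: R_def)
            moreover have "co k w' \<le> co k m" using that k by (auto simp: below_def)
            ultimately show "co k (p w) \<le> co k m" by simp
          qed
          then show ?thesis using False by auto
        qed
        then show ?thesis by simp
      qed
      have sum: "(\<Sum>i\<in>I - F. of_nat (card (?S i))) = (\<Sum>i\<in>I - F. if sel i then 1 else 0 :: complex)"
        by (intro sum.cong S refl)
      show ?thesis
      proof (cases ge)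
        case True
        then have "\<not> sel i" if "i \<in> I - F" for i using that by (auto simp: sel_def ge_def not_less)
        then have "(\<Sum>i\<in>I - F. if sel i then 1 else 0 :: complex) = 0" by (intro sum.neutral) auto
        then show ?thesis using True \<open>m \<in> slice F w\<close> SA sum by simp
      next
        case False
        define J where "J = {k\<in>I - F. co k m < co k (p w)}"
        have J: "finite J" "J \<noteq> {}" using False finI by (auto simp: J_def ge_def not_le)
        obtain i0 where i0: "i0 \<in> J" "\<And>k. k \<in> J \<Longrightarrow> f i0 \<le> f k"
          using J arg_min_if_finite[OF J, of f] by (metis not_le)
        have "sel i \<longleftrightarrow> i = i0" if i: "i \<in> I - F" for i
        proof
          assume "i = i0"
          then show "sel i" using i0 by (force simp: sel_def J_def)
        next
          assume s: "sel i"
          then have "i \<in> J" using i by (auto simp: sel_def J_def)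
          then have "f i0 \<le> f i" by (rule i0(2))
          moreover have "\<not> f i0 < f i" using s i0(1) by (force simp: sel_def J_def)
          ultimately have "f i = f i0" by simp
          then show "i = i0" using f i i0(1) by (auto simp: J_def dest: inj_onD)
        qed
        then have "(\<Sum>i\<in>I - F. if sel i then 1 else 0 :: complex) = (\<Sum>i\<in>I - F. if i = i0 then 1 else 0)"
          by (intro sum.cong) auto
        also have "\<dots> = 1" using i0(1) finI by (auto simp: J_def)
        finally show ?thesis using False \<open>m \<in> slice F w\<close> SA sum by simp
      qed
    qed
  qed
  have "slice_coeff F b m = conv (push RA b) (face_monoid F) m + (\<Sum>i\<in>I - F. slice_coeff (insert i F) (push (R i) b) m)" for m
  proof -
    let ?SA = "\<lambda>w. {w'. w' \<in> below m \<and> w \<in> below w' \<and> RA w w' \<and> m - w' \<in> face_monoid F}"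
    let ?SI = "\<lambda>i w. {w'. w' \<in> below m \<and> w \<in> below w' \<and> R i w w' \<and> m \<in> slice (insert i F) w'}"
    have "b w * (if m \<in> slice F w then 1 else 0)
        = b w * of_nat (card (?SA w)) + (\<Sum>i\<in>I - F. b w * of_nat (card (?SI i w)))"
      if "w \<in> below m" for w
      unfolding count[OF that] by (simp add: distrib_left sum_distrib_left)
    then show ?thesis
      unfolding slice_coeff_alt[of F] slice_coeff_push conv_push
      by (simp add: sum.distrib) (rule sum.swap)
  qed
  then show ?thesis
    using pP eA eI unfolding RA_def by (intro that[of p "\<lambda>i. push (R i) b"])
qed

text \<open>
  Induction on the number of free coordinates. Either some free coordinate vanishes on \<open>face_monoid F\<close>, or
  adding up witnesses gives an element positive off \<open>F\<close>; the two preceding reductions apply.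
\<close>

lemma slice_coeff_decomposition:
  assumes "F \<subseteq> I" "exp_summable b"
  shows "\<exists>G. (\<forall>F'. exp_summable (G F')) \<and> (\<forall>F'. \<not> F \<subseteq> F' \<longrightarrow> G F' = (\<lambda>_. 0)) \<and>
    (\<forall>m. slice_coeff F b m = (\<Sum>F'\<in>Pow I. conv (G F') (face_monoid F') m))"
  using assms
proof (induction "card (I - F)" arbitrary: F b rule: less_induct)
  case less
  note F = less.prems(1) and b = less.prems(2)
  have card: "card (I - insert i F) < card (I - F)" "insert i F \<subseteq> I" if "i \<in> I - F" for i
  proof -
    have "I - insert i F \<subset> I - F" using that by blast
    then show "card (I - insert i F) < card (I - F)" using finI by (intro psubset_card_mono) auto
    show "insert i F \<subseteq> I" using that F by blast
  qed
  show ?case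
  proof (cases "\<exists>i\<in>I - F. \<forall>l\<in>face_monoid F. co i l = 0")
    case True
    then obtain i where i: "i \<in> I - F" "\<And>l. l \<in> face_monoid F \<Longrightarrow> co i l = 0" by blast
    obtain b' where b': "exp_summable b'" "\<And>m. slice_coeff F b m = slice_coeff (insert i F) b' m"
      using slice_flat_coordinate[OF F b i] by blast
    from less.hyps[OF card[OF i(1)] b'(1)] obtain G where
      "\<forall>F'. exp_summable (G F')" "\<forall>F'. \<not> insert i F \<subseteq> F' \<longrightarrow> G F' = (\<lambda>_. 0)"
      "\<forall>m. slice_coeff (insert i F) b' m = (\<Sum>F'\<in>Pow I. conv (G F') (face_monoid F') m)" by blast
    then show ?thesis using b'(2) by (intro exI[of _ G]) auto
  next
    case False
    then have "\<forall>i. \<exists>l. i \<in> I - F \<longrightarrow> l \<in> face_monoid F \<and> co i l \<noteq> 0" by blast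
    from choice[OF this] obtain L where L: "\<And>i. i \<in> I - F \<Longrightarrow> L i \<in> face_monoid F \<and> co i (L i) \<noteq> 0" by blast
    have sumL: "(\<Sum>i\<in>J. L i) \<in> face_monoid F" if "J \<subseteq> I - F" for J
      using finite_subset[OF that finite_Diff[OF finI]] that
      by (induction J rule: finite_induct) (auto simp: face_monoid_0 L intro!: face_monoid_add)
    define l0 where "l0 = (\<Sum>i\<in>I - F. L i)"
    have l0: "l0 \<in> face_monoid F" unfolding l0_def by (rule sumL) simp
    have l0ge: "1 \<le> co k l0" if k: "k \<in> I - F" for k
    proof -
      have LP: "L i \<in> P" if "i \<in> I - F" for i using L[OF that] by (auto simp: face_monoid_def)
      have "1 \<le> co k (L k)" using L[OF k] LP[OF k] k by (intro nat_pos_ge_1) (auto simp: P_iff)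
      also have "\<dots> \<le> co k l0"
        unfolding l0_def co_sum using k finI LP P_nonneg by (intro member_le_sum) auto
      finally show ?thesis .
    qed
    obtain p B where pB: "exp_summable (push (\<lambda>w w'. slice F w \<noteq> {} \<and> w' = p w) b)"
      "\<And>i. i \<in> I - F \<Longrightarrow> exp_summable (B i)"
      "\<And>m. slice_coeff F b m = conv (push (\<lambda>w w'. slice F w \<noteq> {} \<and> w' = p w) b) (face_monoid F) m
        + (\<Sum>i\<in>I - F. slice_coeff (insert i F) (B i) m)"
      by (rule slice_off_base_points[OF F b l0 l0ge], assumption) (rule that)
    have "\<forall>i. \<exists>G. i \<in> I - F \<longrightarrow> (\<forall>F'. exp_summable (G F')) \<and> (\<forall>F'. \<not> insert i F \<subseteq> F' \<longrightarrow> G F' = (\<lambda>_. 0)) \<and>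
      (\<forall>m. slice_coeff (insert i F) (B i) m = (\<Sum>F'\<in>Pow I. conv (G F') (face_monoid F') m))"
      using less.hyps[OF card pB(2)] by blast
    from choice[OF this] obtain G where G: "\<And>i F'. i \<in> I - F \<Longrightarrow> exp_summable (G i F')"
      "\<And>i F'. i \<in> I - F \<Longrightarrow> \<not> insert i F \<subseteq> F' \<Longrightarrow> G i F' = (\<lambda>_. 0)"
      "\<And>i m. i \<in> I - F \<Longrightarrow> slice_coeff (insert i F) (B i) m = (\<Sum>F'\<in>Pow I. conv (G i F') (face_monoid F') m)"
      by blast
    define g where "g = push (\<lambda>w w'. slice F w \<noteq> {} \<and> w' = p w) b"
    define H where "H F' w = (if F' = F then g w else 0) + (\<Sum>i\<in>I - F. G i F' w)" for F' w
    have "exp_summable (H F')" for F'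
      unfolding H_def using pB(1) G(1) finI
      by (cases "F' = F"; intro exp_summable_add exp_summable_sum) (auto simp: g_def[symmetric] exp_summable_zero)
    moreover have "H F' = (\<lambda>_. 0)" if "\<not> F \<subseteq> F'" for F'
    proof -
      have "G i F' = (\<lambda>_. 0)" if "i \<in> I - F" for i
        using G(2)[OF that] \<open>\<not> F \<subseteq> F'\<close> by blast
      then show ?thesis using that by (auto simp: H_def)
    qed
    moreover have "slice_coeff F b m = (\<Sum>F'\<in>Pow I. conv (H F') (face_monoid F') m)" for m
    proof -
      have "(\<Sum>F'\<in>Pow I. conv (H F') (face_monoid F') m)
        = (\<Sum>F'\<in>Pow I. conv (\<lambda>w. if F' = F then g w else 0) (face_monoid F') m)
          + (\<Sum>F'\<in>Pow I. \<Sum>i\<in>I - F. conv (G i F') (face_monoid F') m)"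
        unfolding H_def by (simp add: conv_add conv_sum sum.distrib)
      also have "(\<Sum>F'\<in>Pow I. conv (\<lambda>w. if F' = F then g w else 0) (face_monoid F') m)
        = (\<Sum>F'\<in>Pow I. if F' = F then conv g (face_monoid F) m else 0)"
        by (intro sum.cong) (auto simp: conv_zero)
      also have "\<dots> = conv g (face_monoid F) m" using F finI by simp
      also have "(\<Sum>F'\<in>Pow I. \<Sum>i\<in>I - F. conv (G i F') (face_monoid F') m)
        = (\<Sum>i\<in>I - F. slice_coeff (insert i F) (B i) m)"
        by (subst sum.swap) (simp add: G(3))
      finally show ?thesis using pB(3)[of m] by (simp add: g_def)
    qed
    ultimately show ?thesis by blast
  qed
qed

end

section \<open>Series, products and holomorphy\<close>

lemma has_sum_sum:
  fixes f :: "'k \<Rightarrow> 'a \<Rightarrow> 'b::topological_comm_monoid_add"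
  assumes "\<And>k. k \<in> K \<Longrightarrow> (f k has_sum S k) A"
  shows "((\<lambda>x. \<Sum>k\<in>K. f k x) has_sum (\<Sum>k\<in>K. S k)) A"
  using assms by (induction K rule: infinite_finite_induct) (auto intro!: has_sum_add)

lemma abs_summable_times:
  fixes f :: "'a \<Rightarrow> complex" and g :: "'b \<Rightarrow> complex"
  assumes "(\<lambda>x. norm (f x)) summable_on A" "(\<lambda>x. norm (g x)) summable_on B"
  shows "(\<lambda>(x, y). norm (f x * g y)) summable_on A \<times> B"
    "infsum f A * infsum g B = (\<Sum>\<^sub>\<infinity>(x, y)\<in>A \<times> B. f x * g y)"
    "(\<lambda>(x, y). f x * g y) summable_on A \<times> B"
proof -
  have abs: "(\<lambda>p. norm ((\<lambda>(x, y). f x * g y) p)) summable_on A \<times> B"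
    unfolding Infinite_Sum.abs_summable_on_Sigma_iff
    using assms by (auto simp: norm_mult infsum_cmult_right' abs_mult intro!: summable_on_cmult_left summable_on_cmult_right)
  then show *: "(\<lambda>(x, y). norm (f x * g y)) summable_on A \<times> B" by (simp add: case_prod_unfold)
  show **: "(\<lambda>(x, y). f x * g y) summable_on A \<times> B"
    by (rule abs_summable_summable[OF abs])
  from infsum_Sigma'_banach[OF **]
  show "infsum f A * infsum g B = (\<Sum>\<^sub>\<infinity>(x, y)\<in>A \<times> B. f x * g y)"
    by (simp add: infsum_cmult_left' infsum_cmult_right')
qed

context cone_lattice
begin

text \<open>
  The series over \<open>P\<close>, that is the Laplace transform of the coefficient function \<open>c\<close>.
\<close>

definition ser :: "('v \<Rightarrow> complex) \<Rightarrow> ('v \<Rightarrow>\<^sub>L complex) \<Rightarrow> complex" where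
  "ser c s = (\<Sum>\<^sub>\<infinity>m\<in>P. c m * q_neg q s m)"

lemma ser_Lser: "ser c s = Lser N \<Lambda> c (q_neg q s)"
  by (simp add: ser_def Lser_def P_def)

lemma summable_E:
  assumes "s \<in> tube0" shows "(\<lambda>m. norm (q_neg q s m)) summable_on P"
proof -
  obtain \<delta> where \<delta>: "\<delta> > 0" "\<And>i. i \<in> I \<Longrightarrow> \<delta> \<le> Re (blinfun_apply s (lam i))"
    using tube0_delta[OF assms] by blast
  show ?thesis
    by (rule summable_on_comparison_test[OF summable_deg[OF \<delta>(1)]]) (use norm_E_le[OF \<delta>(2)] in auto)
qed

lemma norm_E_le_1:
  assumes "s \<in> tube0" "m \<in> P" shows "norm (q_neg q s m) \<le> 1"
proof -
  obtain \<delta> where \<delta>: "\<delta> > 0" "\<And>i. i \<in> I \<Longrightarrow> \<delta> \<le> Re (blinfun_apply s (lam i))"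
    using tube0_delta[OF assms(1)] by blast
  have "- \<delta> * deg m \<le> 0" using \<delta>(1) deg_nonneg[OF assms(2)] by simp
  then have "q powr (- \<delta> * deg m) \<le> q powr 0" using q_ge_2 by (intro powr_mono) auto
  then show ?thesis using norm_E_le[OF \<delta>(2) assms(2)] q_ge_2 by simp
qed

lemma exp_summable_times_E:
  assumes "exp_summable g" "s \<in> tube0" shows "(\<lambda>w. norm (g w * q_neg q s w)) summable_on P"
  by (rule summable_on_comparison_test[OF exp_summable_norm[OF assms(1)]])
     (use norm_E_le_1[OF assms(2)] in \<open>auto simp: norm_mult intro!: mult_right_le_one_le\<close>)

text \<open>
  Substitution \<open>m = w + l\<close> in a double series.
\<close>

lemma infsum_pairs:
  fixes h :: "'v \<Rightarrow> 'v \<Rightarrow> complex"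
  assumes A: "A \<subseteq> P" and sum: "(\<lambda>(w, l). h (w + l) w) summable_on P \<times> A"
  shows "(\<Sum>\<^sub>\<infinity>(w, l)\<in>P \<times> A. h (w + l) w) = (\<Sum>\<^sub>\<infinity>m\<in>P. \<Sum>w\<in>{w\<in>below m. m - w \<in> A}. h m w)"
    "(\<lambda>m. \<Sum>w\<in>{w\<in>below m. m - w \<in> A}. h m w) summable_on P"
proof -
  let ?S = "Sigma P (\<lambda>m. {w\<in>below m. m - w \<in> A})"
  let ?t = "\<lambda>(w, l). (w + l, w)"
  have bij: "bij_betw ?t (P \<times> A) ?S"
    by (rule bij_betwI[of _ _ _ "\<lambda>(m, w). (w, m - w)"])
       (use A P_nonneg in \<open>auto simp: below_def intro!: add_P\<close>)
  have eq: "(\<lambda>x. (\<lambda>(m, w). h m w) (?t x)) = (\<lambda>(w, l). h (w + l) w)" by auto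
  have S: "(\<lambda>(m, w). h m w) summable_on ?S"
    using summable_on_reindex_bij_betw[OF bij, of "\<lambda>(m, w). h m w"] sum unfolding eq by blast
  have inner: "(\<Sum>\<^sub>\<infinity>w\<in>{w\<in>below m. m - w \<in> A}. h m w) = (\<Sum>w\<in>{w\<in>below m. m - w \<in> A}. h m w)" for m
    using finite_below[of m] by simp
  show "(\<Sum>\<^sub>\<infinity>(w, l)\<in>P \<times> A. h (w + l) w) = (\<Sum>\<^sub>\<infinity>m\<in>P. \<Sum>w\<in>{w\<in>below m. m - w \<in> A}. h m w)"
    using infsum_Sigma'_banach[OF S] infsum_reindex_bij_betw[OF bij, of "\<lambda>(m, w). h m w"]
    unfolding eq inner by simp
  show "(\<lambda>m. \<Sum>w\<in>{w\<in>below m. m - w \<in> A}. h m w) summable_on P"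
    using summable_on_Sigma_banach[OF S] unfolding inner .
qed

lemma ser_conv:
  assumes g: "exp_summable g" and s: "s \<in> tube0" and A: "A \<subseteq> P"
  shows "ser (conv g A) s = ser g s * (\<Sum>\<^sub>\<infinity>l\<in>A. q_neg q s l)"
    "(\<lambda>m. conv g A m * q_neg q s m) summable_on P"
proof -
  let ?E = "q_neg q s"
  note prod = abs_summable_times[OF exp_summable_times_E[OF g s] summable_on_subset[OF summable_E[OF s] A]]
  have eq: "(\<lambda>(w, l). g w * ?E w * ?E l) = (\<lambda>(w, l). (\<lambda>m w. g w * ?E m) (w + l) w)"
    by (auto simp: E_add)
  note pairs = infsum_pairs[OF A, of "\<lambda>m w. g w * ?E m"]
  show "ser (conv g A) s = ser g s * (\<Sum>\<^sub>\<infinity>l\<in>A. ?E l)"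
    using prod(2,3) pairs(1) unfolding eq by (simp add: ser_def conv_def sum_distrib_right)
  show "(\<lambda>m. conv g A m * ?E m) summable_on P"
    using prod(3) pairs(2) unfolding eq by (simp add: conv_def sum_distrib_right)
qed

text \<open>
  At \<open>s = 0\<close> all exponentials are 1, so transport along a function does not change the sum.
\<close>

lemma ser_push_zero:
  assumes b: "exp_summable b" and p: "\<And>w. w \<in> P \<Longrightarrow> Q w \<Longrightarrow> p w \<in> P \<and> w \<in> below (p w)"
  shows "ser (push (\<lambda>w w'. Q w \<and> w' = p w) b) 0 = (\<Sum>\<^sub>\<infinity>w\<in>{w\<in>P. Q w}. b w)"
proof -
  let ?S = "Sigma P (\<lambda>w'. {w\<in>below w'. Q w \<and> w' = p w})"
  have bij: "bij_betw (\<lambda>w. (p w, w)) {w\<in>P. Q w} ?S"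
    by (rule bij_betwI[of _ _ _ snd]) (use p in \<open>auto simp: below_def\<close>)
  have "b summable_on {w\<in>P. Q w}"
    by (rule abs_summable_summable, rule summable_on_subset[OF exp_summable_norm[OF b]]) auto
  then have sum: "(\<lambda>(w', w). b w) summable_on ?S"
    using summable_on_reindex_bij_betw[OF bij, of "\<lambda>(w', w). b w"] by simp
  have "ser (push (\<lambda>w w'. Q w \<and> w' = p w) b) 0
      = (\<Sum>\<^sub>\<infinity>w'\<in>P. \<Sum>\<^sub>\<infinity>w\<in>{w\<in>below w'. Q w \<and> w' = p w}. b w)"
    unfolding ser_def using finite_below by (intro infsum_cong) (simp add: push_def E_exp)
  also have "\<dots> = infsum (\<lambda>(w', w). b w) ?S"
    by (rule infsum_Sigma'_banach[OF sum])
  also have "\<dots> = (\<Sum>\<^sub>\<infinity>w\<in>{w\<in>P. Q w}. b w)"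
    using infsum_reindex_bij_betw[OF bij, of "\<lambda>(w', w). b w"] by simp
  finally show ?thesis .
qed

lemma summable_deg_sq:
  assumes "\<theta> > 0"
  shows "(\<lambda>m. (deg m)\<^sup>2 * q powr (- \<theta> * deg m)) summable_on P"
proof -
  define L where "L = ln (real q)"
  have L: "L > 0" using q_ge_2 by (simp add: L_def)
  define K where "K = (4 / (L * \<theta>))\<^sup>2"
  have le: "(deg m)\<^sup>2 * q powr (- \<theta> * deg m) \<le> K * q powr (- (\<theta> / 2) * deg m)" if "m \<in> P" for m
  proof -
    define y where "y = L * \<theta> / 4 * deg m"
    have y: "0 \<le> y" using L assms deg_nonneg[OF that] by (simp add: y_def)
    have ye: "y \<le> exp y" using exp_ge_add_one_self[of y] by linarith
    have "deg m = 4 / (L * \<theta>) * y" using L assms by (simp add: y_def)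
    then have "(deg m)\<^sup>2 = K * y\<^sup>2" by (simp add: K_def power_mult_distrib power2_eq_square)
    also have "\<dots> \<le> K * (exp y)\<^sup>2"
      using y ye by (intro mult_left_mono power_mono) (auto simp: K_def)
    also have "(exp y)\<^sup>2 = q powr (\<theta> / 2 * deg m)"
      using q_ge_2 by (simp add: powr_def y_def L_def mult_ac flip: exp_of_nat_mult exp_double)
    finally have "(deg m)\<^sup>2 * q powr (- \<theta> * deg m) \<le> K * q powr (\<theta> / 2 * deg m) * q powr (- \<theta> * deg m)"
      by (intro mult_right_mono) auto
    also have "\<dots> = K * q powr (- (\<theta> / 2) * deg m)" by (simp add: mult.assoc flip: powr_add)
    finally show ?thesis .
  qed
  have "(\<lambda>m. K * q powr (- (\<theta> / 2) * deg m)) summable_on P"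
    by (intro summable_on_cmult_right summable_deg) (use assms in auto)
  from summable_on_comparison_test[OF this le] show ?thesis by simp
qed

lemma norm_apply_le:
  obtains K where "K \<ge> 0" "\<And>m (h :: 'v \<Rightarrow>\<^sub>L complex). m \<in> P \<Longrightarrow> norm (blinfun_apply h m) \<le> norm h * (K * deg m)"
proof
  define K where "K = (\<Sum>i\<in>I. norm (lam i))"
  show "K \<ge> 0" by (auto simp: K_def intro: sum_nonneg)
  fix m and h :: "'v \<Rightarrow>\<^sub>L complex" assume m: "m \<in> P"
  have "norm m \<le> (\<Sum>i\<in>I. norm (co i m *\<^sub>R lam i))"
    using norm_sum[of "\<lambda>i. co i m *\<^sub>R lam i" I] by (simp only: coordinate_expansion)
  also have "\<dots> \<le> (\<Sum>i\<in>I. norm (lam i) * deg m)"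
  proof (rule sum_mono)
    fix i assume i: "i \<in> I"
    show "norm (co i m *\<^sub>R lam i) \<le> norm (lam i) * deg m"
      using P_nonneg[OF m i] co_le_deg[OF m i] by (simp add: mult.commute mult_left_mono)
  qed
  also have "\<dots> = K * deg m" by (simp add: K_def sum_distrib_right)
  finally have "norm h * norm m \<le> norm h * (K * deg m)" by (intro mult_left_mono) auto
  then show "norm (blinfun_apply h m) \<le> norm h * (K * deg m)" using norm_blinfun[of h m] by linarith
qed

lemma exp_remainder: "norm (exp w - 1 - w) \<le> norm w ^ 2 * exp (norm w)" for w :: complex
  using Taylor_exp_field[of w 1] by (simp add: numeral_2_eq_2 mult_ac diff_diff_eq)

text \<open>
  Term by term derivative. The remainder of each exponential is at most the square of the increment
  times an exponential (\<open>exp_remainder\<close>); for increments of norm at most \<open>\<rho>\<close> this exponential eats only half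
  of the decay \<open>\<delta>\<close>, and the series of the remainders is \<open>O(norm h ^ 2)\<close>.
\<close>

lemma holomorphic_series:
  assumes A: "A \<subseteq> P" and c: "\<And>m. m \<in> A \<Longrightarrow> norm (c m) \<le> B"
  shows "dual_holomorphic_on (\<lambda>s. \<Sum>\<^sub>\<infinity>m\<in>A. c m * q_neg q s m) tube0"
  unfolding dual_holomorphic_on_def
proof (intro ballI)
  fix s :: "'v \<Rightarrow>\<^sub>L complex" assume s: "s \<in> tube0"
  obtain \<delta> where \<delta>: "\<delta> > 0" "\<And>i. i \<in> I \<Longrightarrow> \<delta> \<le> Re (blinfun_apply s (lam i))"
    using tube0_delta[OF s] by blast
  obtain K where K: "K \<ge> 0" "\<And>m (h :: 'v \<Rightarrow>\<^sub>L complex). m \<in> P \<Longrightarrow> norm (blinfun_apply h m) \<le> norm h * (K * deg m)"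
    using norm_apply_le by blast
  define L where "L = ln (real q)"
  have L: "L > 0" using q_ge_2 by (simp add: L_def)
  define k where "k = L * K + 1"
  have k: "k > 0" using L K(1) by (simp add: k_def add_nonneg_pos)
  let ?E = "q_neg q s"
  define W where "W h m = - of_real L * blinfun_apply h m" for h :: "'v \<Rightarrow>\<^sub>L complex" and m
  have EW: "q_neg q (s + h) m = ?E m * exp (W h m)" for h m
    by (simp add: E_exp W_def L_def blinfun.add_left algebra_simps flip: exp_add)
  have W: "norm (W h m) \<le> norm h * (k * deg m)" if "m \<in> P" for h m
  proof -
    have "norm (W h m) = L * norm (blinfun_apply h m)" using L by (simp add: W_def norm_mult)
    also have "\<dots> \<le> L * (norm h * (K * deg m))" using K(2)[OF that] L by (intro mult_left_mono) auto
    also have "\<dots> = norm h * (L * K * deg m)" by simp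
    also have "\<dots> \<le> norm h * (k * deg m)"
      using deg_nonneg[OF that] by (intro mult_left_mono mult_right_mono) (auto simp: k_def)
    finally show ?thesis .
  qed
  define B' where "B' = max B 0"
  have B': "B' \<ge> 0" "\<And>m. m \<in> A \<Longrightarrow> norm (c m) \<le> B'" using c by (auto simp: B'_def max.coboundedI1)
  \<comment> \<open>For \<open>norm h \<le> \<rho>\<close> the increment \<open>W h m\<close> costs at most half of the decay \<open>\<delta>\<close>.\<close>
  define \<rho> where "\<rho> = L * \<delta> / (2 * k)"
  have \<rho>: "\<rho> > 0" using L \<delta> k by (simp add: \<rho>_def)
  define u where "u m = B' * k\<^sup>2 * ((deg m)\<^sup>2 * q powr (- (\<delta> / 2) * deg m))" for m
  define v where "v m = B' * k * ((deg m)\<^sup>2 * q powr (- \<delta> * deg m))" for m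
  have u: "u summable_on A" unfolding u_def
    by (rule summable_on_subset[OF _ A], intro summable_on_cmult_right summable_deg_sq) (use \<delta> in auto)
  have v: "v summable_on A" unfolding v_def
    by (rule summable_on_subset[OF _ A], intro summable_on_cmult_right summable_deg_sq) (use \<delta> in auto)
  have cE: "norm (c m * ?E m) \<le> B' * q powr (- \<delta> * deg m)" if "m \<in> A" for m
    using norm_E_le[OF \<delta>(2), of m] B'(1) B'(2)[OF that] A that
    by (auto simp: norm_mult intro!: mult_mono)
  have s0: "(\<lambda>m. c m * ?E m) summable_on A"
    by (rule abs_summable_summable, rule summable_on_comparison_test[OF _ cE],
        rule summable_on_cmult_right, rule summable_on_subset[OF summable_deg[OF \<delta>(1)] A]) auto
  have b1: "norm (c m * ?E m * W h m) \<le> norm h * v m" if m: "m \<in> A" for m h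
  proof -
    have mP: "m \<in> P" using A m by auto
    have "deg m \<le> (deg m)\<^sup>2" using deg_Nats[OF mP]
      by (auto elim!: Nats_cases simp: power2_eq_square le_square simp flip: of_nat_mult)
    then have "norm h * (k * deg m) \<le> norm h * (k * (deg m)\<^sup>2)" using k by (intro mult_left_mono) auto
    then have "norm (W h m) \<le> norm h * (k * (deg m)\<^sup>2)" using W[OF mP] order_trans by blast
    then have "norm (c m * ?E m * W h m) \<le> B' * q powr (- \<delta> * deg m) * (norm h * (k * (deg m)\<^sup>2))"
      unfolding norm_mult[of "c m * ?E m"] using cE[OF m] B'(1) by (intro mult_mono) auto
    then show ?thesis by (simp add: v_def mult_ac)
  qed
  have s1: "(\<lambda>m. norm (c m * ?E m * W h m)) summable_on A" for h
    by (rule summable_on_comparison_test[OF summable_on_cmult_right[OF v] b1]) auto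
  have b2: "norm (c m * ?E m * (exp (W h m) - 1 - W h m)) \<le> (norm h)\<^sup>2 * u m"
    if m: "m \<in> A" and h: "norm h \<le> \<rho>" for m h
  proof -
    have mP: "m \<in> P" using A m by auto
    have d: "0 \<le> deg m" using deg_nonneg[OF mP] .
    have "norm (W h m) \<le> norm h * (k * deg m)" by (rule W[OF mP])
    also have "\<dots> \<le> \<rho> * (k * deg m)" using h k d by (intro mult_right_mono) auto
    also have "\<dots> = L * (\<delta> / 2 * deg m)" using k by (simp add: \<rho>_def)
    finally have "exp (norm (W h m)) \<le> exp (L * (\<delta> / 2 * deg m))" by simp
    also have "\<dots> = q powr (\<delta> / 2 * deg m)" using q_ge_2 by (simp add: powr_def L_def mult.commute)
    finally have e: "exp (norm (W h m)) \<le> q powr (\<delta> / 2 * deg m)" .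
    have "norm (W h m) ^ 2 * exp (norm (W h m)) \<le> (norm h * (k * deg m))\<^sup>2 * q powr (\<delta> / 2 * deg m)"
      using W[OF mP, of h] e by (intro mult_mono power_mono) auto
    then have "norm (exp (W h m) - 1 - W h m) \<le> (norm h * (k * deg m))\<^sup>2 * q powr (\<delta> / 2 * deg m)"
      using exp_remainder order_trans by blast
    then have "norm (c m * ?E m * (exp (W h m) - 1 - W h m))
        \<le> B' * q powr (- \<delta> * deg m) * ((norm h * (k * deg m))\<^sup>2 * q powr (\<delta> / 2 * deg m))"
      unfolding norm_mult[of "c m * ?E m"] using cE[OF m] B'(1) by (intro mult_mono) auto
    also have "\<dots> = (norm h)\<^sup>2 * (B' * k\<^sup>2 * ((deg m)\<^sup>2 * (q powr (- \<delta> * deg m) * q powr (\<delta> / 2 * deg m))))"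
      by (simp add: power_mult_distrib mult_ac)
    also have "q powr (- \<delta> * deg m) * q powr (\<delta> / 2 * deg m) = q powr (- (\<delta> / 2) * deg m)"
      by (simp flip: powr_add)
    finally show ?thesis by (simp add: u_def)
  qed
  define F where "F s = (\<Sum>\<^sub>\<infinity>m\<in>A. c m * q_neg q s m)" for s
  define D where "D h = (\<Sum>\<^sub>\<infinity>m\<in>A. c m * ?E m * W h m)" for h
  have s1': "(\<lambda>m. c m * ?E m * W h m) summable_on A" for h by (rule abs_summable_summable[OF s1])
  have rem: "norm (F (s + h) - F s - D h) \<le> (norm h)\<^sup>2 * infsum u A" if h: "norm h \<le> \<rho>" for h
  proof -
    have s2: "(\<lambda>m. norm (c m * ?E m * (exp (W h m) - 1 - W h m))) summable_on A"
      by (rule summable_on_comparison_test[OF summable_on_cmult_right[OF u] b2[OF _ h]]) auto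
    have "F (s + h) = (\<Sum>\<^sub>\<infinity>m\<in>A. c m * ?E m + c m * ?E m * W h m + c m * ?E m * (exp (W h m) - 1 - W h m))"
      unfolding F_def EW by (intro infsum_cong) (simp add: algebra_simps)
    also have "\<dots> = F s + D h + (\<Sum>\<^sub>\<infinity>m\<in>A. c m * ?E m * (exp (W h m) - 1 - W h m))"
      unfolding F_def D_def
      by (subst infsum_add, intro summable_on_add s0 s1', rule abs_summable_summable[OF s2],
          subst infsum_add, rule s0, rule s1') simp
    finally have "norm (F (s + h) - F s - D h) = norm (\<Sum>\<^sub>\<infinity>m\<in>A. c m * ?E m * (exp (W h m) - 1 - W h m))"
      by simp
    also have "\<dots> \<le> (\<Sum>\<^sub>\<infinity>m\<in>A. (norm h)\<^sup>2 * u m)"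
      by (rule norm_infsum_le[OF has_sum_infsum[OF abs_summable_summable[OF s2]]
            has_sum_infsum[OF summable_on_cmult_right[OF u]]]) (use b2[OF _ h] in auto)
    also have "\<dots> = (norm h)\<^sup>2 * infsum u A" by (rule infsum_cmult_right')
    finally show ?thesis .
  qed
  have blD: "bounded_linear D"
  proof (rule bounded_linear_intro[where K = "infsum v A"])
    show "D (x + y) = D x + D y" for x y
      unfolding D_def infsum_add[OF s1' s1', symmetric]
      by (intro infsum_cong) (simp add: W_def blinfun.add_left algebra_simps)
    show "D (r *\<^sub>R x) = r *\<^sub>R D x" for r x
      unfolding D_def infsum_scaleR_right[symmetric]
      by (intro infsum_cong) (simp add: W_def blinfun.scaleR_left)
    show "norm (D x) \<le> norm x * infsum v A" for x
    proof -
      have "norm (D x) \<le> (\<Sum>\<^sub>\<infinity>m\<in>A. norm x * v m)" unfolding D_def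
        by (rule norm_infsum_le[OF has_sum_infsum[OF s1']
            has_sum_infsum[OF summable_on_cmult_right[OF v]]]) (use b1 in auto)
      also have "\<dots> = norm x * infsum v A" by (rule infsum_cmult_right')
      finally show ?thesis .
    qed
  qed
  have "((\<lambda>h. norm (F (s + h) - F s - D h) / norm h) \<longlongrightarrow> 0) (at 0)"
  proof (rule Lim_null_comparison)
    show "\<forall>\<^sub>F h in at 0. norm (norm (F (s + h) - F s - D h) / norm h) \<le> norm h * infsum u A"
      unfolding eventually_at
    proof (intro exI[of _ \<rho>] conjI ballI impI \<rho>)
      fix h :: "'v \<Rightarrow>\<^sub>L complex" assume h: "h \<noteq> 0 \<and> dist h 0 < \<rho>"
      then show "norm (norm (F (s + h) - F s - D h) / norm h) \<le> norm h * infsum u A"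
        using rem[of h] by (simp add: divide_simps power2_eq_square mult_ac)
    qed
    show "((\<lambda>h. norm h * infsum u A) \<longlongrightarrow> 0) (at 0)"
      by (rule tendsto_eq_intros tendsto_norm_zero refl tendsto_ident_at | simp)+
  qed
  then have "(F has_derivative D) (at s)"
    using blD unfolding has_derivative_at by blast
  then have "(F has_derivative D) (at s within tube0)" by (rule has_derivative_at_withinI)
  moreover have "D (blinfun_mult_right a o\<^sub>L h) = a * D h" for a h
    unfolding D_def infsum_cmult_right'[symmetric] by (intro infsum_cong) (simp add: W_def mult_ac)
  ultimately show "\<exists>f'. ((\<lambda>s. \<Sum>\<^sub>\<infinity>m\<in>A. c m * q_neg q s m) has_derivative f') (at s within tube0) \<and>
        (\<forall>c h. f' (blinfun_mult_right c o\<^sub>L h) = c * f' h)"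
    unfolding F_def by blast
qed

lemma dual_holomorphic_mult:
  assumes "dual_holomorphic_on f D" "dual_holomorphic_on g D"
  shows "dual_holomorphic_on (\<lambda>s. f s * g s) D"
  unfolding dual_holomorphic_on_def
proof
  fix s assume s: "s \<in> D"
  obtain f' where f': "(f has_derivative f') (at s within D)"
    "\<And>c h. f' (blinfun_mult_right c o\<^sub>L h) = c * f' h"
    using assms(1) s unfolding dual_holomorphic_on_def by blast
  obtain g' where g': "(g has_derivative g') (at s within D)"
    "\<And>c h. g' (blinfun_mult_right c o\<^sub>L h) = c * g' h"
    using assms(2) s unfolding dual_holomorphic_on_def by blast
  show "\<exists>f'. ((\<lambda>s. f s * g s) has_derivative f') (at s within D) \<and>
        (\<forall>c h. f' (blinfun_mult_right c o\<^sub>L h) = c * f' h)"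
    by (rule exI, rule conjI, rule has_derivative_mult[OF f'(1) g'(1)])
       (simp add: f' g' algebra_simps)
qed

end

section \<open>Subgroups of the lattice and Gordan's alternative\<close>

lemma subgroup_coset_iff: "subgroup_of M N \<Longrightarrow> x +o M = M \<longleftrightarrow> x \<in> (M :: 'v::ab_group_add set)"
proof
  assume M: "subgroup_of M N"
  { assume "x +o M = M" moreover have "0 \<in> M" using M by (simp add: subgroup_of_def)
    ultimately show "x \<in> M" using set_plus_intro2[of 0 M x] by simp }
  { assume x: "x \<in> M"
    have neg: "- z \<in> M" if "z \<in> M" for z using M that unfolding subgroup_of_def by (metis diff_0)
    have "x + z \<in> M" "z - x \<in> M" if "z \<in> M" for z
    proof -
      have "x - (- z) \<in> M" "z - x \<in> M" using M x that neg[OF that] unfolding subgroup_of_def by blast+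
      then show "x + z \<in> M" "z - x \<in> M" by simp_all
    qed
    then show "x +o M = M"
      by (auto simp: elt_set_plus_def) (metis add.commute diff_add_cancel) }
qed

lemma subgroup_coset_eq_iff:
  assumes "subgroup_of M N" shows "x +o M = y +o M \<longleftrightarrow> x - y \<in> (M :: 'v::ab_group_add set)"
proof -
  have "x +o M = y +o M \<longleftrightarrow> (x - y) +o M = M"
  proof
    assume "x +o M = y +o M"
    then have "(- y) +o (x +o M) = (- y) +o (y +o M)" by simp
    then show "(x - y) +o M = M" by (simp add: set_plus_rearrange2)
  next
    assume "(x - y) +o M = M"
    then have "y +o ((x - y) +o M) = y +o M" by simp
    then show "x +o M = y +o M" by (simp add: set_plus_rearrange2)
  qed
  then show ?thesis using subgroup_coset_iff[OF assms] by simp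
qed

lemma subgroup_coset_add:
  assumes "subgroup_of M N" shows "(x +o M) + (y +o M) = (x + y) +o (M :: 'v::ab_group_add set)"
proof -
  have "M + M = M"
  proof
    have "u + v \<in> M" if "u \<in> M" "v \<in> M" for u v
      using subgroup_coset_iff[OF assms, of u] that set_plus_intro2[of v M u] by simp
    then show "M + M \<subseteq> M" by (auto elim!: set_plus_elim)
    have "0 \<in> M" using assms by (simp add: subgroup_of_def)
    then show "M \<subseteq> M + M" using set_zero_plus2 by blast
  qed
  then show ?thesis by (simp add: set_plus_rearrange)
qed

context cone_lattice
begin

lemma N_small_zero:
  assumes "x \<in> N" "\<And>i. i \<in> I \<Longrightarrow> \<bar>co i x\<bar> < 1" shows "x = 0"
proof (rule co_eqI)
  fix i assume i: "i \<in> I"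
  have "co i x \<in> \<int>" using assms(1) i by (simp add: N_iff)
  then obtain z where "co i x = of_int z" by (auto elim: Ints_cases)
  then show "co i x = co i 0" using assms(2)[OF i] by simp
qed

lemma subgroup_of_mult_int:
  assumes M: "subgroup_of M N" and "x \<in> M" shows "of_int k *\<^sub>R x \<in> M"
proof -
  have diff: "u - v \<in> M" if "u \<in> M" "v \<in> M" for u v using M that by (auto simp: subgroup_of_def)
  have z: "0 \<in> M" using M by (auto simp: subgroup_of_def)
  have neg: "- u \<in> M" if "u \<in> M" for u using diff[OF z that] by simp
  have add: "u + v \<in> M" if "u \<in> M" "v \<in> M" for u v using diff[OF that(1) neg[OF that(2)]] by simp
  have nat: "of_nat n *\<^sub>R x \<in> M" for n
    by (induction n) (use assms z in \<open>auto simp: scaleR_add_left intro: add\<close>)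
  show ?thesis
  proof (cases "k \<ge> 0")
    case True then show ?thesis using nat[of "nat k"] by simp
  next
    case False then show ?thesis using neg[OF nat[of "nat (- k)"]] by simp
  qed
qed

lemma subgroup_of_sum:
  assumes M: "subgroup_of M N" and "\<And>x. x \<in> A \<Longrightarrow> f x \<in> M" shows "(\<Sum>x\<in>A. f x) \<in> M"
proof -
  have diff: "u - v \<in> M" if "u \<in> M" "v \<in> M" for u v using M that by (auto simp: subgroup_of_def)
  have z: "0 \<in> M" using M by (auto simp: subgroup_of_def)
  have add: "u + v \<in> M" if "u \<in> M" "v \<in> M" for u v using diff[OF that(1) diff[OF z that(2)]] by simp
  show ?thesis using assms(2) by (induction A rule: infinite_finite_induct) (auto simp: z add)
qed

text \<open>
  A real combination of elements of \<open>M\<close> that is a lattice point has a multiple in \<open>M\<close>. By Dirichlet's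
  simultaneous approximation some multiple of the coefficients is so close to integers that the
  combination with these integers differs from the multiple of \<open>x\<close> by a lattice point with
  coordinates less than 1 in absolute value, which is 0.
\<close>

lemma saturated:
  assumes M: "subgroup_of M N" "torsion_free_quot N M"
    and x: "x \<in> N" "x \<in> span M"
  shows "x \<in> M"
proof -
  obtain t r where t: "finite t" "t \<subseteq> M" "x = (\<Sum>a\<in>t. r a *\<^sub>R a)"
    using x(2) unfolding span_explicit by blast
  obtain h where h: "bij_betw h {0..<card t} t" using ex_bij_betw_nat_finite[OF t(1)] by blast
  define D where "D = (\<Sum>i\<in>I. \<Sum>a\<in>t. \<bar>co i a\<bar>)"
  have D: "(\<Sum>a\<in>t. \<bar>co i a\<bar>) \<le> D" if "i \<in> I" for i
    unfolding D_def using that finI by (intro member_le_sum sum_nonneg) auto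
  have D0: "0 \<le> D" unfolding D_def by (intro sum_nonneg) auto
  \<comment> \<open>Larger than every coordinate sum, so that an error below \<open>1 / K\<close> per coefficient stays below 1.\<close>
  define K where "K = nat \<lceil>D\<rceil> + 1"
  have K: "K > 0" "D < real K" unfolding K_def by (simp, linarith)
  obtain k p where k: "0 < k" "\<And>j. j < card t \<Longrightarrow> \<bar>of_int k * r (h j) - of_int (p j)\<bar> < 1 / K"
    using Dirichlet_approx_simult[OF K(1), of "card t" "\<lambda>j. r (h j)"] by metis
  define g where "g = the_inv_into {0..<card t} h"
  have gp: "\<bar>of_int k * r a - of_int (p (g a))\<bar> \<le> 1 / K" if "a \<in> t" for a
  proof -
    have inj: "inj_on h {0..<card t}" and im: "h ` {0..<card t} = t" using h by (auto simp: bij_betw_def)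
    have "g a \<in> {0..<card t}" "h (g a) = a"
      using the_inv_into_into[OF inj, of a "{0..<card t}"] f_the_inv_into_f[OF inj, of a] that im
      by (auto simp: g_def)
    then show ?thesis using k(2)[of "g a"] by auto
  qed
  define y where "y = (\<Sum>a\<in>t. of_int (p (g a)) *\<^sub>R a)"
  have y: "y \<in> M" unfolding y_def using t(2) by (intro subgroup_of_sum[OF M(1)] subgroup_of_mult_int[OF M(1)]) auto
  have "of_int k *\<^sub>R x - y \<in> N"
    using y M(1) x(1) by (intro diff_N) (auto simp: N_iff subgroup_of_def intro!: Ints_mult)
  moreover have "\<bar>co i (of_int k *\<^sub>R x - y)\<bar> < 1" if i: "i \<in> I" for i
  proof -
    have "of_int k *\<^sub>R x - y = (\<Sum>a\<in>t. (of_int k * r a - of_int (p (g a))) *\<^sub>R a)"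
      by (simp add: t(3) y_def scaleR_sum_right sum_subtractf scaleR_left_diff_distrib)
    then have "\<bar>co i (of_int k *\<^sub>R x - y)\<bar> = \<bar>\<Sum>a\<in>t. (of_int k * r a - of_int (p (g a))) * co i a\<bar>"
      by (simp add: co_sum)
    also have "\<dots> \<le> (\<Sum>a\<in>t. \<bar>of_int k * r a - of_int (p (g a))\<bar> * \<bar>co i a\<bar>)"
      by (rule order_trans[OF sum_abs]) (simp add: abs_mult)
    also have "\<dots> \<le> (\<Sum>a\<in>t. 1 / K * \<bar>co i a\<bar>)"
      using gp by (intro sum_mono mult_right_mono) auto
    also have "\<dots> \<le> 1 / K * D"
      unfolding sum_distrib_left[symmetric] using D[OF i] by (intro mult_left_mono) auto
    also have "\<dots> < 1" using K by (simp add: field_simps)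
    finally show ?thesis .
  qed
  ultimately have "of_int k *\<^sub>R x - y = 0" by (rule N_small_zero)
  then have "of_nat (nat k) *\<^sub>R x \<in> M" using y k(1) by simp
  then have "(of_nat (nat k) *\<^sub>R x) +o M = M" using subgroup_coset_iff[OF M(1)] by blast
  then have "x +o M = M" using M(2) x(1) k(1) unfolding torsion_free_quot_def
    by (metis zero_less_nat_eq)
  then show ?thesis using subgroup_coset_iff[OF M(1)] by blast
qed

text \<open>
  Gordan's alternative over the integers, by induction on \<open>J\<close>. When \<open>J\<close> has a positive element \<open>w\<close> and the new
  coordinate \<open>i\<close> does not vanish on \<open>M\<close>, apply the induction hypothesis to the subgroup where it vanishes:
  either a positive element \<open>y\<close> is found there and a large multiple of \<open>y\<close> absorbs an element \<open>v\<close> with positive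
  \<open>i\<close>-th coordinate, or a nonnegative functional vanishes there and is thus, on \<open>M\<close>, proportional to the
  \<open>i\<close>-th coordinate. The sign of the factor tells whether \<open>w\<close> itself is positive at \<open>i\<close> or the difference
  of the two is a nonnegative functional vanishing on \<open>M\<close>.
\<close>

lemma gordan:
  assumes "finite J" "J \<subseteq> I" "subgroup_of M N"
  shows "(\<exists>m\<in>M. \<forall>j\<in>J. co j m > 0) \<or>
    (\<exists>u. (\<forall>j\<in>J. u j \<in> \<int> \<and> u j \<ge> 0) \<and> (\<exists>j\<in>J. u j > 0) \<and> (\<forall>m\<in>M. (\<Sum>j\<in>J. u j * co j m) = 0))"
  using assms
proof (induction J arbitrary: M rule: finite_induct)
  case empty
  then show ?case by (auto simp: subgroup_of_def)
next
  case (insert i J)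
  note M = insert.prems(2)
  have iI: "i \<in> I" "J \<subseteq> I" using insert.prems by auto
  \<comment> \<open>The subgroup to which the induction hypothesis is applied a second time.\<close>
  define M0 where "M0 = {m\<in>M. co i m = 0}"
  have M0: "subgroup_of M0 N" using M by (auto simp: subgroup_of_def M0_def)
  have int: "co j m \<in> \<int>" if "j \<in> insert i J" "m \<in> M" for j m
  proof -
    have "m \<in> N" "j \<in> I" using that M insert.prems(1) unfolding subgroup_of_def by blast+
    then show ?thesis by (simp add: N_iff)
  qed
  from insert.IH[OF iI(2) M] show ?case
  proof
    assume "\<exists>u. (\<forall>j\<in>J. u j \<in> \<int> \<and> u j \<ge> 0) \<and> (\<exists>j\<in>J. u j > 0) \<and> (\<forall>m\<in>M. (\<Sum>j\<in>J. u j * co j m) = 0)"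
    then obtain u where u: "\<forall>j\<in>J. u j \<in> \<int> \<and> u j \<ge> 0" "\<exists>j\<in>J. u j > 0" "\<forall>m\<in>M. (\<Sum>j\<in>J. u j * co j m) = 0"
      by blast
    have "(\<Sum>j\<in>J. (u(i := 0)) j * co j m) = (\<Sum>j\<in>J. u j * co j m)" for m
      using insert.hyps by (intro sum.cong) auto
    moreover have "\<exists>j\<in>insert i J. (u(i := 0)) j > 0"
      using u(2) insert.hyps(2) by (metis fun_upd_other insertCI)
    ultimately show ?thesis using u insert.hyps
      by (intro disjI2 exI[of _ "u(i := 0)"]) (simp del: fun_upd_apply; simp)
  next
    assume "\<exists>m\<in>M. \<forall>j\<in>J. co j m > 0"
    then obtain w where w: "w \<in> M" "\<And>j. j \<in> J \<Longrightarrow> co j w > 0" by blast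
    show ?thesis
    proof (cases "\<exists>m\<in>M. co i m \<noteq> 0")
      case False
      have "(\<Sum>j\<in>J. (if j = i then 1 else 0) * co j m) = 0" for m
        using insert.hyps by (intro sum.neutral) auto
      then show ?thesis using False insert.hyps
        by (intro disjI2 exI[of _ "\<lambda>j. if j = i then 1 else 0"]) auto
    next
      case True
      then obtain v' where v': "v' \<in> M" "co i v' \<noteq> 0" by blast
      have "- v' \<in> M" using subgroup_of_mult_int[OF M v'(1), of "-1"] by simp
      then obtain v where v: "v \<in> M" "co i v > 0"
        using v' by (cases "co i v' > 0") (auto intro: that[of "- v'"] that[of v'])
      from insert.IH[OF iI(2) M0] show ?thesis
      proof
        assume "\<exists>m\<in>M0. \<forall>j\<in>J. co j m > 0"
        then obtain y where y: "y \<in> M" "co i y = 0" "\<And>j. j \<in> J \<Longrightarrow> co j y > 0" by (auto simp: M0_def)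
        define K where "K = \<lceil>\<Sum>j\<in>J. \<bar>co j v\<bar>\<rceil> + 1"
        define z where "z = of_int K *\<^sub>R y - of_int (-1) *\<^sub>R v"
        have "z \<in> M" unfolding z_def
          using M subgroup_of_mult_int[OF M y(1), of K] subgroup_of_mult_int[OF M v(1), of "-1"]
          unfolding subgroup_of_def by blast
        moreover have "co i z > 0" using y(2) v(2) by (simp add: z_def)
        moreover have "co j z > 0" if j: "j \<in> J" for j
        proof -
          have "co j y \<in> \<int>" using int[of j y] j y(1) by blast
          then have "1 \<le> co j y" using y(3)[OF j] by (auto elim!: Ints_cases)
          have "\<bar>co j v\<bar> \<le> (\<Sum>j\<in>J. \<bar>co j v\<bar>)" using j insert.hyps(1) by (intro member_le_sum) auto
          also have "\<dots> < of_int K" unfolding K_def by linarith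
          finally have "\<bar>co j v\<bar> < of_int K" .
          moreover have "of_int K * 1 \<le> of_int K * co j y"
            using \<open>1 \<le> co j y\<close> calculation by (intro mult_left_mono) linarith+
          ultimately show ?thesis by (simp add: z_def)
        qed
        ultimately show ?thesis by blast
      next
        assume "\<exists>u. (\<forall>j\<in>J. u j \<in> \<int> \<and> u j \<ge> 0) \<and> (\<exists>j\<in>J. u j > 0) \<and> (\<forall>m\<in>M0. (\<Sum>j\<in>J. u j * co j m) = 0)"
        then obtain u where u: "\<forall>j\<in>J. u j \<in> \<int> \<and> u j \<ge> 0" "\<exists>j\<in>J. u j > 0" "\<And>m. m \<in> M0 \<Longrightarrow> (\<Sum>j\<in>J. u j * co j m) = 0"
          by blast
        define U where "U m = (\<Sum>j\<in>J. u j * co j m)" for m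
        have U: "co i v * U m = co i m * U v" if m: "m \<in> M" for m
        proof -
          obtain a b where ab: "co i v = of_int a" "co i m = of_int b"
            using int[of i v] int[of i m] v(1) m by (auto elim!: Ints_cases)
          have "of_int a *\<^sub>R m - of_int b *\<^sub>R v \<in> M0"
            using subgroup_of_mult_int[OF M m, of a] subgroup_of_mult_int[OF M v(1), of b] M
            by (auto simp: M0_def subgroup_of_def ab)
          then have "U (of_int a *\<^sub>R m - of_int b *\<^sub>R v) = 0" unfolding U_def by (rule u(3))
          then have "of_int a * U m - of_int b * U v = 0"
            by (simp add: U_def right_diff_distrib sum_subtractf sum_distrib_left mult_ac)
          then show ?thesis by (simp add: ab)
        qed
        show ?thesis
        proof (cases "U v > 0")
          case True
          have "U w > 0" unfolding U_def
          proof -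
            obtain j0 where j0: "j0 \<in> J" "u j0 > 0" using u(2) by blast
            have "0 \<le> u j * co j w" if "j \<in> J" for j using u(1) w(2) that by (simp add: less_imp_le)
            moreover have "0 < u j0 * co j0 w" using j0 w(2) by simp
            ultimately show "0 < (\<Sum>j\<in>J. u j * co j w)" using j0(1) insert.hyps(1) by (intro sum_pos2)
          qed
          then have "0 < co i w * U v" using U[OF w(1)] v(2) by (metis mult_pos_pos)
          then have "co i w > 0" using True by (simp add: zero_less_mult_iff)
          then show ?thesis using w by blast
        next
          case False
          define u' where "u' = (\<lambda>j. if j = i then - U v else co i v * u j)"
          have "U v \<in> \<int>" unfolding U_def using u(1) int v(1) by (auto intro!: Ints_sum Ints_mult)
          moreover have "co i v \<in> \<int>" using int v(1) by blast
          ultimately have "\<forall>j\<in>insert i J. u' j \<in> \<int> \<and> u' j \<ge> 0"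
            using u(1) v(2) False by (auto simp: u'_def)
          moreover have "\<exists>j\<in>insert i J. u' j > 0" using u(2) v(2) insert.hyps(2) by (force simp: u'_def)
          moreover have "(\<Sum>j\<in>insert i J. u' j * co j m) = 0" if m: "m \<in> M" for m
          proof -
            have "(\<Sum>j\<in>J. u' j * co j m) = (\<Sum>j\<in>J. co i v * (u j * co j m))"
              using insert.hyps(2) by (intro sum.cong) (auto simp: u'_def)
            also have "\<dots> = co i v * U m" by (simp add: U_def sum_distrib_left)
            finally show ?thesis using insert.hyps U[OF m] by (simp add: u'_def)
          qed
          ultimately show ?thesis by blast
        qed
      qed
    qed
  qed
qed

text \<open>
  A functional produced by Gordan's alternative would be a nonzero element of the intersection
  of the two dual cones.
\<close>

lemma interior_point:
  assumes M: "subgroup_of M N" and disj: "quot_dual_in_real_dual N M \<inter> dual_cone \<Lambda> = {0}"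
  obtains m where "m \<in> M" "\<And>i. i \<in> I \<Longrightarrow> co i m > 0"
proof -
  have "\<not> (\<exists>u. (\<forall>j\<in>I. u j \<in> \<int> \<and> u j \<ge> 0) \<and> (\<exists>j\<in>I. u j > 0) \<and> (\<forall>m\<in>M. (\<Sum>j\<in>I. u j * co j m) = 0))"
  proof
    assume "\<exists>u. (\<forall>j\<in>I. u j \<in> \<int> \<and> u j \<ge> 0) \<and> (\<exists>j\<in>I. u j > 0) \<and> (\<forall>m\<in>M. (\<Sum>j\<in>I. u j * co j m) = 0)"
    then obtain u where u: "\<And>j. j \<in> I \<Longrightarrow> u j \<in> \<int> \<and> u j \<ge> 0" "\<exists>j\<in>I. u j > 0"
      "\<And>m. m \<in> M \<Longrightarrow> (\<Sum>j\<in>I. u j * co j m) = 0" by blast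
    define U where "U = (\<Sum>i\<in>I. u i *\<^sub>R dual_vec I lam i)"
    have U: "blinfun_apply U y = (\<Sum>j\<in>I. u j * co j y)" for y
      by (simp add: U_def blinfun.sum_left blinfun.scaleR_left co_def)
    have "U \<in> dual_cone \<Lambda>" using u(1) by (auto simp: dual_cone_def U cone_iff intro!: sum_nonneg)
    moreover have "U \<in> quot_dual_in_real_dual N M"
    proof -
      define \<phi> where "\<phi> = restrict (\<lambda>A. \<lfloor>blinfun_apply U (SOME y. y \<in> A)\<rfloor>) (quot_group N M)"
      have \<phi>: "of_int (\<phi> (x +o M)) = blinfun_apply U x" if x: "x \<in> N" for x
      proof -
        have "x +o M \<in> quot_group N M" using x by (simp add: quot_group_def)
        have "0 \<in> M" using M by (simp add: subgroup_of_def)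
        then have "x + 0 \<in> x +o M" by (rule set_plus_intro2)
        then have "(SOME y. y \<in> x +o M) \<in> x +o M" by (rule someI)
        then obtain m where m: "m \<in> M" "(SOME y. y \<in> x +o M) = x + m" by (auto simp: elt_set_plus_def)
        have "blinfun_apply U (x + m) = blinfun_apply U x"
          using u(3)[OF m(1)] by (simp add: U distrib_left sum.distrib)
        moreover have "blinfun_apply U x \<in> \<int>" using u(1) x by (auto simp: U N_iff intro!: Ints_sum Ints_mult)
        ultimately show ?thesis using \<open>x +o M \<in> quot_group N M\<close> m(2)
          by (auto simp: \<phi>_def elim!: Ints_cases)
      qed
      have "\<phi> (A + B) = \<phi> A + \<phi> B" if AB: "A \<in> quot_group N M" "B \<in> quot_group N M" for A B
      proof -
        obtain x y where xy: "x \<in> N" "y \<in> N" "A = x +o M" "B = y +o M"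
          using AB by (auto simp: quot_group_def)
        have "real_of_int (\<phi> (A + B)) = of_int (\<phi> A) + of_int (\<phi> B)"
          using \<phi>[of x] \<phi>[of y] \<phi>[of "x + y"] xy add_N
          by (simp add: subgroup_coset_add[OF M] blinfun.add_right)
        then show ?thesis by linarith
      qed
      then have "\<phi> \<in> quot_dual_int N M" by (auto simp: quot_dual_int_def \<phi>_def)
      then show ?thesis using \<phi> unfolding quot_dual_in_real_dual_def by (intro CollectI bexI[of _ \<phi>]) auto
    qed
    ultimately have "U = 0" using disj by blast
    obtain j where j: "j \<in> I" "u j > 0" using u(2) by blast
    have "blinfun_apply U (lam j) = (\<Sum>k\<in>I. if k = j then u k else 0)"
      unfolding U using j(1) by (intro sum.cong) (auto simp: co_lam)
    also have "\<dots> = u j" using j(1) finI by simp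
    finally show False using \<open>U = 0\<close> j by simp
  qed
  then show ?thesis using gordan[OF finI order_refl M] that by blast
qed

lemma finite_independent: "independent B \<Longrightarrow> finite (B :: 'v set)"
  using independent_span_bound[of "lam ` I" B] finI span_lam by auto

lemma dim_less:
  assumes "B \<subseteq> M" "B \<subseteq> A" "A \<subseteq> span B" "m0 \<in> M" "m0 \<notin> span (B :: 'v set)"
  shows "dim A < dim M"
proof -
  obtain C where C: "C \<subseteq> B" "independent C" "B \<subseteq> span C"
    using maximal_independent_subset by blast
  have "span B \<subseteq> span C" using C(3) by (simp add: span_minimal)
  then have A: "A \<subseteq> span C" using assms(3) by blast
  have m0: "m0 \<notin> span C" using assms(5) C(1) span_mono by blast
  have "insert m0 C \<subseteq> M" using assms C(1) by blast
  moreover have "independent (insert m0 C)" using m0 C(2) by (rule independent_insertI)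
  ultimately obtain D where D: "insert m0 C \<subseteq> D" "D \<subseteq> M" "independent D" "M \<subseteq> span D"
    using maximal_independent_subset_extend by blast
  have "card C < card (insert m0 C)"
    using finite_independent[OF C(2)] m0 span_base by (subst card_insert_disjoint) auto
  also have "\<dots> \<le> card D" using D finite_independent by (intro card_mono) auto
  also have "card D = dim M" by (rule basis_card_eq_dim[OF D(2,4,3)])
  also have "card C = dim A" using C assms(2) A by (intro basis_card_eq_dim) auto
  finally show ?thesis .
qed

end

section \<open>Admissible functions attached to faces\<close>

context cone_lattice
begin

text \<open>
  Admissible functions are total functions while every identity is wanted on the tube only.
\<close>

definition admissible_tube :: "int \<Rightarrow> (('v \<Rightarrow>\<^sub>L complex) \<Rightarrow> complex) \<Rightarrow> bool" where
  "admissible_tube m f \<longleftrightarrow> (\<exists>h. admissible I lam q m h \<and> (\<forall>s\<in>tube0. h s = f s))"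

lemma admissible_tube_zero: "admissible_tube m (\<lambda>_. 0)"
  unfolding admissible_tube_def admissible_def by (intro exI[of _ "\<lambda>_. 0"]) (auto intro!: exI[of _ 0])

lemma admissible_tube_elementary: "elementary_admissible I lam q m f \<Longrightarrow> admissible_tube m f"
  unfolding admissible_tube_def admissible_def
  by (intro exI[of _ f] conjI exI[of _ "1::nat"] exI[of _ "\<lambda>_. f"]) auto

lemma admissible_tube_cong: "admissible_tube m f \<Longrightarrow> (\<And>s. s \<in> tube0 \<Longrightarrow> f s = g s) \<Longrightarrow> admissible_tube m g"
  unfolding admissible_tube_def by auto

lemma admissible_tube_add:
  assumes "admissible_tube m f" "admissible_tube m g" shows "admissible_tube m (\<lambda>s. f s + g s)"
proof -
  obtain f' where f': "admissible I lam q m f'" "\<forall>s\<in>tube0. f' s = f s" using assms by (auto simp: admissible_tube_def)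
  obtain g' where g': "admissible I lam q m g'" "\<forall>s\<in>tube0. g' s = g s" using assms by (auto simp: admissible_tube_def)
  obtain k :: nat and F where F: "\<forall>j<k. elementary_admissible I lam q m (F j)" "f' = (\<lambda>s. \<Sum>j<k. F j s)"
    using f'(1) unfolding admissible_def by blast
  obtain l :: nat and G where G: "\<forall>j<l. elementary_admissible I lam q m (G j)" "g' = (\<lambda>s. \<Sum>j<l. G j s)"
    using g'(1) unfolding admissible_def by blast
  define H where "H j = (if j < k then F j else G (j - k))" for j :: nat
  have "(\<Sum>j<k + l. H j s) = f' s + g' s" for s
  proof -
    have "(\<Sum>j<k + l. H j s) = (\<Sum>j<k. H j s) + (\<Sum>j<l. H (k + j) s)"
      by (induction l) (simp_all add: add.assoc)
    then show ?thesis by (simp add: H_def F(2) G(2))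
  qed
  moreover have "\<forall>j<k + l. elementary_admissible I lam q m (H j)" using F(1) G(1) by (auto simp: H_def)
  ultimately have "admissible I lam q m (\<lambda>s. f' s + g' s)"
    unfolding admissible_def by (intro exI[of _ "k + l"] exI[of _ H]) auto
  then show ?thesis unfolding admissible_tube_def using f'(2) g'(2) by (intro exI[of _ "\<lambda>s. f' s + g' s"]) auto
qed

lemma admissible_tube_sum: "finite A \<Longrightarrow> (\<And>k. k \<in> A \<Longrightarrow> admissible_tube m (f k)) \<Longrightarrow> admissible_tube m (\<lambda>s. \<Sum>k\<in>A. f k s)"
  by (induction A rule: finite_induct) (auto simp: admissible_tube_zero intro!: admissible_tube_add)

end

context coset_points
begin

definition face_interior :: "'i set \<Rightarrow> 'v set" where
  "face_interior G = {l\<in>face_monoid G. \<forall>k\<in>I - G. co k l > 0}"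

lemma face_monoid_P: "face_monoid F \<subseteq> P" by (auto simp: face_monoid_def)

lemma face_interior_zero_set:
  assumes "l \<in> face_interior G" "G \<subseteq> I" shows "G = {k\<in>I. co k l = 0}"
proof (intro equalityI subsetI)
  fix k assume "k \<in> G"
  then show "k \<in> {k\<in>I. co k l = 0}" using assms by (auto simp: face_interior_def face_monoid_def)
next
  fix k assume k: "k \<in> {k\<in>I. co k l = 0}"
  show "k \<in> G"
  proof (rule ccontr)
    assume "k \<notin> G"
    then have "k \<in> I - G" using k by simp
    then have "co k l > 0" using assms(1) unfolding face_interior_def by blast
    then show False using k by simp
  qed
qed

text \<open>
  Dickson's lemma gives the finite set; an element of the monoid is reached by subtracting members of the
  set one by one. So the cone is rational polyhedral.
\<close>

lemma hilbert_basis: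
  obtains H where "finite H" "H \<subseteq> face_monoid G" "face_monoid G \<subseteq> convex_cone hull H"
proof -
  obtain H where H: "H \<subseteq> face_monoid G - {0}" "finite H" "\<And>a. a \<in> face_monoid G - {0} \<Longrightarrow> \<exists>b\<in>H. b \<in> below a"
    using dickson_P[of "face_monoid G - {0}"] face_monoid_P[of G] by blast
  have "l \<in> convex_cone hull H" if "l \<in> face_monoid G" for l
    using that
  proof (induction "nat \<lfloor>deg l\<rfloor>" arbitrary: l rule: less_induct)
    case less
    show ?case
    proof (cases "l = 0")
      case True
      then show ?thesis by (simp add: convex_cone_hull_contains_0)
    next
      case False
      then obtain h where h: "h \<in> H" "h \<in> below l" using H(3) less.prems by blast
      have hL: "h \<in> face_monoid G" "h \<noteq> 0" using h(1) H(1) by auto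
      have P: "h \<in> P" "l \<in> P" using hL(1) less.prems by (auto simp: face_monoid_def)
      have "l - h \<in> face_monoid G" using less.prems hL belowD[OF h(2) P(2)] M'_diff by (auto simp: face_monoid_def)
      moreover have "1 \<le> deg h" using P hL(2) deg_eq_0[of h] deg_Nats[of h] by (intro nat_pos_ge_1) auto
      then have "nat \<lfloor>deg (l - h)\<rfloor> < nat \<lfloor>deg l\<rfloor>"
        using deg_below[OF h(2)] by (simp; linarith)
      ultimately have "l - h \<in> convex_cone hull H" using less.hyps by blast
      moreover have "h \<in> convex_cone hull H" using h(1) by (rule hull_inc)
      ultimately have "(l - h) + h \<in> convex_cone hull H" by (rule convex_cone_hull_add)
      then show ?thesis by simp
    qed
  qed
  then show ?thesis using that[of H] H by blast
qed

lemma cone_coords: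
  assumes "H \<subseteq> face_monoid G" "G \<subseteq> I" "y \<in> convex_cone hull H"
  shows "\<And>k. k \<in> G \<Longrightarrow> co k y = 0" "y \<in> \<Lambda>"
proof -
  let ?C = "{y. (\<forall>k\<in>G. co k y = 0) \<and> (\<forall>k\<in>I. 0 \<le> co k y)}"
  have "convex_cone ?C" unfolding convex_cone_def convex_def conic_def
    by (auto intro!: exI[of _ 0])
  moreover have "H \<subseteq> ?C" using assms(1) P_nonneg by (auto simp: face_monoid_def)
  ultimately have "convex_cone hull H \<subseteq> ?C" by (intro hull_minimal)
  then show "\<And>k. k \<in> G \<Longrightarrow> co k y = 0" "y \<in> \<Lambda>" using assms(3) by (auto simp: cone_iff)
qed

lemma cone_hull_sum: "(\<And>b. b \<in> B \<Longrightarrow> 0 \<le> c b) \<Longrightarrow> B \<subseteq> convex_cone hull H \<Longrightarrow>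
    (\<Sum>b\<in>B. c b *\<^sub>R b) \<in> convex_cone hull H" for H :: "'v set"
  by (induction B rule: infinite_finite_induct)
     (auto simp: convex_cone_hull_contains_0 intro!: convex_cone_hull_add convex_cone_hull_mul)

text \<open>
  An interior point stays in the cone when a small multiple of a point \<open>n\<close> with positive coordinates is
  subtracted, so its own are positive. Conversely let \<open>m\<close> have positive coordinates
  off \<open>G\<close>, and let \<open>B\<close> be a basis of the span taken from the generators. Then \<open>K m - \<Sum>B\<close> is in the monoid for large
  \<open>K\<close>; hence \<open>m\<close> is a member of the cone plus \<open>\<Sum>B / K\<close>, and small changes of the coefficients of \<open>B\<close> are harmless.
\<close>

lemma rel_interior_face:
  assumes G: "G \<subseteq> I" and H: "finite H" "H \<subseteq> face_monoid G" "face_monoid G \<subseteq> convex_cone hull H" and ne: "face_interior G \<noteq> {}"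
  shows "rel_interior (convex_cone hull H) \<inter> M' = face_interior G"
proof (intro equalityI subsetI)
  let ?Y = "convex_cone hull H"
  have "0 \<in> affine hull ?Y" by (intro hull_inc convex_cone_hull_contains_0)
  then have aff: "affine hull ?Y = span ?Y" by (rule affine_hull_span_0)
  {
    fix m assume m: "m \<in> rel_interior ?Y \<inter> M'"
    then have "m \<in> rel_interior ?Y" by blast
    then obtain e where e: "m \<in> ?Y" "e > 0" "ball m e \<inter> span ?Y \<subseteq> ?Y"
      unfolding mem_rel_interior_ball aff by blast
    have mP: "m \<in> P" using cone_coords[OF H(2) G e(1)] m M'_N by (auto simp: P_def)
    then have mL: "m \<in> face_monoid G" using cone_coords[OF H(2) G e(1)] m by (auto simp: face_monoid_def)
    obtain n where n: "n \<in> face_interior G" using ne by blast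
    then have nY: "n \<in> ?Y" using H(3) by (auto simp: face_interior_def)
    define t where "t = e / (2 * (norm n + 1))"
    have t: "t > 0" using e(2) by (simp add: t_def add_nonneg_pos)
    have "t * norm n < e"
    proof -
      have frac: "x / (2 * (x + 1)) < 1" if "0 \<le> x" for x :: real using that by (simp add: divide_less_eq)
      have lt1: "norm n / (2 * (norm n + 1)) < 1" by (intro frac norm_ge_zero)
      have "t * norm n = e * (norm n / (2 * (norm n + 1)))" by (simp add: t_def)
      also have "\<dots> < e * 1" using lt1 e(2) by (rule mult_strict_left_mono)
      finally show ?thesis by simp
    qed
    then have "m - t *\<^sub>R n \<in> ball m e" using t by (simp add: dist_norm)
    moreover have "m - t *\<^sub>R n \<in> span ?Y" using e(1) nY by (intro span_diff span_scale span_base)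
    ultimately have "m - t *\<^sub>R n \<in> ?Y" using e(3) by blast
    then have "m - t *\<^sub>R n \<in> \<Lambda>" using cone_coords[OF H(2) G] by blast
    then have ge: "t * co k n \<le> co k m" if "k \<in> I" for k using that by (auto simp: cone_iff)
    have "co k m > 0" if k: "k \<in> I - G" for k
    proof -
      have "0 < t * co k n" using n k t by (auto simp: face_interior_def)
      then show ?thesis using ge[of k] k by auto
    qed
    then show "m \<in> face_interior G" using mL by (auto simp: face_interior_def)
  next
    fix m assume m: "m \<in> face_interior G"
    then have mL: "m \<in> face_monoid G" and mpos: "\<And>k. k \<in> I - G \<Longrightarrow> co k m > 0" by (auto simp: face_interior_def)
    obtain B where B: "B \<subseteq> H" "independent B" "H \<subseteq> span B" using maximal_independent_subset by blast
    have finB: "finite B" using B(1) H(1) finite_subset by blast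
    have BL: "B \<subseteq> face_monoid G" using B(1) H(2) by blast
    have BY: "B \<subseteq> ?Y" using BL H(3) by blast
    have "H \<subseteq> span B" by (rule B(3))
    moreover have "convex_cone (span B)" unfolding convex_cone_def
      using span_zero[of B] by (auto simp: convex_def conic_def intro!: span_add span_scale)
    ultimately have "?Y \<subseteq> span B" by (rule hull_minimal)
    then have spY: "span ?Y \<subseteq> span B" by (simp add: span_minimal)
    obtain C where C: "C \<ge> 0" "\<And>c b. b \<in> B \<Longrightarrow> \<bar>c b\<bar> \<le> C * norm (\<Sum>b\<in>B. c b *\<^sub>R b)"
      using coefficients_bounded[OF finB B(2)] by blast
    define K where "K = nat \<lceil>\<Sum>b\<in>B. deg b\<rceil> + 1"
    have K: "0 < real K" "(\<Sum>b\<in>B. deg b) \<le> real K" unfolding K_def by (simp, linarith)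
    define l where "l = real K *\<^sub>R m - (\<Sum>b\<in>B. b)"
    have BM: "(\<Sum>b\<in>B. b) \<in> face_monoid G" using finB BL
      by (induction B rule: finite_induct) (auto simp: face_monoid_0 intro!: face_monoid_add)
    have KL: "real K *\<^sub>R m \<in> face_monoid G" by (rule face_monoid_mult[OF mL])
    have lM: "l \<in> M'" unfolding l_def using KL BM M'_diff by (auto simp: face_monoid_def)
    have l0: "co k l = 0" if "k \<in> G" for k
      unfolding l_def using KL BM that by (auto simp: face_monoid_def)
    have l1: "co k l \<ge> 0" if k: "k \<in> I - G" for k
    proof -
      have "1 \<le> co k m" using mL mpos[OF k] k by (intro nat_pos_ge_1) (auto simp: face_monoid_def P_iff)
      then have "real K * 1 \<le> real K * co k m" by (intro mult_left_mono) auto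
      moreover have "(\<Sum>b\<in>B. co k b) \<le> (\<Sum>b\<in>B. deg b)"
        using BL k co_le_deg by (intro sum_mono) (auto simp: face_monoid_def)
      ultimately show ?thesis using K(2) by (simp add: l_def co_sum)
    qed
    have "0 \<le> co k l" if "k \<in> I" for k using l0[of k] l1[of k] that by (cases "k \<in> G") auto
    then have "l \<in> P" using M'_N lM by (auto simp: P_def cone_iff)
    then have "l \<in> face_monoid G" using lM l0 by (auto simp: face_monoid_def)
    then have lY: "l \<in> ?Y" using H(3) by blast
    \<comment> \<open>Within distance \<open>e\<close> of \<open>m\<close> the coefficients on \<open>B\<close> change by at most \<open>1 / K\<close>.\<close>
    define e where "e = 1 / (K * (C + 1))"
    have e: "e > 0" using K(1) C(1) by (simp add: e_def)
    have "y \<in> ?Y" if y: "y \<in> ball m e" "y \<in> span ?Y" for y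
    proof -
      have "m \<in> ?Y" using mL H(3) by blast
      then have "y - m \<in> span B" using y(2) spY by (intro span_diff) (auto simp: span_base)
      then obtain c where c: "y - m = (\<Sum>b\<in>B. c b *\<^sub>R b)" unfolding span_finite[OF finB] by auto
      have cb: "0 \<le> 1 / K + c b" if "b \<in> B" for b
      proof -
        have "\<bar>c b\<bar> \<le> C * norm (y - m)" unfolding c by (rule C(2)[OF that])
        also have "\<dots> \<le> C * e" using y(1) C(1) by (intro mult_left_mono) (auto simp: dist_norm norm_minus_commute)
        also have "\<dots> = 1 / K * (C / (C + 1))" by (simp add: e_def)
        also have "\<dots> \<le> 1 / K" using K(1) C(1) by (intro mult_left_le) auto
        finally show ?thesis by linarith
      qed
      have "y = (1 / K) *\<^sub>R l + (\<Sum>b\<in>B. (1 / K + c b) *\<^sub>R b)"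
      proof -
        have "(\<Sum>b\<in>B. (1 / K + c b) *\<^sub>R b) = (1 / K) *\<^sub>R (\<Sum>b\<in>B. b) + (y - m)"
          by (simp add: c scaleR_add_left sum.distrib scaleR_sum_right)
        moreover have "(1 / K) *\<^sub>R l = m - (1 / K) *\<^sub>R (\<Sum>b\<in>B. b)"
          using K(1) by (simp add: l_def scaleR_diff_right)
        ultimately show ?thesis by simp
      qed
      also have "\<dots> \<in> ?Y" using lY cb BY K(1)
        by (intro convex_cone_hull_add convex_cone_hull_mul cone_hull_sum) auto
      finally show ?thesis .
    qed
    then have "m \<in> rel_interior ?Y" unfolding mem_rel_interior_ball aff
      using e mL H(3) by blast
    then show "m \<in> rel_interior ?Y \<inter> M'" using mL by (auto simp: face_monoid_def)
  }
qed

text \<open>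
  The element \<open>m0\<close> is not in the span of the face, because \<open>G\<close> is nonempty: this is where the multiplicity improves
  by one. When \<open>M\<close> has rank 1 the only face left is the origin, and multiplicity 0 asks for a plain series.
\<close>

lemma face_interior_admissible:
  assumes g: "exp_summable g" and G: "G \<subseteq> I" "G \<noteq> {}"
    and M: "M' \<subseteq> M" "m0 \<in> M" "\<And>k. k \<in> I \<Longrightarrow> co k m0 > 0"
  shows "admissible_tube (1 - int (dim M)) (\<lambda>s. ser g s * (\<Sum>\<^sub>\<infinity>l\<in>face_interior G. q_neg q s l))"
proof (cases "face_interior G = {}")
  case True
  then show ?thesis by (simp add: admissible_tube_zero)
next
  case False
  obtain H where H: "finite H" "H \<subseteq> face_monoid G" "face_monoid G \<subseteq> convex_cone hull H" using hilbert_basis by blast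
  let ?Y = "convex_cone hull H"
  have Lser: "Lser M' (rel_interior ?Y) (\<lambda>_. 1) z = (\<Sum>\<^sub>\<infinity>l\<in>face_interior G. z l)" for z
    unfolding Lser_def rel_interior_face[OF G(1) H False] by simp
  have "dim ?Y < dim M"
  proof (rule dim_less)
    show "H \<subseteq> M" using H(2) M(1) by (auto simp: face_monoid_def)
    show "H \<subseteq> ?Y" by (rule hull_subset)
    have "convex_cone (span H)" unfolding convex_cone_def
      using span_zero[of H] by (auto simp: convex_def conic_def intro!: span_add span_scale)
    with span_superset show "?Y \<subseteq> span H" by (rule hull_minimal)
    obtain i where i: "i \<in> G" using G by blast
    have "subspace {y. co i y = 0}" by (auto simp: subspace_def)
    moreover have "H \<subseteq> {y. co i y = 0}" using H(2) i by (auto simp: face_monoid_def)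
    ultimately have "span H \<subseteq> {y. co i y = 0}" by (intro span_minimal)
    moreover have "co i m0 > 0" using M(3) i G by auto
    ultimately show "m0 \<notin> span H" by auto
  qed (rule M(2))
  show ?thesis
  proof (cases "dim M = 1")
    case True
    then have d0: "dim ?Y = 0" using \<open>dim ?Y < dim M\<close> by simp
    obtain B where B: "B \<subseteq> ?Y" "independent B" "?Y \<subseteq> span B" "card B = dim ?Y"
      using basis_exists by blast
    then have "B = {}" using d0 finite_independent[OF B(2)] by simp
    then have "face_monoid G \<subseteq> {0}" using B(3) H(3) by auto
    then have "face_interior G = {0}" using False by (auto simp: face_interior_def)
    then have "ser g s * (\<Sum>\<^sub>\<infinity>l\<in>face_interior G. q_neg q s l) = Lser N \<Lambda> g (q_neg q s)" for s
      by (simp add: ser_Lser E_exp)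
    then have "elementary_admissible I lam q 0 (\<lambda>s. ser g s * (\<Sum>\<^sub>\<infinity>l\<in>face_interior G. q_neg q s l))"
      using exp_summable_admissible[OF g] by (simp add: elementary_admissible_def)
    then show ?thesis using True admissible_tube_elementary by simp
  next
    case False': False
    let ?f = "\<lambda>s. ser g s * (\<Sum>\<^sub>\<infinity>l\<in>face_interior G. q_neg q s l)"
    have neg: "1 - int (dim M) < 0" using False' \<open>dim ?Y < dim M\<close> by linarith
    obtain B where B: "\<And>w. w \<in> P \<Longrightarrow> norm (g w) \<le> B"
      using finite_sum_le_infsum[OF exp_summable_norm[OF g], of "{w}" for w] by force
    have "dual_holomorphic_on (\<lambda>s. ser g s) tube0"
      unfolding ser_def by (rule holomorphic_series[OF order_refl B])
    moreover have "dual_holomorphic_on (\<lambda>s. \<Sum>\<^sub>\<infinity>l\<in>face_interior G. q_neg q s l) tube0"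
      using holomorphic_series[of "face_interior G" "\<lambda>_. 1" 1] face_monoid_P by (force simp: face_interior_def)
    ultimately have hol: "dual_holomorphic_on ?f tube0" by (rule dual_holomorphic_mult)
    have "H \<subseteq> N" using H(2) face_monoid_P[of G] P_subset_N by (meson order_trans)
    then have "rational_polyhedral_cone N ?Y" unfolding rational_polyhedral_cone_def
      using H(1) by (intro exI[of _ H] conjI refl)
    moreover have "?Y \<subseteq> \<Lambda>" using cone_coords[OF H(2) G(1)] by blast
    moreover have "int (dim ?Y) \<le> - (1 - int (dim M))" using \<open>dim ?Y < dim M\<close> by linarith
    moreover have "\<forall>s\<in>tube0. ?f s = Lser N \<Lambda> g (q_neg q s) * Lser M' (rel_interior ?Y) (\<lambda>_. 1) (q_neg q s)"
      by (simp add: Lser ser_Lser)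
    ultimately have "elementary_admissible I lam q (1 - int (dim M)) ?f"
      unfolding elementary_admissible_def using hol neg M' exp_summable_admissible[OF g] by blast
    then show ?thesis by (rule admissible_tube_elementary)
  qed
qed

text \<open>
  Partition of a monoid according to which coordinates vanish.
\<close>

lemma face_monoid_admissible:
  assumes g: "exp_summable g" and F: "F \<subseteq> I" "F \<noteq> {}"
    and M: "M' \<subseteq> M" "m0 \<in> M" "\<And>k. k \<in> I \<Longrightarrow> co k m0 > 0"
  shows "admissible_tube (1 - int (dim M)) (ser (conv g (face_monoid F)))"
proof -
  let ?K = "{G. F \<subseteq> G \<and> G \<subseteq> I}"
  have fin: "finite ?K" using finI by (intro finite_subset[of ?K "Pow I"]) auto
  have Un: "(\<Union>G\<in>?K. face_interior G) = face_monoid F"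
  proof (intro equalityI subsetI)
    fix l assume l: "l \<in> face_monoid F"
    let ?G = "{k\<in>I. co k l = 0}"
    have "0 \<le> co k l" if "k \<in> I" for k using l P_nonneg that by (auto simp: face_monoid_def)
    then have "l \<in> face_interior ?G" using l 
      by (simp add: face_interior_def face_monoid_def less_le)
    moreover have "?G \<in> ?K" using l F(1) by (auto simp: face_monoid_def)
    ultimately show "l \<in> (\<Union>G\<in>?K. face_interior G)" by blast
  qed (auto simp: face_interior_def face_monoid_def)
  have disj: "face_interior G \<inter> face_interior G' = {}" if "G \<in> ?K" "G' \<in> ?K" "G \<noteq> G'" for G G'
  proof (rule ccontr)
    assume "face_interior G \<inter> face_interior G' \<noteq> {}"
    then obtain l where l: "l \<in> face_interior G" "l \<in> face_interior G'" by blast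
    then show False using that face_interior_zero_set[OF l(1)] face_interior_zero_set[OF l(2)] by blast
  qed
  have "admissible_tube (1 - int (dim M)) (\<lambda>s. \<Sum>G\<in>?K. ser g s * (\<Sum>\<^sub>\<infinity>l\<in>face_interior G. q_neg q s l))"
    using F by (intro admissible_tube_sum[OF fin] face_interior_admissible[OF g _ _ M]) auto
  moreover have "(\<Sum>G\<in>?K. ser g s * (\<Sum>\<^sub>\<infinity>l\<in>face_interior G. q_neg q s l)) = ser (conv g (face_monoid F)) s"
    if s: "s \<in> tube0" for s
  proof -
    have "q_neg q s summable_on face_interior G" for G
      by (rule summable_on_subset[OF abs_summable_summable[OF summable_E[OF s]]]) (use face_monoid_P in \<open>auto simp: face_interior_def\<close>)
    then have "(\<Sum>G\<in>?K. \<Sum>\<^sub>\<infinity>l\<in>face_interior G. q_neg q s l) = (\<Sum>\<^sub>\<infinity>l\<in>face_monoid F. q_neg q s l)"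
      unfolding Un[symmetric] using disj by (intro sum_infsum[OF fin]) auto
    then show ?thesis using ser_conv(1)[OF g s face_monoid_P] by (simp add: sum_distrib_left[symmetric])
  qed
  ultimately show ?thesis by (rule admissible_tube_cong)
qed

end

section \<open>Characters of the quotient and the torus integral\<close>

text \<open>
  Over a countable index set an enumeration reduces this to the theorem on series of functions.
\<close>

lemma integral_infsum:
  fixes f :: "'b \<Rightarrow> 'a \<Rightarrow> complex"
  assumes fin: "emeasure M (space M) = 1" and A: "countable A"
    and meas: "\<And>k. k \<in> A \<Longrightarrow> f k \<in> borel_measurable M"
    and bound: "\<And>k z. k \<in> A \<Longrightarrow> z \<in> space M \<Longrightarrow> norm (f k z) \<le> u k"
    and u: "u summable_on A"
  shows "(\<integral>z. (\<Sum>\<^sub>\<infinity>k\<in>A. f k z) \<partial>M) = (\<Sum>\<^sub>\<infinity>k\<in>A. \<integral>z. f k z \<partial>M)"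
proof -
  interpret finite_measure M by standard (simp add: fin)
  have int: "integrable M (f k)" if "k \<in> A" for k
    by (rule integrable_const_bound[of _ "u k"]) (use bound[OF that] meas[OF that] in auto)
  show ?thesis
  proof (cases "finite A")
    case True
    then show ?thesis using int by (simp add: Bochner_Integration.integral_sum)
  next
    case False
    define e where "e = from_nat_into A"
    have e: "bij_betw e UNIV A" unfolding e_def by (rule bij_betw_from_nat_into[OF A False])
    have eA: "e n \<in> A" for n using e by (auto simp: bij_betw_def)
    have ue: "(\<lambda>n. u (e n)) summable_on UNIV"
      using summable_on_reindex_bij_betw[OF e, of u] u by blast
    have un: "0 \<le> u (e n)" if "z \<in> space M" for n z
      using bound[OF eA that, of n] norm_ge_zero order_trans by blast
    have us: "summable (\<lambda>n. u (e n))" by (rule summable_on_imp_summable[OF ue])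
    have sm: "summable (\<lambda>n. norm (f (e n) z))" if "z \<in> space M" for z
      using bound[OF eA that] by (intro summable_comparison_test'[OF us, of 0]) auto
    have inner: "(\<Sum>\<^sub>\<infinity>k\<in>A. f k z) = (\<Sum>n. f (e n) z)" if z: "z \<in> space M" for z
    proof -
      have "(\<lambda>n. f (e n) z) summable_on UNIV"
        by (rule norm_summable_imp_summable_on[OF sm[OF z]])
      then have "(\<lambda>n. f (e n) z) sums (\<Sum>\<^sub>\<infinity>n. f (e n) z)"
        using has_sum_infsum has_sum_imp_sums by blast
      then show ?thesis
        using infsum_reindex_bij_betw[OF e, of "\<lambda>k. f k z"] by (simp add: sums_iff)
    qed
    have nb: "norm (\<integral>z. f (e n) z \<partial>M) \<le> (\<integral>z. norm (f (e n) z) \<partial>M)" for n by (rule integral_norm_bound)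
    have ib: "(\<integral>z. norm (f (e n) z) \<partial>M) \<le> u (e n)" for n
    proof -
      have "(\<integral>z. norm (f (e n) z) \<partial>M) \<le> (\<integral>z. u (e n) \<partial>M)"
        using bound[OF eA] int[OF eA] by (intro integral_mono) auto
      also have "\<dots> = u (e n)" using fin by (simp add: measure_def)
      finally show ?thesis .
    qed
    have si: "summable (\<lambda>n. \<integral>z. norm (f (e n) z) \<partial>M)"
      by (rule summable_comparison_test'[OF us, of 0]) (use ib in auto)
    have "(\<integral>z. (\<Sum>\<^sub>\<infinity>k\<in>A. f k z) \<partial>M) = (\<integral>z. (\<Sum>n. f (e n) z) \<partial>M)"
      by (rule Bochner_Integration.integral_cong[OF refl inner])
    also have "\<dots> = (\<Sum>n. \<integral>z. f (e n) z \<partial>M)"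
      by (rule integral_suminf) (use int[OF eA] sm si in auto)
    also have "\<dots> = (\<Sum>\<^sub>\<infinity>n. \<integral>z. f (e n) z \<partial>M)"
    proof -
      have "summable (\<lambda>n. norm (\<integral>z. f (e n) z \<partial>M))"
        by (rule summable_comparison_test'[OF si, of 0]) (use nb in auto)
      then have "(\<lambda>n. \<integral>z. f (e n) z \<partial>M) summable_on UNIV" by (rule norm_summable_imp_summable_on)
      then have "(\<lambda>n. \<integral>z. f (e n) z \<partial>M) sums (\<Sum>\<^sub>\<infinity>n. \<integral>z. f (e n) z \<partial>M)"
        using has_sum_infsum has_sum_imp_sums by blast
      then show ?thesis by (simp add: sums_iff)
    qed
    also have "\<dots> = (\<Sum>\<^sub>\<infinity>k\<in>A. \<integral>z. f k z \<partial>M)"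
      by (rule infsum_reindex_bij_betw[OF e, of "\<lambda>k. \<integral>z. f k z \<partial>M"])
    finally show ?thesis .
  qed
qed

context cone_lattice
begin

lemma countable_P: "countable P"
proof -
  have "P \<subseteq> (\<Union>n. {w\<in>P. \<forall>i\<in>I. co i w \<le> real n})"
  proof
    fix w assume w: "w \<in> P"
    obtain n where "deg w \<le> real n" using real_arch_simple by blast
    then have "\<forall>i\<in>I. co i w \<le> real n" using co_le_deg[OF w] order_trans by blast
    then show "w \<in> (\<Union>n. {w\<in>P. \<forall>i\<in>I. co i w \<le> real n})" using w by blast
  qed
  moreover have "countable (\<Union>n. {w\<in>P. \<forall>i\<in>I. co i w \<le> real n})"
    by (rule countable_UN) (auto intro: countable_finite finite_box)
  ultimately show ?thesis by (rule countable_subset)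
qed

end

locale dual_haar = cone_lattice I lam q
  for I :: "'i set" and lam :: "'i \<Rightarrow> 'v::real_normed_vector" and q :: nat +
  fixes M :: "'v set" and dz :: "('v set \<Rightarrow> complex) measure"
  assumes M: "subgroup_of M N" "torsion_free_quot N M" and dz: "haar_prob N M dz"
begin

lemma sp: "space dz = quot_dual_U N M" and mass: "emeasure dz (space dz) = 1"
  using dz by (auto simp: haar_prob_def)

lemma coset_in: "x \<in> N \<Longrightarrow> x +o M \<in> quot_group N M" by (simp add: quot_group_def)

lemma char_add: "z \<in> quot_dual_U N M \<Longrightarrow> x \<in> N \<Longrightarrow> y \<in> N \<Longrightarrow> z ((x + y) +o M) = z (x +o M) * z (y +o M)"
proof -
  assume z: "z \<in> quot_dual_U N M" and xy: "x \<in> N" "y \<in> N"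
  have "z ((x +o M) + (y +o M)) = z (x +o M) * z (y +o M)"
    using z coset_in[OF xy(1)] coset_in[OF xy(2)] unfolding quot_dual_U_def by blast
  then show ?thesis by (simp only: subgroup_coset_add[OF M(1)])
qed

lemma char_norm: "z \<in> quot_dual_U N M \<Longrightarrow> x \<in> N \<Longrightarrow> norm (z (x +o M)) = 1"
  using coset_in by (auto simp: quot_dual_U_def)

lemma char_M: "z \<in> quot_dual_U N M \<Longrightarrow> x \<in> M \<Longrightarrow> z (x +o M) = 1"
proof -
  assume z: "z \<in> quot_dual_U N M" and x: "x \<in> M"
  have xN: "x \<in> N" "0 \<in> N" using x M(1) by (auto simp: subgroup_of_def)
  have eq: "x +o M = M" using subgroup_coset_iff[OF M(1)] x by blast
  have eq0: "0 +o M = M" using subgroup_coset_iff[OF M(1), of 0] M(1) by (simp add: subgroup_of_def)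
  have "z M = z M * z M" using char_add[OF z xN(2) xN(2)] by (simp add: eq0)
  moreover have "z M \<noteq> 0" using char_norm[OF z xN(1)] by (auto simp: eq)
  ultimately show ?thesis by (simp add: eq)
qed

lemma eval_measurable:
  assumes x: "x \<in> N" shows "(\<lambda>z. z (x +o M)) \<in> borel_measurable dz"
proof (rule borel_measurableI)
  fix S :: "complex set" assume S: "open S"
  let ?Q = "quot_group N M" and ?U = "quot_dual_U N M"
  let ?X = "product_topology (\<lambda>_. euclidean :: complex topology) ?Q"
  let ?T = "{z \<in> topspace ?X. z (x +o M) \<in> S}"
  have "continuous_map ?X euclidean (\<lambda>z. z (x +o M))"
    by (rule continuous_map_product_projection[OF coset_in[OF x]])
  then have "openin ?X ?T" by (rule openin_continuous_map_preimage) (use S in \<open>simp add: open_openin[symmetric]\<close>)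
  moreover have "?U \<subseteq> topspace ?X" by (auto simp: quot_dual_U_def PiE_def)
  then have "(\<lambda>z. z (x +o M)) -` S \<inter> space dz = ?T \<inter> ?U" unfolding sp by auto
  ultimately have "openin (subtopology ?X ?U) ((\<lambda>z. z (x +o M)) -` S \<inter> space dz)"
    unfolding openin_subtopology by blast
  then show "(\<lambda>z. z (x +o M)) -` S \<inter> space dz \<in> sets dz"
    using dz unfolding haar_prob_def by (auto intro!: sigma_sets.Basic)
qed

text \<open>
  As \<open>x\<close> is not in \<open>span M\<close>, some real functional vanishes on \<open>M\<close> and has the value \<open>pi\<close> at \<open>x\<close>.
\<close>

lemma separating_char:
  assumes x: "x \<in> N" "x \<notin> M"
  obtains w where "w \<in> quot_dual_U N M" "w (x +o M) = -1"
proof -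
  have xs: "x \<notin> span M" using saturated[OF M x(1)] x(2) by blast
  obtain B where B: "B \<subseteq> M" "independent B" "M \<subseteq> span B" using maximal_independent_subset by blast
  have "x \<notin> span B" using xs span_mono[OF B(1)] by blast
  then have "independent (insert x B)" using B(2) by (rule independent_insertI)
  then obtain f :: "'v \<Rightarrow> real" where f: "linear f" "\<forall>b\<in>insert x B. f b = (if b = x then pi else 0)"
    using linear_independent_extend[of "insert x B" "\<lambda>b. if b = x then pi else 0"] by blast
  have fB: "f b = 0" if "b \<in> B" for b using f(2) that \<open>x \<notin> span B\<close> span_base by auto
  have fM: "f m = 0" if "m \<in> M" for m
    using linear_eq_0_on_span[OF f(1), of B] fB that B(3) by blast
  define w where "w = restrict (\<lambda>A. cis (f (SOME y. y \<in> A))) (quot_group N M)"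
  have w: "w (y +o M) = cis (f y)" if "y \<in> N" for y
  proof -
    have "0 \<in> M" using M by (simp add: subgroup_of_def)
    then have "y + 0 \<in> y +o M" by (rule set_plus_intro2)
    then have "(SOME z. z \<in> y +o M) \<in> y +o M" by (rule someI)
    then obtain m where m: "m \<in> M" "(SOME z. z \<in> y +o M) = y + m" by (auto simp: elt_set_plus_def)
    then show ?thesis using coset_in[OF that] fM[OF m(1)] linear_add[OF f(1)] by (simp add: w_def)
  qed
  have "w (A + B) = w A * w B" if AB: "A \<in> quot_group N M" "B \<in> quot_group N M" for A B
  proof -
    obtain a b where ab: "a \<in> N" "b \<in> N" "A = a +o M" "B = b +o M"
      using AB unfolding quot_group_def by blast
    then show ?thesis using w add_N by (simp add: subgroup_coset_add[OF M(1)] linear_add[OF f(1)] cis_mult)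
  qed
  moreover have "norm (w A) = 1" if "A \<in> quot_group N M" for A using that by (simp add: w_def)
  ultimately have "w \<in> quot_dual_U N M" by (auto simp: quot_dual_U_def w_def)
  moreover have "w (x +o M) = -1" using w[OF x(1)] f(2) by simp
  ultimately show ?thesis by (rule that)
qed

lemma char_mult:
  assumes "w \<in> quot_dual_U N M" "z \<in> quot_dual_U N M"
  shows "restrict (\<lambda>\<gamma>. w \<gamma> * z \<gamma>) (quot_group N M) \<in> quot_dual_U N M"
proof -
  have "A + B \<in> quot_group N M" if "A \<in> quot_group N M" "B \<in> quot_group N M" for A B
    using that add_N by (auto simp: quot_group_def subgroup_coset_add[OF M(1)])
  then show ?thesis using assms by (auto simp: quot_dual_U_def norm_mult)
qed

lemma char_cnj:
  assumes "w \<in> quot_dual_U N M"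
  shows "restrict (\<lambda>\<gamma>. cnj (w \<gamma>)) (quot_group N M) \<in> quot_dual_U N M"
proof -
  have "A + B \<in> quot_group N M" if "A \<in> quot_group N M" "B \<in> quot_group N M" for A B
    using that add_N by (auto simp: quot_group_def subgroup_coset_add[OF M(1)])
  then show ?thesis using assms by (auto simp: quot_dual_U_def)
qed

text \<open>
  Orthogonality of characters. Multiplication by a character \<open>w\<close> with value \<open>-1\<close> at \<open>x\<close> preserves the measure and
  changes the sign of the evaluation at \<open>x\<close>, so this evaluation and its negative have the same
  distribution. The invariance of the measure is applied to preimages under the evaluation, whose
  translates are again such preimages and hence measurable.
\<close>

lemma integral_char:
  assumes x: "x \<in> N"
  shows "(\<integral>z. z (x +o M) \<partial>dz) = (if x \<in> M then 1 else 0)"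
proof (cases "x \<in> M")
  case True
  have "(\<integral>z. z (x +o M) \<partial>dz) = (\<integral>z. 1 \<partial>dz)"
    using char_M[OF _ True] by (intro Bochner_Integration.integral_cong) (auto simp: sp)
  then show ?thesis using True mass by (simp add: measure_def)
next
  case False
  let ?Q = "quot_group N M" and ?U = "quot_dual_U N M"
  obtain w where w: "w \<in> ?U" "w (x +o M) = -1" using separating_char[OF x False] by blast
  define w' where "w' = restrict (\<lambda>\<gamma>. cnj (w \<gamma>)) ?Q"
  have w': "w' \<in> ?U" unfolding w'_def by (rule char_cnj[OF w(1)])
  note xQ = coset_in[OF x]
  let ?ev = "\<lambda>z. z (x +o M)"
  have ev: "?ev \<in> borel_measurable dz" by (rule eval_measurable[OF x])
  have "distr dz borel ?ev = distr dz borel (\<lambda>z. - ?ev z)"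
  proof (rule measure_eqI)
    fix S assume "S \<in> sets (distr dz borel ?ev)"
    then have S: "S \<in> sets borel" by simp
    let ?E = "?ev -` S \<inter> space dz"
    have E: "?E \<in> sets dz" using ev S by (rule measurable_sets)
    have "(\<lambda>z. restrict (\<lambda>\<gamma>. w \<gamma> * z \<gamma>) ?Q) ` ?E = (\<lambda>z. - ?ev z) -` S \<inter> space dz"
    proof (intro equalityI subsetI)
      fix z assume "z \<in> (\<lambda>z. restrict (\<lambda>\<gamma>. w \<gamma> * z \<gamma>) ?Q) ` ?E"
      then show "z \<in> (\<lambda>z. - ?ev z) -` S \<inter> space dz"
        using char_mult[OF w(1)] w(2) xQ by (auto simp: sp)
    next
      fix z assume z: "z \<in> (\<lambda>z. - ?ev z) -` S \<inter> space dz"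
      then have zU: "z \<in> ?U" by (simp add: sp)
      let ?z = "restrict (\<lambda>\<gamma>. w' \<gamma> * z \<gamma>) ?Q"
      have zE: "?z \<in> ?E" using z char_mult[OF w' zU] xQ w(2) by (simp add: sp w'_def)
      have eq: "restrict (\<lambda>\<gamma>. w \<gamma> * ?z \<gamma>) ?Q = z"
      proof
        fix \<gamma>
        show "restrict (\<lambda>\<gamma>. w \<gamma> * ?z \<gamma>) ?Q \<gamma> = z \<gamma>"
        proof (cases "\<gamma> \<in> ?Q")
          case True
          then have "norm (w \<gamma>) = 1" using w(1) by (simp add: quot_dual_U_def)
          then have "w \<gamma> * cnj (w \<gamma>) = 1" by (simp add: complex_norm_square[symmetric])
          then show ?thesis using True by (simp add: w'_def mult.assoc[symmetric])
        next
          case False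
          then show ?thesis using zU by (simp add: quot_dual_U_def extensional_def)
        qed
      qed
      show "z \<in> (\<lambda>z. restrict (\<lambda>\<gamma>. w \<gamma> * z \<gamma>) ?Q) ` ?E"
        using imageI[OF zE, of "\<lambda>z. restrict (\<lambda>\<gamma>. w \<gamma> * z \<gamma>) ?Q"] unfolding eq .
    qed
    moreover have "emeasure dz ((\<lambda>z. restrict (\<lambda>\<gamma>. w \<gamma> * z \<gamma>) ?Q) ` ?E) = emeasure dz ?E"
      using dz w(1) E unfolding haar_prob_def by blast
    ultimately show "emeasure (distr dz borel ?ev) S = emeasure (distr dz borel (\<lambda>z. - ?ev z)) S"
      using ev S by (simp add: emeasure_distr)
  qed simp
  then have "(\<integral>v. v \<partial>distr dz borel ?ev) = (\<integral>v. v \<partial>distr dz borel (\<lambda>z. - ?ev z))" by simp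
  then have "(\<integral>z. ?ev z \<partial>dz) = (\<integral>z. - ?ev z \<partial>dz)"
    using ev by (simp add: integral_distr)
  then show ?thesis using False by simp
qed

text \<open>
  The product of the two series is a double series that converges uniformly on the torus. Integration
  keeps the pairs \<open>(x, y)\<close> with \<open>x + y \<in> M\<close>.
\<close>

lemma torus_integral:
  assumes a: "exp_summable a" and N': "N' \<subseteq> N" and s: "s \<in> tube0"
  shows "(\<integral>z. Lser N \<Lambda> a (\<lambda>y. z (y +o M) * q_neg q s y) *
               Lser N' \<Lambda> (\<lambda>_. 1) (\<lambda>y. z (y +o M) * q_neg q s y) \<partial>dz)
    = ser (\<lambda>m. if m \<in> M then conv a (P \<inter> N') m else 0) s" (is "?lhs = _")
proof -
  let ?E = "q_neg q s"
  let ?A = "P \<inter> N'"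
  define t where "t = (\<lambda>(x, y). a x * ?E x * ?E y)"
  have sE: "(\<lambda>y. norm (?E y)) summable_on ?A" by (rule summable_on_subset[OF summable_E[OF s]]) auto
  note T = abs_summable_times[OF exp_summable_times_E[OF a s] sE]
  have tn: "(\<lambda>p. norm (t p)) summable_on P \<times> ?A" using T(1) by (simp add: t_def case_prod_unfold)
  have prod: "Lser N \<Lambda> a (\<lambda>y. z (y +o M) * ?E y) * Lser N' \<Lambda> (\<lambda>_. 1) (\<lambda>y. z (y +o M) * ?E y)
    = (\<Sum>\<^sub>\<infinity>p\<in>P \<times> ?A. t p * z ((fst p + snd p) +o M))" if z: "z \<in> quot_dual_U N M" for z
  proof -
    have nz: "norm (z (y +o M)) = 1" if "y \<in> P" for y using char_norm[OF z] that P_subset_N by blast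
    have 1: "(\<lambda>x. norm (a x * (z (x +o M) * ?E x))) summable_on P"
      using exp_summable_times_E[OF a s] by (rule summable_on_cong[THEN iffD1, rotated]) (simp add: norm_mult nz)
    have 2: "(\<lambda>y. norm (z (y +o M) * ?E y)) summable_on ?A"
      using sE by (rule summable_on_cong[THEN iffD1, rotated]) (simp add: norm_mult nz)
    have "Lser N \<Lambda> a (\<lambda>y. z (y +o M) * ?E y) * Lser N' \<Lambda> (\<lambda>_. 1) (\<lambda>y. z (y +o M) * ?E y)
      = (\<Sum>\<^sub>\<infinity>x\<in>P. a x * (z (x +o M) * ?E x)) * (\<Sum>\<^sub>\<infinity>y\<in>?A. z (y +o M) * ?E y)"
      unfolding Lser_points[OF N'] by (simp add: Lser_def P_def)
    also have "\<dots> = (\<Sum>\<^sub>\<infinity>(x, y)\<in>P \<times> ?A. a x * (z (x +o M) * ?E x) * (z (y +o M) * ?E y))"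
      by (rule abs_summable_times(2)[OF 1 2])
    also have "\<dots> = (\<Sum>\<^sub>\<infinity>p\<in>P \<times> ?A. t p * z ((fst p + snd p) +o M))"
    proof (rule infsum_cong)
      fix p assume "p \<in> P \<times> ?A"
      then have "fst p \<in> N" "snd p \<in> N" using P_subset_N by auto
      then show "(case p of (x, y) \<Rightarrow> a x * (z (x +o M) * ?E x) * (z (y +o M) * ?E y))
          = t p * z ((fst p + snd p) +o M)"
        by (simp add: t_def case_prod_unfold char_add[OF z])
    qed
    finally show ?thesis .
  qed
  have PN: "fst p + snd p \<in> N" if "p \<in> P \<times> ?A" for p using that P_subset_N by (auto intro!: add_N)
  let ?\<chi> = "\<lambda>m. if m \<in> M then 1 else 0 :: complex"
  have "?lhs
    = (\<integral>z. (\<Sum>\<^sub>\<infinity>p\<in>P \<times> ?A. t p * z ((fst p + snd p) +o M)) \<partial>dz)"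
    by (rule Bochner_Integration.integral_cong[OF refl]) (simp add: prod sp)
  also have "\<dots> = (\<Sum>\<^sub>\<infinity>p\<in>P \<times> ?A. \<integral>z. t p * z ((fst p + snd p) +o M) \<partial>dz)"
  proof (rule integral_infsum[OF mass _ _ _ tn])
    have "countable ?A" by (rule countable_subset[OF _ countable_P]) auto
    then show "countable (P \<times> ?A)" by (intro countable_SIGMA countable_P)
    show "(\<lambda>z. t p * z ((fst p + snd p) +o M)) \<in> borel_measurable dz" if "p \<in> P \<times> ?A" for p
      using eval_measurable[OF PN[OF that]] by measurable
    show "norm (t p * z ((fst p + snd p) +o M)) \<le> norm (t p)" if "p \<in> P \<times> ?A" "z \<in> space dz" for p z
      using char_norm[of z, OF _ PN[OF that(1)]] that(2) by (simp add: norm_mult sp)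
  qed
  also have "\<dots> = (\<Sum>\<^sub>\<infinity>p\<in>P \<times> ?A. t p * ?\<chi> (fst p + snd p))"
    by (rule infsum_cong) (simp add: integral_char[OF PN])
  also have "\<dots> = (\<Sum>\<^sub>\<infinity>(w, l)\<in>P \<times> ?A. (\<lambda>m w. ?\<chi> m * (a w * ?E m)) (w + l) w)"
    by (rule infsum_cong) (auto simp: t_def E_add)
  finally have I: "?lhs
    = (\<Sum>\<^sub>\<infinity>(w, l)\<in>P \<times> ?A. (\<lambda>m w. ?\<chi> m * (a w * ?E m)) (w + l) w)" .
  have "(\<lambda>p. norm ((\<lambda>(w, l). (\<lambda>m w. ?\<chi> m * (a w * ?E m)) (w + l) w) p)) summable_on P \<times> ?A"
    by (rule summable_on_comparison_test[OF tn]) (auto simp: t_def E_add norm_mult)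
  then have S: "(\<lambda>(w, l). (\<lambda>m w. ?\<chi> m * (a w * ?E m)) (w + l) w) summable_on P \<times> ?A"
    by (rule abs_summable_summable)
  have c: "(\<Sum>w\<in>{w\<in>below m. m - w \<in> ?A}. ?\<chi> m * (a w * ?E m))
      = (if m \<in> M then conv a ?A m else 0) * ?E m" for m
    by (simp add: conv_def sum_distrib_right)
  show ?thesis
    unfolding I ser_def infsum_pairs(1)[OF Int_lower1 S] c by (rule refl)
qed

end

section \<open>The leading term\<close>

context coset_points
begin

text \<open>
  The term with \<open>F = {}\<close> is split off by hand, because its coefficient function is needed explicitly for the
  value at 0. All other terms have smaller dimension.
\<close>

lemma coset_leading_term:
  assumes b: "exp_summable b" and l0: "l0 \<in> face_monoid {}" "\<And>k. k \<in> I \<Longrightarrow> 1 \<le> co k l0" and M: "M' \<subseteq> M"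
  obtains g where "exp_summable g"
    "admissible_tube (1 - int (dim M)) (\<lambda>s. ser (slice_coeff {} b) s - ser g s * (\<Sum>\<^sub>\<infinity>l\<in>face_monoid {}. q_neg q s l))"
    "ser g 0 = (\<Sum>\<^sub>\<infinity>w\<in>{w\<in>P. slice {} w \<noteq> {}}. b w)"
    "\<And>s. s \<in> tube0 \<Longrightarrow> (\<lambda>m. slice_coeff {} b m * q_neg q s m) summable_on P"
proof -
  have l0': "1 \<le> co k l0" if "k \<in> I - {}" for k using l0(2) that by simp
  obtain p B where pB: "exp_summable (push (\<lambda>w w'. slice {} w \<noteq> {} \<and> w' = p w) b)"
    "\<And>i. i \<in> I - {} \<Longrightarrow> exp_summable (B i)"
    "\<And>w. w \<in> P \<Longrightarrow> slice {} w \<noteq> {} \<Longrightarrow> p w \<in> P \<and> w \<in> below (p w)"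
    "\<And>m. slice_coeff {} b m = conv (push (\<lambda>w w'. slice {} w \<noteq> {} \<and> w' = p w) b) (face_monoid {}) m
        + (\<Sum>i\<in>I - {}. slice_coeff (insert i {}) (B i) m)"
    by (rule slice_off_base_points[OF empty_subsetI b l0(1) l0'], assumption) (rule that)
  define g where "g = push (\<lambda>w w'. slice {} w \<noteq> {} \<and> w' = p w) b"
  have g: "exp_summable g" using pB(1) by (simp add: g_def)
  have "\<forall>i. \<exists>G. i \<in> I \<longrightarrow> (\<forall>F'. exp_summable (G F')) \<and> (\<forall>F'. \<not> {i} \<subseteq> F' \<longrightarrow> G F' = (\<lambda>_. 0)) \<and>
    (\<forall>m. slice_coeff {i} (B i) m = (\<Sum>F'\<in>Pow I. conv (G F') (face_monoid F') m))"
  proof (intro allI)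
    fix i
    show "\<exists>G. i \<in> I \<longrightarrow> (\<forall>F'. exp_summable (G F')) \<and> (\<forall>F'. \<not> {i} \<subseteq> F' \<longrightarrow> G F' = (\<lambda>_. 0)) \<and>
      (\<forall>m. slice_coeff {i} (B i) m = (\<Sum>F'\<in>Pow I. conv (G F') (face_monoid F') m))"
    proof (cases "i \<in> I")
      case True
      then show ?thesis using slice_coeff_decomposition[of "{i}" "B i"] pB(2)[of i] by simp
    qed simp
  qed
  from choice[OF this] obtain G where G: "\<And>i F'. i \<in> I \<Longrightarrow> exp_summable (G i F')"
    "\<And>i F'. i \<in> I \<Longrightarrow> \<not> {i} \<subseteq> F' \<Longrightarrow> G i F' = (\<lambda>_. 0)"
    "\<And>i m. i \<in> I \<Longrightarrow> slice_coeff {i} (B i) m = (\<Sum>F'\<in>Pow I. conv (G i F') (face_monoid F') m)"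
    by blast
  have slice_coeff: "slice_coeff {} b m = conv g (face_monoid {}) m + (\<Sum>i\<in>I. \<Sum>F'\<in>Pow I. conv (G i F') (face_monoid F') m)" for m
    using pB(4)[of m] by (simp add: g_def G(3))
  have S: "(\<lambda>m. \<Sum>i\<in>I. \<Sum>F'\<in>Pow I. conv (G i F') (face_monoid F') m * q_neg q s m) summable_on P"
    "(\<Sum>\<^sub>\<infinity>m\<in>P. \<Sum>i\<in>I. \<Sum>F'\<in>Pow I. conv (G i F') (face_monoid F') m * q_neg q s m)
      = (\<Sum>i\<in>I. \<Sum>F'\<in>Pow I. ser (conv (G i F') (face_monoid F')) s)" if s: "s \<in> tube0" for s
  proof -
    note sc = ser_conv(2)[OF G(1) s face_monoid_P]
    have hs: "((\<lambda>m. \<Sum>i\<in>I. \<Sum>F'\<in>Pow I. conv (G i F') (face_monoid F') m * q_neg q s m) has_sum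
        (\<Sum>i\<in>I. \<Sum>F'\<in>Pow I. ser (conv (G i F') (face_monoid F')) s)) P"
      unfolding ser_def by (intro has_sum_sum has_sum_infsum sc)
    show "(\<lambda>m. \<Sum>i\<in>I. \<Sum>F'\<in>Pow I. conv (G i F') (face_monoid F') m * q_neg q s m) summable_on P"
      by (rule has_sum_imp_summable[OF hs])
    show "(\<Sum>\<^sub>\<infinity>m\<in>P. \<Sum>i\<in>I. \<Sum>F'\<in>Pow I. conv (G i F') (face_monoid F') m * q_neg q s m)
      = (\<Sum>i\<in>I. \<Sum>F'\<in>Pow I. ser (conv (G i F') (face_monoid F')) s)"
      by (rule infsumI[OF hs])
  qed
  have cfE: "slice_coeff {} b m * q_neg q s m = conv g (face_monoid {}) m * q_neg q s m
      + (\<Sum>i\<in>I. \<Sum>F'\<in>Pow I. conv (G i F') (face_monoid F') m * q_neg q s m)" for m s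
    by (simp add: slice_coeff distrib_right sum_distrib_right)
  have sumcf: "(\<lambda>m. slice_coeff {} b m * q_neg q s m) summable_on P" if s: "s \<in> tube0" for s
    unfolding cfE by (intro summable_on_add ser_conv(2)[OF g s face_monoid_P] S(1)[OF s])
  have tails: "ser (slice_coeff {} b) s - ser g s * (\<Sum>\<^sub>\<infinity>l\<in>face_monoid {}. q_neg q s l)
      = (\<Sum>i\<in>I. \<Sum>F'\<in>Pow I. ser (conv (G i F') (face_monoid F')) s)" if s: "s \<in> tube0" for s
  proof -
    have "ser (slice_coeff {} b) s = ser (conv g (face_monoid {})) s
        + (\<Sum>\<^sub>\<infinity>m\<in>P. \<Sum>i\<in>I. \<Sum>F'\<in>Pow I. conv (G i F') (face_monoid F') m * q_neg q s m)"
      unfolding ser_def cfE by (rule infsum_add[OF ser_conv(2)[OF g s face_monoid_P] S(1)[OF s]])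
    then show ?thesis using S(2)[OF s] ser_conv(1)[OF g s face_monoid_P] by simp
  qed
  have "admissible_tube (1 - int (dim M)) (\<lambda>s. \<Sum>i\<in>I. \<Sum>F'\<in>Pow I. ser (conv (G i F') (face_monoid F')) s)"
  proof (intro admissible_tube_sum finI finite_Pow_iff[THEN iffD2])
    fix i F' assume i: "i \<in> I" and F': "F' \<in> Pow I"
    show "admissible_tube (1 - int (dim M)) (ser (conv (G i F') (face_monoid F')))"
    proof (cases "F' = {}")
      case True
      then have "G i F' = (\<lambda>_. 0)" using G(2)[OF i, of F'] by simp
      moreover have "ser (conv (\<lambda>_. 0) (face_monoid F')) = (\<lambda>_. 0)" by (simp add: ser_def conv_zero fun_eq_iff)
      ultimately show ?thesis by (simp add: admissible_tube_zero)
    next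
      case False
      have "l0 \<in> M" using l0(1) M by (auto simp: face_monoid_def)
      moreover have "0 < co k l0" if "k \<in> I" for k using l0(2)[OF that] by simp
      ultimately show ?thesis using False F' by (intro face_monoid_admissible[OF G(1)[OF i] _ _ M]) auto
    qed
  qed
  then have "admissible_tube (1 - int (dim M)) (\<lambda>s. ser (slice_coeff {} b) s - ser g s * (\<Sum>\<^sub>\<infinity>l\<in>face_monoid {}. q_neg q s l))"
    by (rule admissible_tube_cong) (rule tails[symmetric])
  moreover have "ser g 0 = (\<Sum>\<^sub>\<infinity>w\<in>{w\<in>P. slice {} w \<noteq> {}}. b w)"
    unfolding g_def by (rule ser_push_zero[OF b pB(3)])
  ultimately show ?thesis using that[of g] g sumcf by blast
qed

end

context dual_haar
begin

text \<open>
  The cosets \<open>\<kappa>\<close> of \<open>N'\<close> are treated one at a time: if \<open>x \<in> \<kappa>\<close>, then \<open>m - x \<in> N'\<close> says \<open>m \<in> \<kappa>\<close>. Positivity of \<open>l0\<close>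
  is used twice, for the splitting and, under the second hypothesis, to place a point of \<open>M \<inter> \<kappa>\<close> above every \<open>w \<in> \<kappa>\<close>
  with \<open>a w \<noteq> 0\<close>.
\<close>

lemma torus_integral_decomposition:
  assumes a: "exp_summable a" and N': "subgroup_of N' N" "finite_index N' N"
    and disj: "quot_dual_in_real_dual N M \<inter> dual_cone \<Lambda> = {0}"
  obtains g where "exp_summable g"
    "admissible_tube (1 - int (dim M)) (\<lambda>s. (\<integral>z. Lser N \<Lambda> a (\<lambda>y. z (y +o M) * q_neg q s y) *
          Lser N' \<Lambda> (\<lambda>_. 1) (\<lambda>y. z (y +o M) * q_neg q s y) \<partial>dz)
       - ser g s * Lser N' (\<Lambda> \<inter> span M) (\<lambda>_. 1) (q_neg q s))"
    "(\<forall>y\<in>\<Lambda> \<inter> N. a y \<noteq> 0 \<longrightarrow> y +o M \<in> (\<lambda>x. x +o M) ` N') \<longrightarrow> ser g 0 = Lser N \<Lambda> a (\<lambda>_. 1)"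
proof -
  let ?E = "q_neg q"
  let ?f = "\<lambda>s. \<integral>z. Lser N \<Lambda> a (\<lambda>y. z (y +o M) * ?E s y) *
    Lser N' \<Lambda> (\<lambda>_. 1) (\<lambda>y. z (y +o M) * ?E s y) \<partial>dz"
  define Q where "Q = quot_group N N'"
  define M' where "M' = M \<inter> N'"
  define T where "T \<kappa> = {m\<in>P. m \<in> M \<and> m +o N' = \<kappa>}" for \<kappa>
  have finQ: "finite Q" using N'(2) by (simp add: Q_def finite_index_def)
  have N'N: "N' \<subseteq> N" and MN: "M \<subseteq> N" using N'(1) M(1) by (auto simp: subgroup_of_def)
  have sub: "subgroup_of M' N" using M(1) N'(1) by (auto simp: M'_def subgroup_of_def)
  have cp: "coset_points I lam q M' (T \<kappa>)" for \<kappa>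
  proof unfold_locales
    show "subgroup_of M' N" by (rule sub)
    show "T \<kappa> \<subseteq> P" by (auto simp: T_def)
    show "m - m' \<in> M'" if "m \<in> T \<kappa>" "m' \<in> T \<kappa>" for m m'
    proof -
      have "m +o N' = m' +o N'" using that by (simp add: T_def)
      then have "m - m' \<in> N'" using subgroup_coset_eq_iff[OF N'(1)] by blast
      moreover have "m - m' \<in> M" using that M(1) by (auto simp: T_def subgroup_of_def)
      ultimately show ?thesis by (simp add: M'_def)
    qed
    show "m + l \<in> T \<kappa>" if "m \<in> T \<kappa>" "l \<in> M'" "m + l \<in> P" for m l
    proof -
      have "(m + l) - m \<in> N'" using that(2) by (simp add: M'_def)
      then have "(m + l) +o N' = m +o N'" using subgroup_coset_eq_iff[OF N'(1)] by blast
      moreover have "m + l \<in> M"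
        using subgroup_of_sum[OF M(1), of "{0, 1 :: nat}" "\<lambda>i. if i = 0 then m else l"] that
        by (simp add: T_def M'_def)
      ultimately show ?thesis using that by (simp add: T_def)
    qed
  qed
  obtain m0 where m0: "m0 \<in> M" "\<And>i. i \<in> I \<Longrightarrow> co i m0 > 0"
    using interior_point[OF M(1) disj] by blast
  have m0N: "m0 \<in> N" using m0(1) MN by blast
  have "\<exists>k>0. real k *\<^sub>R m0 \<in> N'"
  proof -
    have "(\<lambda>n. (real n *\<^sub>R m0) +o N') ` UNIV \<subseteq> Q"
      using subgroup_of_mult_int[OF M(1) m0(1), of "int n" for n] MN by (auto simp: Q_def quot_group_def)
    then have "finite ((\<lambda>n. (real n *\<^sub>R m0) +o N') ` UNIV)" using finQ finite_subset by blast
    then have "\<not> inj (\<lambda>n. (real n *\<^sub>R m0) +o N')"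
      using finite_imageD infinite_UNIV_nat by blast
    then obtain n n' :: nat where "n \<noteq> n'" "(real n *\<^sub>R m0) +o N' = (real n' *\<^sub>R m0) +o N'"
      by (auto simp: inj_on_def)
    then obtain n n' :: nat where n: "n < n'" "(real n' *\<^sub>R m0) +o N' = (real n *\<^sub>R m0) +o N'"
      by (metis linorder_neqE_nat)
    then have "real n' *\<^sub>R m0 - real n *\<^sub>R m0 \<in> N'" using subgroup_coset_eq_iff[OF N'(1)] by blast
    then have "real (n' - n) *\<^sub>R m0 \<in> N'" using n(1) by (simp add: of_nat_diff scaleR_left_diff_distrib)
    then show ?thesis using n(1) by (intro exI[of _ "n' - n"]) auto
  qed
  then obtain d :: nat where d: "d > 0" "real d *\<^sub>R m0 \<in> N'" by blast
  \<comment> \<open>As \<open>N'\<close> has finite index, two multiples of \<open>m0\<close> agree modulo \<open>N'\<close>.\<close>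
  define l0 where "l0 = real d *\<^sub>R m0"
  have l0M: "l0 \<in> M'" using d(2) subgroup_of_mult_int[OF M(1) m0(1), of "int d"] by (simp add: M'_def l0_def)
  have l0N: "l0 \<in> N" using l0M sub by (auto simp: subgroup_of_def)
  have l0pos: "co k l0 > 0" if "k \<in> I" for k using d(1) m0(2)[OF that] by (simp add: l0_def)
  have l0P: "l0 \<in> P" using l0N l0pos by (auto simp: P_def cone_iff less_imp_le)
  have l0ge: "1 \<le> co k l0" if "k \<in> I" for k
    using l0P l0pos[OF that] that by (auto simp: P_iff elim!: Nats_cases dest!: bspec)
  define L where "L = P \<inter> M'"
  have face_monoid: "coset_points.face_monoid I lam M' {} = L"
    using coset_points.face_monoid_def[OF cp] by (auto simp: L_def)
  define b where "b \<kappa> w = (if w \<in> {w. w +o N' = \<kappa>} then a w else 0)" for \<kappa> w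
  have b: "exp_summable (b \<kappa>)" for \<kappa> unfolding b_def by (rule exp_summable_restrict[OF a])
  let ?slice_coeff = "\<lambda>\<kappa>. coset_points.slice_coeff I lam (T \<kappa>) {} (b \<kappa>)"
  let ?slice = "\<lambda>\<kappa>. coset_points.slice I lam (T \<kappa>) {}"
  have slice: "?slice \<kappa> w = {m\<in>T \<kappa>. \<forall>k\<in>I. co k w \<le> co k m}" for \<kappa> w
    using coset_points.slice_def[OF cp] by simp
  have "\<forall>\<kappa>. \<exists>g. exp_summable g
    \<and> admissible_tube (1 - int (dim M)) (\<lambda>s. ser (?slice_coeff \<kappa>) s - ser g s * (\<Sum>\<^sub>\<infinity>l\<in>L. ?E s l))
    \<and> ser g 0 = (\<Sum>\<^sub>\<infinity>w\<in>{w\<in>P. ?slice \<kappa> w \<noteq> {}}. b \<kappa> w)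
    \<and> (\<forall>s\<in>tube0. (\<lambda>m. ?slice_coeff \<kappa> m * ?E s m) summable_on P)"
  proof
    fix \<kappa>
    interpret coset_points I lam q M' "T \<kappa>" by (rule cp)
    have l0L: "l0 \<in> face_monoid {}" using l0M l0P by (simp add: face_monoid_def)
    have sM: "M' \<subseteq> M" by (simp add: M'_def)
    obtain g where "exp_summable g"
      "admissible_tube (1 - int (dim M)) (\<lambda>s. ser (?slice_coeff \<kappa>) s - ser g s * (\<Sum>\<^sub>\<infinity>l\<in>face_monoid {}. ?E s l))"
      "ser g 0 = (\<Sum>\<^sub>\<infinity>w\<in>{w\<in>P. ?slice \<kappa> w \<noteq> {}}. b \<kappa> w)"
      "\<And>s. s \<in> tube0 \<Longrightarrow> (\<lambda>m. ?slice_coeff \<kappa> m * ?E s m) summable_on P"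
      by (rule coset_leading_term[OF b l0L l0ge sM], assumption) (rule that)
    then show "\<exists>g. exp_summable g
      \<and> admissible_tube (1 - int (dim M)) (\<lambda>s. ser (?slice_coeff \<kappa>) s - ser g s * (\<Sum>\<^sub>\<infinity>l\<in>L. ?E s l))
      \<and> ser g 0 = (\<Sum>\<^sub>\<infinity>w\<in>{w\<in>P. ?slice \<kappa> w \<noteq> {}}. b \<kappa> w)
      \<and> (\<forall>s\<in>tube0. (\<lambda>m. ?slice_coeff \<kappa> m * ?E s m) summable_on P)"
      unfolding face_monoid by (intro exI[of _ g]) simp
  qed
  from choice[OF this] obtain g where gs: "\<forall>\<kappa>. exp_summable (g \<kappa>)
    \<and> admissible_tube (1 - int (dim M)) (\<lambda>s. ser (?slice_coeff \<kappa>) s - ser (g \<kappa>) s * (\<Sum>\<^sub>\<infinity>l\<in>L. ?E s l))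
    \<and> ser (g \<kappa>) 0 = (\<Sum>\<^sub>\<infinity>w\<in>{w\<in>P. ?slice \<kappa> w \<noteq> {}}. b \<kappa> w)
    \<and> (\<forall>s\<in>tube0. (\<lambda>m. ?slice_coeff \<kappa> m * ?E s m) summable_on P)" by (rule exE)
  have g: "exp_summable (g \<kappa>)"
    "admissible_tube (1 - int (dim M)) (\<lambda>s. ser (?slice_coeff \<kappa>) s - ser (g \<kappa>) s * (\<Sum>\<^sub>\<infinity>l\<in>L. ?E s l))"
    "ser (g \<kappa>) 0 = (\<Sum>\<^sub>\<infinity>w\<in>{w\<in>P. ?slice \<kappa> w \<noteq> {}}. b \<kappa> w)"
    "s \<in> tube0 \<Longrightarrow> (\<lambda>m. ?slice_coeff \<kappa> m * ?E s m) summable_on P" for \<kappa> s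
    using spec[OF gs, of \<kappa>] by blast+
  define G where "G w = (\<Sum>\<kappa>\<in>Q. g \<kappa> w)" for w
  have G: "exp_summable G" unfolding G_def by (rule exp_summable_sum[OF finQ g(1)])
  have serG: "ser G s = (\<Sum>\<kappa>\<in>Q. ser (g \<kappa>) s)" if "\<And>\<kappa>. (\<lambda>w. g \<kappa> w * ?E s w) summable_on P" for s
  proof -
    have "((\<lambda>w. \<Sum>\<kappa>\<in>Q. g \<kappa> w * ?E s w) has_sum (\<Sum>\<kappa>\<in>Q. ser (g \<kappa>) s)) P"
      unfolding ser_def by (intro has_sum_sum has_sum_infsum that)
    then show ?thesis unfolding ser_def[of G] G_def sum_distrib_right by (rule infsumI)
  qed
  define c where "c m = (if m \<in> M then conv a (P \<inter> N') m else 0)" for m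
  have c: "c m = (\<Sum>\<kappa>\<in>Q. ?slice_coeff \<kappa> m)" if m: "m \<in> P" for m
  proof -
    have mQ: "m +o N' \<in> Q" using m P_subset_N by (auto simp: Q_def quot_group_def)
    have slice_coeff: "?slice_coeff \<kappa> m = (\<Sum>w\<in>{w\<in>below m. m \<in> ?slice \<kappa> w}. b \<kappa> w)" for \<kappa>
      by (rule coset_points.slice_coeff_def[OF cp])
    have off: "?slice_coeff \<kappa> m = 0" if "\<kappa> \<noteq> m +o N'" for \<kappa>
      unfolding slice_coeff slice using that by (intro sum.neutral) (auto simp: T_def)
    have "(\<Sum>\<kappa>\<in>Q. ?slice_coeff \<kappa> m) = (\<Sum>\<kappa>\<in>{m +o N'}. ?slice_coeff \<kappa> m)"
      using mQ finQ off by (intro sum.mono_neutral_right) auto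
    also have "\<dots> = ?slice_coeff (m +o N') m" by simp
    also have "\<dots> = c m"
    proof (cases "m \<in> M")
      case False
      then show ?thesis unfolding slice_coeff slice by (simp add: c_def T_def)
    next
      case True
      have "{w\<in>below m. m \<in> ?slice (m +o N') w} = below m"
        unfolding slice using True m by (auto simp: T_def below_def)
      moreover have "w +o N' = m +o N' \<longleftrightarrow> m - w \<in> N'" for w
        using subgroup_coset_eq_iff[OF N'(1), of m w] by metis
      ultimately have "?slice_coeff (m +o N') m = (\<Sum>w\<in>below m. if m - w \<in> N' then a w else 0)"
        unfolding slice_coeff b_def by simp
      also have "\<dots> = (\<Sum>w\<in>{w\<in>below m. m - w \<in> N'}. a w)"
        by (rule sum.inter_filter[OF finite_below, symmetric])
      also have "{w\<in>below m. m - w \<in> N'} = {w\<in>below m. m - w \<in> P \<inter> N'}"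
        using coset_points.belowD[OF cp _ m] by blast
      finally show ?thesis using True by (simp add: c_def conv_def)
    qed
    finally show ?thesis by simp
  qed
  have span: "\<Lambda> \<inter> span M \<inter> N' = L"
  proof (intro equalityI subsetI)
    fix x assume x: "x \<in> \<Lambda> \<inter> span M \<inter> N'"
    then have "x \<in> N" using N'N by blast
    moreover from this have "x \<in> M" using x saturated[OF M] by blast
    ultimately show "x \<in> L" using x by (simp add: L_def M'_def P_def)
  next
    fix x assume "x \<in> L"
    then show "x \<in> \<Lambda> \<inter> span M \<inter> N'" by (auto simp: L_def M'_def P_def span_base)
  qed
  have Lser: "Lser N' (\<Lambda> \<inter> span M) (\<lambda>_. 1) z = (\<Sum>\<^sub>\<infinity>l\<in>L. z l)" for z
    by (simp add: Lser_def span)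
  have ev: "(\<Sum>\<kappa>\<in>Q. ser (?slice_coeff \<kappa>) s - ser (g \<kappa>) s * (\<Sum>\<^sub>\<infinity>l\<in>L. ?E s l))
    = ?f s
       - ser G s * Lser N' (\<Lambda> \<inter> span M) (\<lambda>_. 1) (?E s)" if s: "s \<in> tube0" for s
  proof -
    have "((\<lambda>m. \<Sum>\<kappa>\<in>Q. ?slice_coeff \<kappa> m * ?E s m) has_sum (\<Sum>\<kappa>\<in>Q. ser (?slice_coeff \<kappa>) s)) P"
      unfolding ser_def by (intro has_sum_sum has_sum_infsum g(4)[OF s])
    then have "(\<Sum>\<^sub>\<infinity>m\<in>P. \<Sum>\<kappa>\<in>Q. ?slice_coeff \<kappa> m * ?E s m) = (\<Sum>\<kappa>\<in>Q. ser (?slice_coeff \<kappa>) s)" by (rule infsumI)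
    moreover have "ser c s = (\<Sum>\<^sub>\<infinity>m\<in>P. \<Sum>\<kappa>\<in>Q. ?slice_coeff \<kappa> m * ?E s m)"
      unfolding ser_def by (intro infsum_cong) (simp add: c sum_distrib_right)
    ultimately have "ser c s = (\<Sum>\<kappa>\<in>Q. ser (?slice_coeff \<kappa>) s)" by simp
    moreover have "ser G s = (\<Sum>\<kappa>\<in>Q. ser (g \<kappa>) s)"
      by (rule serG, rule abs_summable_summable, rule exp_summable_times_E[OF g(1) s])
    ultimately show ?thesis
      using torus_integral[OF a N'N s] unfolding c_def[abs_def, symmetric]
      by (simp add: Lser sum_subtractf sum_distrib_right)
  qed
  have "admissible_tube (1 - int (dim M)) (\<lambda>s. \<Sum>\<kappa>\<in>Q. ser (?slice_coeff \<kappa>) s - ser (g \<kappa>) s * (\<Sum>\<^sub>\<infinity>l\<in>L. ?E s l))"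
    by (intro admissible_tube_sum finQ g(2))
  then have adm: "admissible_tube (1 - int (dim M)) (\<lambda>s. ?f s
       - ser G s * Lser N' (\<Lambda> \<inter> span M) (\<lambda>_. 1) (?E s))"
    by (rule admissible_tube_cong) (rule ev)
  have "ser G 0 = Lser N \<Lambda> a (\<lambda>_. 1)"
    if supp: "\<forall>y\<in>\<Lambda> \<inter> N. a y \<noteq> 0 \<longrightarrow> y +o M \<in> (\<lambda>x. x +o M) ` N'"
  proof -
    have sb: "b \<kappa> summable_on P" for \<kappa>
      by (rule abs_summable_summable[OF exp_summable_norm[OF b]])
    have g0: "ser (g \<kappa>) 0 = (\<Sum>\<^sub>\<infinity>w\<in>P. b \<kappa> w)" for \<kappa>
      unfolding g(3)
    proof (rule infsum_cong_neutral)
      fix w assume w: "w \<in> P - {w\<in>P. ?slice \<kappa> w \<noteq> {}}"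
      show "b \<kappa> w = 0"
      proof (rule ccontr)
        assume "b \<kappa> w \<noteq> 0"
        then have \<kappa>: "w +o N' = \<kappa>" "a w \<noteq> 0" by (auto simp: b_def split: if_splits)
        have wP: "w \<in> P" "w \<in> N" using w P_subset_N by auto
        obtain n where n: "n \<in> N'" "w +o M = n +o M" using supp \<kappa>(2) wP by (auto simp: P_def)
        have wnM: "w - n \<in> M" using n(2) subgroup_coset_eq_iff[OF M(1)] by blast
        obtain k where k: "(\<Sum>i\<in>I. \<bar>co i n\<bar>) \<le> real k" using real_arch_simple by blast
        define m where "m = w - n + real k *\<^sub>R l0"
        have kl: "real k *\<^sub>R l0 \<in> M'" using subgroup_of_mult_int[OF sub l0M, of "int k"] by simp
        have mM: "m \<in> M"
          using subgroup_of_sum[OF M(1), of "{0, 1 :: nat}" "\<lambda>i. if i = 0 then w - n else real k *\<^sub>R l0"] kl wnM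
          by (simp add: m_def M'_def)
        have wm: "co i w \<le> co i m" if i: "i \<in> I" for i
        proof -
          have "\<bar>co i n\<bar> \<le> (\<Sum>i\<in>I. \<bar>co i n\<bar>)" using i finI by (intro member_le_sum) auto
          moreover have "real k * 1 \<le> real k * co i l0" using l0ge[OF i] by (intro mult_left_mono) auto
          ultimately show ?thesis using k by (simp add: m_def)
        qed
        have "m \<in> \<Lambda>" unfolding cone_iff using wm P_nonneg[OF wP(1)] order_trans by blast
        then have mP: "m \<in> P" using mM MN by (auto simp: P_def)
        have "m - w = real k *\<^sub>R l0 - n" by (simp add: m_def)
        then have "m - w \<in> N'" using kl n(1) N'(1) by (auto simp: M'_def subgroup_of_def)
        then have "m +o N' = \<kappa>" using subgroup_coset_eq_iff[OF N'(1)] \<kappa>(1) by blast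
        then have "m \<in> ?slice \<kappa> w" unfolding slice using mP mM wm by (auto simp: T_def)
        then show False using w by blast
      qed
    qed auto
    have "(\<lambda>w. g \<kappa> w * ?E 0 w) summable_on P" for \<kappa>
      using abs_summable_summable[OF exp_summable_norm[OF g(1)]] by (simp add: E_exp)
    then have "ser G 0 = (\<Sum>\<kappa>\<in>Q. \<Sum>\<^sub>\<infinity>w\<in>P. b \<kappa> w)" using serG g0 by simp
    also have "\<dots> = (\<Sum>\<^sub>\<infinity>w\<in>P. \<Sum>\<kappa>\<in>Q. b \<kappa> w)"
      by (rule infsumI[symmetric], intro has_sum_sum has_sum_infsum sb)
    also have "\<dots> = (\<Sum>\<^sub>\<infinity>w\<in>P. a w)"
    proof (rule infsum_cong)
      fix w assume w: "w \<in> P"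
      then have "w +o N' \<in> Q" using P_subset_N by (auto simp: Q_def quot_group_def)
      then show "(\<Sum>\<kappa>\<in>Q. b \<kappa> w) = a w" using finQ by (simp add: b_def)
    qed
    finally show ?thesis by (simp add: Lser_def P_def)
  qed
  then show ?thesis using that[OF G adm] by blast
qed

end

theorem mainTheorem3:
  fixes q :: nat
    and I :: "'i set" and lam :: "'i \<Rightarrow> 'v::real_normed_vector"
    and N \<Lambda> M N' :: "'v set"
    and a :: "'v \<Rightarrow> complex" and \<epsilon> :: real
    and dz :: "('v set \<Rightarrow> complex) measure"
    and f\<^sub>2 :: "('v \<Rightarrow>\<^sub>L complex) \<Rightarrow> complex"
  assumes q: "q = CARD('k::{field,finite})"
    and basis: "real_basis I lam"
    and N: "N = lattice_of I lam"
    and \<Lambda>: "\<Lambda> = basis_cone I lam"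
    and M: "subgroup_of M N" "torsion_free_quot N M"
    and N': "subgroup_of N' N" "finite_index N' N"
    and a: "\<epsilon> > 0"
      "\<forall>s\<in>tube (dual_cone_gt I lam (-\<epsilon>)). Lconv N \<Lambda> a (q_neg q s)"
    and dz: "haar_prob N M dz"
    and f2: "\<forall>s\<in>tube (dual_cone_gt I lam 0).
      f\<^sub>2 s = (\<integral>z. Lser N \<Lambda> a (\<lambda>y. z (y +o M) * q_neg q s y) *
                    Lser N' \<Lambda> (\<lambda>_. 1) (\<lambda>y. z (y +o M) * q_neg q s y) \<partial>dz)"
    and disj: "quot_dual_in_real_dual N M \<inter> dual_cone \<Lambda> = {0}"
  shows "(\<exists>g h. admissible I lam q 0 g \<and> admissible I lam q (1 - int (dim M)) h \<and>
            (\<forall>s\<in>tube (dual_cone_gt I lam 0).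
               h s = f\<^sub>2 s - g s * Lser N' (\<Lambda> \<inter> span M) (\<lambda>_. 1) (q_neg q s)))
       \<and> ((\<forall>y\<in>\<Lambda> \<inter> N. a y \<noteq> 0 \<longrightarrow> y +o M \<in> (\<lambda>x. x +o M) ` N') \<longrightarrow>
          (\<exists>g h. admissible I lam q 0 g \<and> admissible I lam q (1 - int (dim M)) h \<and>
            (\<forall>s\<in>tube (dual_cone_gt I lam 0).
               h s = f\<^sub>2 s - g s * Lser N' (\<Lambda> \<inter> span M) (\<lambda>_. 1) (q_neg q s)) \<and>
            g 0 = Lser N \<Lambda> a (\<lambda>_. 1)))"
proof -
  have "card {0, 1 :: 'k} \<le> CARD('k)" by (rule card_mono) auto
  then have "2 \<le> q" using q by simp
  then interpret dual_haar I lam q M dz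
    using basis M dz N by unfold_locales auto
  have "exp_summable a" using Lconv_imp_exp_summable[OF a(1)] a(2) N \<Lambda> by blast
  then obtain g where g: "exp_summable g"
    "admissible_tube (1 - int (dim M)) (\<lambda>s. (\<integral>z. Lser N \<Lambda> a (\<lambda>y. z (y +o M) * q_neg q s y) *
          Lser N' \<Lambda> (\<lambda>_. 1) (\<lambda>y. z (y +o M) * q_neg q s y) \<partial>dz)
       - ser g s * Lser N' (\<Lambda> \<inter> span M) (\<lambda>_. 1) (q_neg q s))"
    "(\<forall>y\<in>\<Lambda> \<inter> N. a y \<noteq> 0 \<longrightarrow> y +o M \<in> (\<lambda>x. x +o M) ` N') \<longrightarrow> ser g 0 = Lser N \<Lambda> a (\<lambda>_. 1)"
    using torus_integral_decomposition[of a N'] N' disj unfolding N \<Lambda> by blast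
  obtain h where h: "admissible I lam q (1 - int (dim M)) h"
    "\<forall>s\<in>tube (dual_cone_gt I lam 0). h s = f\<^sub>2 s - ser g s * Lser N' (\<Lambda> \<inter> span M) (\<lambda>_. 1) (q_neg q s)"
    using g(2) f2 unfolding admissible_tube_def by (metis (no_types, lifting))
  have "elementary_admissible I lam q 0 (ser g)"
    using exp_summable_admissible[OF g(1)] by (simp add: elementary_admissible_def ser_Lser[abs_def])
  then have "admissible I lam q 0 (ser g)"
    unfolding admissible_def by (intro exI[of _ "1::nat"] exI[of _ "\<lambda>_. ser g"]) auto
  then show ?thesis using h g(3) by blast
qed

end
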